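(* Consider a family of hidden Markov models indexed by $\theta\in\Theta$, as described in the context, satisfying the assumptions (H0), (H1), (H2), (H3) listed there. Assume moreover (H4): the signal distributions $(q_\beta)_{\beta\in\bar O}$ satisfy (i) for any $\beta,\beta'\in\bar O$, the measures $q_\beta$ and $q_{\beta'}$ are equivalent; (ii) $q_\beta(y)$ is continuous in $\beta\in\bar O$ for $\sigma$-a.e. $y\in S$; (iii) for any $\beta\in\bar O$, $\sup_{\beta'\in\bar O}\left|\log\frac{q_\beta(y)}{q_{\beta'}(y)}\right|\in L^1(q_\beta)$. Let $\hat\theta_n^{ME}$ be the maximum entropy estimator $$\hat\theta_n^{ME}=\arg\min_{\theta\in\Theta}\;-\frac1n\sum_{k=1}^n\log Q_\theta^{Y,2}(Y_{k-1},Y_k).$$ Then for any $\theta\in\Theta$ and any initial distribution $\nu$ of $X_0$, we have under $\mathbb{P}_{\theta,\nu}$, $$\hat\theta_n^{ME}\to\theta\quad\text{a.s. as }n\to\infty.$$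
   Context: Setting. $\mathbb{M}=\{1,\dots,m\}$ with $m\ge 2$. The signal space $S$ is either at most countable (with the discrete metric) or a Euclidean space $\mathbb{R}^l$ (with the Euclidean metric), with Borel $\sigma$-field $\mathcal{S}$; $\mathcal{M}_1(S)$ is the set of probability measures on $(S,\mathcal{S})$. $\{q_\beta:\beta\in\bar O\}\subset\mathcal{M}_1(S)$ is a family of probability measures $q_\beta(dy)=q_\beta(y)\,\sigma(dy)$, where $\sigma$ is some reference positive measure on $S$ (e.g. the counting measure or the Lebesgue measure, according to whether $S$ is at most countable or Euclidean). For each $\theta\in\Theta$ we have a stochastic matrix $P_\theta=(p_{ij}(\theta))_{i,j\in\mathbb{M}}$ and parameters $\beta_i(\theta)\in\bar O$, $i\in\mathbb{M}$. Under $\mathbb{P}_{\theta,\nu}$, the process $(X_n,Y_n)_{n\ge0}$ is the hidden Markov model: $(X_n)$ is a Markov chain on $\mathbb{M}$ with transition matrix $P_\theta$ and $X_0\sim\nu$, and conditionally on $X_0=x_0,\dots,X_n=x_n$, the $Y_0,\dots,Y_n$ are independent with $Y_k$ of law $q_{\beta_{x_k}(\theta)}$. Assumptions. (H0) $\Theta$ is the closure of a bounded open set $\Theta^0\subset\mathbb{R}^M$; $\bar O$ is the closure of a bounded open set $O\subset\mathbb{R}^d$, and $\beta_i(\theta)\in\bar O$ for all $i\in\mathbb{M}$, $\theta\in\Theta$; $\theta\mapsto((p_{ij}(\theta))_{i,j\in\mathbb{M}},(\beta_i(\theta))_{i\in\mathbb{M}})$ is continuous and injective on $\Theta$; $\beta\mapsto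 q_\beta$ is continuous from $\bar O$ to $\mathcal{M}_1(S)$ with the weak convergence topology. (H1) There are an integer $n_0\ge1$, $\kappa>0$ and a probability measure $\nu_0$ on $\mathbb{M}$ charging all states of $\mathbb{M}$ such that for any $\theta\in\Theta$, $P_\theta^{n_0}(i,j)\ge\kappa\nu_0(j)$ for all $i,j\in\mathbb{M}$. Consequently $P_\theta$ has a unique invariant probability measure $\mu_\theta$, and $\mu_\theta(i)>0$ for all $i$. (H2) (the hidden states are ordered by $(\beta_i=\beta_i(\theta))$) For any bijection $\tau:\mathbb{M}\to\mathbb{M}$, if $(\beta_{\tau(1)},\dots,\beta_{\tau(m)})=(\beta_1,\dots,\beta_m)$, then $\tau(i)=i$ for all $i\in\mathbb{M}$. In other words the hidden states are ordered by the parameters $(\beta_1,\dots,\beta_m)$. This implies that $\beta_i\ne\beta_j$ for different hidden states $i,j$. (H3) (identifiability of the hidden states) For $\beta_i,\tilde\beta_i\in\bar O$, $i=1,\dots,m$, if $\sum_{i=1}^mc_iq_{\beta_i}=\sum_{i=1}^m\tilde c_iq_{\tilde\beta_i}$ where $c_i,\tilde c_i\ge0$ and $\sum_ic_i=\sum_i\tilde c_i=1$, then $\sum_ic_i\delta_{\beta_i}=\sum_i\tilde c_i\delta_{\tilde\beta_i}$ ($\delta_\beta$ is the Dirac measure at $\beta$). Notation. $Q_\theta^{Y,2}(y,y')=\sum_{i,j\in\mathbb{M}}\mu_\theta(i)p_{ij}(\theta)q_{\beta_i(\theta)}(y)q_{\beta_j(\theta)}(y')$ is the density with respect to $\sigma(dy)\sigma(dy')$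 of the stationary law of $(Y_0,Y_1)$.
   Formalization: (H2) is taken across the whole family: if β_{τ(i)}(θ)=β_i(θ') for all i, with θ,θ' in Θ and τ a bijection, then τ is the identity; read for a single θ only, the claim fails by label switching of hidden states. *)

theory Defs
  imports "HOL-Probability.Probability"
begin

(* The signal space enters only through its topology, so a countable discrete space and R^l
   are described up to homeomorphism. *)
definition signal_space :: "'s::topological_space itself \<Rightarrow> bool" where
  "signal_space _ \<longleftrightarrow>
     (countable (UNIV :: 's set) \<and> (\<forall>A :: 's set. open A)) \<or>
     (\<exists>l. (euclidean :: 's topology) homeomorphic_space Euclidean_space l)"

definition signal_law :: "'s measure \<Rightarrow> ('b \<Rightarrow> 's \<Rightarrow> real) \<Rightarrow> 'b \<Rightarrow> 's measure" where
  "signal_law \<sigma> q \<beta> = density \<sigma> (\<lambda>y. ennreal (q \<beta> y))"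

(* Continuity on B, for the topology of weak convergence, of a family of probability measures. *)
definition weakly_continuous_on ::
    "'b::topological_space set \<Rightarrow> ('b \<Rightarrow> 's::topological_space measure) \<Rightarrow> bool" where
  "weakly_continuous_on B L \<longleftrightarrow>
     (\<forall>f :: 's \<Rightarrow> real. continuous_on UNIV f \<and> bounded (range f) \<longrightarrow>
        continuous_on B (\<lambda>\<beta>. \<integral>y. f y \<partial>L \<beta>))"

(* The state space {1,...,m} is a finite index type 'm; laws on it are values of type 'm pmf. *)

definition stochastic_matrix :: "real ^ 'm ^ 'm \<Rightarrow> bool" where
  "stochastic_matrix P \<longleftrightarrow> (\<forall>i j. 0 \<le> P $ i $ j) \<and> (\<forall>i. (\<Sum>j\<in>UNIV. P $ i $ j) = 1)"

(* Powers for the matrix product: the library's * and ^ on vectors act componentwise. *)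
definition mat_power :: "real ^ 'm ^ 'm \<Rightarrow> nat \<Rightarrow> real ^ 'm ^ 'm" where
  "mat_power P n = (((**) P) ^^ n) (mat 1)"

definition invariant_pmf :: "real ^ 'm ^ 'm \<Rightarrow> 'm pmf" where
  "invariant_pmf P = (THE \<mu>. \<forall>j. (\<Sum>i\<in>UNIV. pmf \<mu> i * P $ i $ j) = pmf \<mu> j)"

(* (X,Y) on the probability space M: X is a Markov chain with initial law \<nu> and transition
   matrix P; given X 0 = x 0, ..., X n = x n, the signals Y 0, ..., Y n are independent and
   Y k has law L (x k). *)
definition hidden_markov_model ::
    "'w measure \<Rightarrow> real ^ 'm ^ 'm \<Rightarrow> 'm pmf \<Rightarrow> ('m \<Rightarrow> 's::topological_space measure) \<Rightarrow>
     (nat \<Rightarrow> 'w \<Rightarrow> 'm::finite) \<Rightarrow> (nat \<Rightarrow> 'w \<Rightarrow> 's) \<Rightarrow> bool" where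
  "hidden_markov_model M P \<nu> L X Y \<longleftrightarrow>
     prob_space M \<and>
     (\<forall>n. X n \<in> measurable M (count_space UNIV)) \<and>
     (\<forall>n. Y n \<in> measurable M borel) \<and>
     distr M (count_space UNIV) (X 0) = measure_pmf \<nu> \<and>
     (\<forall>n x. 0 < \<P>(\<omega> in M. \<forall>k\<le>n. X k \<omega> = x k) \<longrightarrow>
        (\<forall>j. \<P>(\<omega> in M. X (Suc n) \<omega> = j \<bar> \<forall>k\<le>n. X k \<omega> = x k) = P $ x n $ j)) \<and>
     (\<forall>n x. 0 < \<P>(\<omega> in M. \<forall>k\<le>n. X k \<omega> = x k) \<longrightarrow>
        (let N = uniform_measure M {\<omega> \<in> space M. \<forall>k\<le>n. X k \<omega> = x k} in
           prob_space.indep_vars N (\<lambda>_. borel) Y {..n} \<and>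
           (\<forall>k\<le>n. distr N borel (Y k) = L (x k))))"

(* Logarithm of a nonnegative real, with log 0 = -\<infinity> (whereas ln 0 = 0 in the library). *)
definition elog :: "real \<Rightarrow> ereal" where
  "elog x = (if 0 < x then ereal (ln x) else - \<infinity>)"

(* The function in question is a supremum over an uncountable set, hence a priori only
   almost everywhere equal to a measurable function. *)
definition in_L1 :: "'s measure \<Rightarrow> ('s \<Rightarrow> ereal) \<Rightarrow> bool" where
  "in_L1 M f \<longleftrightarrow> (\<exists>g :: 's \<Rightarrow> real. integrable M g \<and> (AE y in M. f y = ereal (g y)))"

definition pair_density ::
    "real ^ 'm ^ 'm \<Rightarrow> 'b ^ 'm \<Rightarrow> ('b \<Rightarrow> 's \<Rightarrow> real) \<Rightarrow> 's \<Rightarrow> 's \<Rightarrow> real" where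
  "pair_density P b q y y' =
     (\<Sum>i\<in>UNIV. \<Sum>j\<in>UNIV. pmf (invariant_pmf P) i * P $ i $ j * q (b $ i) y * q (b $ j) y')"

definition empirical_entropy ::
    "real ^ 'm ^ 'm \<Rightarrow> 'b ^ 'm \<Rightarrow> ('b \<Rightarrow> 's \<Rightarrow> real) \<Rightarrow> nat \<Rightarrow> (nat \<Rightarrow> 's) \<Rightarrow> ereal" where
  "empirical_entropy P b q n y =
     - (ereal (1 / real n) * (\<Sum>k=1..n. elog (pair_density P b q (y (k - 1)) (y k))))"

end

theory Submission
  imports Defs
begin

text \<open>
  Dividing all signal densities by the one of a fixed parameter turns the criterion into an average of
  \<open>ln p\<^sub>t(Y\<^sub>k, Y\<^sub>k\<^sub>+\<^sub>1)\<close> with \<open>p\<^sub>t\<close> continuous in \<open>t\<close> and \<open>ln p\<^sub>t\<close> dominated, uniformly in \<open>t\<close>, by an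
  integrable function. These averages converge almost surely to their stationary means: by the Doeblin
  condition the covariances of truncated functions of pairs of signals decay geometrically, which is enough
  for Etemadi's proof of the strong law. By Gibbs' inequality the limit is maximal only at parameters with
  the same stationary law of two consecutive signals. This law determines \<open>\<theta>\<close>: its marginal gives the
  ordered signal parameters and the invariant law, and then, by identifiability of mixtures in each
  coordinate separately, the transition matrix. Wald's compactness argument concludes.
\<close>

section \<open>Stochastic matrices under a Doeblin condition\<close>

text \<open>The logarithms are only integrable and the chain starts from an arbitrary law, so
  neither square integrability nor stationarity is available. As there are finitely many hidden
  states, the means of truncated functions given two hidden states have one bound K, whatever the
  truncation level, so covariances at distance at least 2 are at most K^2 times the mixing rate.
  Second moments enter only at distances 0 and 1. The variance bound is thus of the form n * (a *
  (truncated second moment) + b), which Etemadi's argument absorbs. The assumptions on the densities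
  hold only almost everywhere, while suprema over uncountable parameter sets are best handled at
  every point. The normalized densities are therefore altered on a single null set, common to all
  parameters because the signal laws are equivalent. Almost surely no signal ever falls into it, and
  outside it all densities are positive, so that \<open>elog\<close> stays finite. The pair law
  fixes the parameters of the states only up to relabelling; (H2) excludes a relabelling, and the
  injectivity in (H0) then returns \<theta>.\<close>

lemma mat_power_0 [simp]: "mat_power P 0 = mat 1"
  by (simp add: mat_power_def)

lemma mat_power_Suc: "mat_power P (Suc n) = P ** mat_power P n"
  by (simp add: mat_power_def)

lemma mat_power_add: "mat_power P (a + b) = mat_power P a ** mat_power P b"
  by (induction a) (simp_all add: mat_power_Suc matrix_mul_assoc)

lemma stochastic_matrix_mat_1: "stochastic_matrix (mat 1 :: real ^ 'm::finite ^ 'm)"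
  by (simp add: stochastic_matrix_def mat_def)

lemma stochastic_matrix_mult:
  fixes A B :: "real ^ 'm::finite ^ 'm"
  assumes "stochastic_matrix A" "stochastic_matrix B"
  shows "stochastic_matrix (A ** B)"
proof -
  have "(\<Sum>j\<in>UNIV. \<Sum>k\<in>UNIV. A $ i $ k * B $ k $ j) = 1" for i
  proof -
    have "(\<Sum>j\<in>UNIV. \<Sum>k\<in>UNIV. A $ i $ k * B $ k $ j) = (\<Sum>k\<in>UNIV. A $ i $ k * (\<Sum>j\<in>UNIV. B $ k $ j))"
      by (subst sum.swap) (simp add: sum_distrib_left)
    then show ?thesis using assms by (simp add: stochastic_matrix_def)
  qed
  then show ?thesis
    using assms by (auto simp: stochastic_matrix_def matrix_matrix_mult_def intro!: sum_nonneg)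
qed

lemma stochastic_mat_power:
  fixes P :: "real ^ 'm::finite ^ 'm"
  assumes "stochastic_matrix P" shows "stochastic_matrix (mat_power P n)"
  by (induction n) (simp_all add: stochastic_matrix_mat_1 mat_power_Suc stochastic_matrix_mult assms)

text \<open>Removing the minorizing part \<open>\<kappa> * pmf \<nu>0 j\<close> from every row
  leaves nonnegative rows \<open>R\<close> of total mass 1 - \<kappa>. The removed part contributes
  the same number \<open>e\<close> to every entry of \<open>Q *v v\<close> and cancels in
  differences. The oscillation is expressed as a common bound \<open>c\<close> on all differences,
  so that the estimate can be iterated.\<close>

lemma doeblin_contraction:
  fixes Q :: "real ^ 'm::finite ^ 'm"
  assumes Q: "stochastic_matrix Q" and minor: "\<And>i j. \<kappa> * pmf \<nu>0 j \<le> Q $ i $ j"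
    and v: "\<And>i i'. v $ i - v $ i' \<le> c"
  shows "(Q *v v) $ i - (Q *v v) $ i' \<le> (1 - \<kappa>) * c"
proof -
  define R where "R i j = Q $ i $ j - \<kappa> * pmf \<nu>0 j" for i j
  define e where "e = (\<Sum>j\<in>UNIV. \<kappa> * pmf \<nu>0 j * v $ j)"
  have R0: "0 \<le> R i j" for i j using minor by (simp add: R_def)
  have "(\<Sum>j\<in>UNIV. pmf \<nu>0 j) = 1" by (rule sum_pmf_eq_1) auto
  then have R1: "(\<Sum>j\<in>UNIV. R i j) = 1 - \<kappa>" for i
    using Q by (simp add: R_def sum_subtractf stochastic_matrix_def flip: sum_distrib_left)
  have Qv: "(Q *v v) $ i = (\<Sum>j\<in>UNIV. R i j * v $ j) + e" for i
    by (simp add: R_def e_def matrix_vector_mult_def algebra_simps flip: sum.distrib)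
  obtain a where a: "\<And>j. v $ j \<le> v $ a"
    using ex_is_arg_min_if_finite[of UNIV "\<lambda>j. - v $ j"] by (auto simp: is_arg_min_linorder)
  obtain b where b: "\<And>j. v $ b \<le> v $ j"
    using ex_is_arg_min_if_finite[of UNIV "\<lambda>j. v $ j"] by (auto simp: is_arg_min_linorder)
  have "(\<Sum>j\<in>UNIV. R i j * v $ j) \<le> (1 - \<kappa>) * v $ a"
    unfolding R1[of i, symmetric] sum_distrib_right by (intro sum_mono mult_left_mono a R0)
  moreover have "(1 - \<kappa>) * v $ b \<le> (\<Sum>j\<in>UNIV. R i' j * v $ j)"
    unfolding R1[of i', symmetric] sum_distrib_right by (intro sum_mono mult_left_mono b R0)
  moreover have "0 \<le> 1 - \<kappa>"
    using R1[of i] R0 by (metis sum_nonneg)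
  then have "(1 - \<kappa>) * (v $ a - v $ b) \<le> (1 - \<kappa>) * c"
    using v by (intro mult_left_mono)
  ultimately show ?thesis by (simp add: Qv algebra_simps)
qed

lemma minorization_le_1:
  fixes Q :: "real ^ 'm::finite ^ 'm"
  assumes Q: "stochastic_matrix Q" and minor: "\<And>i j. \<kappa> * pmf \<nu>0 j \<le> Q $ i $ j"
  shows "\<kappa> \<le> 1"
proof -
  fix i
  have "(\<Sum>j\<in>UNIV. \<kappa> * pmf \<nu>0 j) \<le> (\<Sum>j\<in>UNIV. Q $ i $ j)"
    by (intro sum_mono minor)
  moreover have "(\<Sum>j\<in>UNIV. pmf \<nu>0 j) = 1" by (rule sum_pmf_eq_1) auto
  ultimately show ?thesis
    using Q by (simp add: stochastic_matrix_def flip: sum_distrib_left)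
qed

text \<open>Split n into blocks of n0 steps and a remainder: each block contracts the oscillation by
  1 - \<kappa>, and the remaining steps do not increase it.\<close>

lemma mat_power_contraction:
  fixes P :: "real ^ 'm::finite ^ 'm"
  assumes P: "stochastic_matrix P" and minor: "\<And>i j. \<kappa> * pmf \<nu>0 j \<le> mat_power P n0 $ i $ j"
    and v: "\<And>i i'. v $ i - v $ i' \<le> c"
  shows "(mat_power P n *v v) $ i - (mat_power P n *v v) $ i' \<le> (1 - \<kappa>) ^ (n div n0) * c"
proof -
  have "(mat_power P (n0 * k + r) *v v) $ i - (mat_power P (n0 * k + r) *v v) $ i' \<le> (1 - \<kappa>) ^ k * c"
    for k r i i'
  proof (induction k arbitrary: i i')
    case 0
    \<comment> \<open>With \<kappa> = 0 the minorization is mere nonnegativity, and the contraction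
      says that a stochastic matrix does not increase the oscillation;
      \<open>return_pmf undefined\<close> is a placeholder.\<close>
    show ?case
      using doeblin_contraction[OF stochastic_mat_power[OF P, of r], of 0 "return_pmf undefined" v c i i'] v
        stochastic_mat_power[OF P, of r]
      by (simp add: stochastic_matrix_def)
  next
    case (Suc k)
    have "mat_power P (n0 * Suc k + r) *v v = mat_power P n0 *v (mat_power P (n0 * k + r) *v v)"
      by (simp add: matrix_vector_mul_assoc flip: mat_power_add) (simp add: ac_simps)
    then show ?case
      using doeblin_contraction[OF stochastic_mat_power[OF P, of n0] minor Suc.IH, of i i']
      by (simp add: mult.assoc)
  qed
  from this[of "n div n0" "n mod n0" i i'] show ?thesis by simp
qed

lemma pmf_average_close:
  fixes \<mu> :: "'m::finite pmf" and v :: "'m \<Rightarrow> real"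
  assumes v: "\<And>i i'. v i - v i' \<le> c"
  shows "\<bar>(\<Sum>i\<in>UNIV. pmf \<mu> i * v i) - v k\<bar> \<le> c"
proof -
  have 1: "(\<Sum>i\<in>UNIV. pmf \<mu> i) = 1" by (rule sum_pmf_eq_1) auto
  then have "(\<Sum>i\<in>UNIV. pmf \<mu> i * v i) - v k = (\<Sum>i\<in>UNIV. pmf \<mu> i * (v i - v k))"
    by (simp add: right_diff_distrib sum_subtractf flip: sum_distrib_right)
  also have "\<bar>\<dots>\<bar> \<le> (\<Sum>i\<in>UNIV. pmf \<mu> i * c)"
    using v by (intro order_trans[OF sum_abs] sum_mono)
      (auto simp: abs_mult abs_le_iff intro!: mult_left_mono)
  also have "\<dots> = c" by (simp add: 1 flip: sum_distrib_right)
  finally show ?thesis .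
qed

section \<open>Existence, uniqueness, positivity and continuity of the invariant law\<close>

lemma ex_pmf_of_vec:
  fixes w :: "real ^ 'm::finite"
  assumes "\<And>i. 0 \<le> w $ i" "(\<Sum>i\<in>UNIV. w $ i) = 1"
  obtains \<mu> :: "'m pmf" where "\<And>i. pmf \<mu> i = w $ i"
proof
  have "(\<integral>\<^sup>+x. ennreal (w $ x) \<partial>count_space UNIV) = 1"
    using assms by (simp add: nn_integral_count_space_finite)
  then show "pmf (embed_pmf (\<lambda>i. w $ i)) i = w $ i" for i
    using assms by (intro pmf_embed_pmf) auto
qed

lemma compact_simplex: "compact {w :: real ^ 'm::finite. (\<forall>i. 0 \<le> w $ i) \<and> (\<Sum>i\<in>UNIV. w $ i) = 1}"
  (is "compact ?S")
proof -
  have "?S \<subseteq> cbox 0 1"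
  proof
    fix w assume w: "w \<in> ?S"
    then have "w $ i \<le> (\<Sum>i\<in>UNIV. w $ i)" for i by (intro member_le_sum) auto
    with w show "w \<in> cbox 0 1" by (auto simp: mem_box_cart)
  qed
  moreover have "closed ?S"
    by (intro closed_Collect_conj closed_Collect_all closed_Collect_le closed_Collect_eq continuous_intros)
  ultimately show ?thesis
    using bounded_subset[OF bounded_cbox] by (auto simp: compact_eq_bounded_closed)
qed

text \<open>Brouwer's fixed point theorem on the simplex, for the map that sends w to w P.\<close>

lemma ex_invariant:
  fixes P :: "real ^ 'm::finite ^ 'm"
  assumes P: "stochastic_matrix P"
  shows "\<exists>\<mu> :: 'm pmf. \<forall>j. (\<Sum>i\<in>UNIV. pmf \<mu> i * P $ i $ j) = pmf \<mu> j"
proof -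
  define S where "S = {w :: real ^ 'm. (\<forall>i. 0 \<le> w $ i) \<and> (\<Sum>i\<in>UNIV. w $ i) = 1}"
  have "compact S" unfolding S_def by (rule compact_simplex)
  moreover have "convex S"
    unfolding S_def convex_def
    by (auto simp: sum.distrib simp flip: sum_distrib_left intro!: add_nonneg_nonneg)
  moreover have "axis undefined 1 \<in> S"
    by (auto simp: S_def axis_def)
  then have "S \<noteq> {}" by blast
  moreover have "continuous_on S (\<lambda>w. w v* P)"
    unfolding vector_matrix_mult_def by (intro continuous_intros continuous_on_vec_lambda)
  moreover have "(\<lambda>w. w v* P) \<in> S \<rightarrow> S"
  proof
    fix w assume w: "w \<in> S"
    have "(\<Sum>j\<in>UNIV. \<Sum>i\<in>UNIV. w $ i * P $ i $ j) = (\<Sum>i\<in>UNIV. w $ i * (\<Sum>j\<in>UNIV. P $ i $ j))"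
      by (subst sum.swap) (simp only: sum_distrib_left)
    also have "\<dots> = 1" using w P by (simp add: S_def stochastic_matrix_def)
    finally have "(\<Sum>j\<in>UNIV. (w v* P) $ j) = 1"
      by (simp add: vector_matrix_mult_def)
    moreover have "0 \<le> (w v* P) $ j" for j
      using w P unfolding vector_matrix_mult_def S_def stochastic_matrix_def
      by (simp add: sum_nonneg)
    ultimately show "w v* P \<in> S" by (simp add: S_def)
  qed
  ultimately obtain w where w: "w \<in> S" "w v* P = w" using brouwer by metis
  then obtain \<mu> :: "'m pmf" where "\<And>i. pmf \<mu> i = w $ i"
    using ex_pmf_of_vec unfolding S_def by blast
  moreover have "(\<Sum>i\<in>UNIV. w $ i * P $ i $ j) = w $ j" for j
    using arg_cong[OF w(2), of "\<lambda>w. w $ j"] by (simp add: vector_matrix_mult_def)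
  ultimately show ?thesis by (intro exI[of _ \<mu>]) simp
qed

lemma invariant_mat_power:
  fixes P :: "real ^ 'm::finite ^ 'm"
  assumes inv: "\<And>j. (\<Sum>i\<in>UNIV. pmf \<mu> i * P $ i $ j) = pmf \<mu> j"
  shows "(\<Sum>i\<in>UNIV. pmf \<mu> i * (mat_power P n *v v) $ i) = (\<Sum>i\<in>UNIV. pmf \<mu> i * v $ i)"
proof (induction n)
  case (Suc n)
  have "(\<Sum>i\<in>UNIV. pmf \<mu> i * (P *v u) $ i) = (\<Sum>j\<in>UNIV. (\<Sum>i\<in>UNIV. pmf \<mu> i * P $ i $ j) * u $ j)" for u
    unfolding matrix_vector_mult_def sum_distrib_right
    by (subst sum.swap) (simp add: sum_distrib_left mult.assoc)
  with Suc inv show ?case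
    by (simp add: mat_power_Suc flip: matrix_vector_mul_assoc)
qed simp

text \<open>By invariance the \<mu>-average of \<open>v\<close> is also that of
  \<open>mat_power P n *v v\<close>, and an average lies within the oscillation of each
  entry.\<close>

lemma mat_power_close_invariant:
  fixes P :: "real ^ 'm::finite ^ 'm"
  assumes P: "stochastic_matrix P" and minor: "\<And>i j. \<kappa> * pmf \<nu>0 j \<le> mat_power P n0 $ i $ j"
    and inv: "\<And>j. (\<Sum>i\<in>UNIV. pmf \<mu> i * P $ i $ j) = pmf \<mu> j"
    and v: "\<And>i i'. v $ i - v $ i' \<le> c"
  shows "\<bar>(\<Sum>i\<in>UNIV. pmf \<mu> i * v $ i) - (mat_power P n *v v) $ k\<bar> \<le> (1 - \<kappa>) ^ (n div n0) * c"
  using pmf_average_close[of "\<lambda>i. (mat_power P n *v v) $ i", OF mat_power_contraction[OF P minor v]]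
  by (subst invariant_mat_power[OF inv, symmetric, of _ n])

lemma mat_power_entry_close_invariant:
  fixes P :: "real ^ 'm::finite ^ 'm"
  assumes P: "stochastic_matrix P" and minor: "\<And>i j. \<kappa> * pmf \<nu>0 j \<le> mat_power P n0 $ i $ j"
    and inv: "\<And>j. (\<Sum>i\<in>UNIV. pmf \<mu> i * P $ i $ j) = pmf \<mu> j"
  shows "\<bar>pmf \<mu> j - mat_power P n $ i $ j\<bar> \<le> (1 - \<kappa>) ^ (n div n0)"
proof -
  have "axis j 1 $ i - axis j 1 $ i' \<le> (1::real)" for i i' by (simp add: axis_def)
  from mat_power_close_invariant[OF P minor inv this, where n = n and k = i]
  show ?thesis
    by (simp add: matrix_vector_mult_basis column_def) (simp add: axis_def if_distrib cong: if_cong)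
qed

lemma doeblin_rate_tendsto_0:
  assumes "0 < \<kappa>" "\<kappa> \<le> 1" "1 \<le> n0"
  shows "(\<lambda>n. (1 - \<kappa> :: real) ^ (n div n0)) \<longlonglongrightarrow> 0"
proof -
  have "filterlim (\<lambda>n. n div n0) at_top sequentially"
    unfolding filterlim_at_top eventually_sequentially
  proof (intro allI exI impI)
    fix Z n assume "Z * n0 \<le> n"
    then show "Z \<le> n div n0" using assms(3) by (simp add: less_eq_div_iff_mult_less_eq)
  qed
  moreover have "(\<lambda>n. (1 - \<kappa> :: real) ^ n) \<longlonglongrightarrow> 0"
    using assms by (intro LIMSEQ_power_zero) auto
  ultimately show ?thesis by (rule filterlim_compose[rotated])
qed

text \<open>\<open>invariant_pmf\<close> is a definite description, so uniqueness has to be shown: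
  every invariant law is the limit of the entries of the powers of \<open>P\<close>.\<close>

lemma invariant_pmf_invariant:
  fixes P :: "real ^ 'm::finite ^ 'm"
  assumes P: "stochastic_matrix P" and minor: "\<And>i j. \<kappa> * pmf \<nu>0 j \<le> mat_power P n0 $ i $ j"
    and "0 < \<kappa>" "1 \<le> n0"
  shows "(\<Sum>i\<in>UNIV. pmf (invariant_pmf P) i * P $ i $ j) = pmf (invariant_pmf P) j"
proof -
  have \<kappa>1: "\<kappa> \<le> 1" using minorization_le_1[OF stochastic_mat_power[OF P] minor] .
  have lim: "(\<lambda>n. mat_power P n $ i $ j) \<longlonglongrightarrow> pmf \<mu> j"
    if "\<And>j. (\<Sum>i\<in>UNIV. pmf \<mu> i * P $ i $ j) = pmf \<mu> j" for \<mu> i j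
  proof (rule Lim_transform_bound[OF _ doeblin_rate_tendsto_0, THEN LIM_zero_cancel])
    show "\<forall>\<^sub>F n in sequentially. norm (mat_power P n $ i $ j - pmf \<mu> j) \<le> norm ((1 - \<kappa>) ^ (n div n0))"
      using mat_power_entry_close_invariant[OF P minor that] \<kappa>1
      by (intro always_eventually allI) (simp add: abs_minus_commute)
  qed (use assms \<kappa>1 in auto)
  have "\<exists>!\<mu>. \<forall>j. (\<Sum>i\<in>UNIV. pmf \<mu> i * P $ i $ j) = pmf \<mu> j"
  proof (rule ex_ex1I[OF ex_invariant[OF P]])
    fix \<mu> \<mu>' :: "'m pmf"
    assume "\<forall>j. (\<Sum>i\<in>UNIV. pmf \<mu> i * P $ i $ j) = pmf \<mu> j"
      and "\<forall>j. (\<Sum>i\<in>UNIV. pmf \<mu>' i * P $ i $ j) = pmf \<mu>' j"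
    then show "\<mu> = \<mu>'" by (intro pmf_eqI LIMSEQ_unique[OF lim lim]) auto
  qed
  from theI'[OF this] show ?thesis unfolding invariant_pmf_def by blast
qed

text \<open>The invariant law is also invariant under the power n0, and every entry in column j of
  that power is at least \<open>\<kappa> * pmf \<nu>0 j\<close>.\<close>

lemma invariant_pmf_pos:
  fixes P :: "real ^ 'm::finite ^ 'm"
  assumes P: "stochastic_matrix P" and minor: "\<And>i j. \<kappa> * pmf \<nu>0 j \<le> mat_power P n0 $ i $ j"
    and "0 < \<kappa>" "1 \<le> n0" "0 < pmf \<nu>0 j"
  shows "0 < pmf (invariant_pmf P) j"
proof -
  let ?\<mu> = "invariant_pmf P"
  have 1: "(\<Sum>i\<in>UNIV. pmf ?\<mu> i) = 1" by (rule sum_pmf_eq_1) auto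
  have "0 < \<kappa> * pmf \<nu>0 j" using assms by simp
  also have "\<dots> = (\<Sum>i\<in>UNIV. pmf ?\<mu> i * (\<kappa> * pmf \<nu>0 j))"
    by (simp add: 1 flip: sum_distrib_right)
  also have "\<dots> \<le> (\<Sum>i\<in>UNIV. pmf ?\<mu> i * mat_power P n0 $ i $ j)"
    by (intro sum_mono mult_left_mono minor) auto
  also have "\<dots> = pmf ?\<mu> j"
    using invariant_mat_power[OF invariant_pmf_invariant[OF P minor assms(3,4)], of n0 "axis j 1"]
    by (simp add: matrix_vector_mult_basis column_def) (simp add: axis_def if_distrib cong: if_cong)
  finally show ?thesis .
qed

lemma continuous_on_mat_power:
  fixes P :: "'a::topological_space \<Rightarrow> real ^ 'm::finite ^ 'm"
  assumes "continuous_on T P"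
  shows "continuous_on T (\<lambda>t. mat_power (P t) n $ i $ j)"
proof (induction n arbitrary: i j)
  case (Suc n)
  have "continuous_on T (\<lambda>t. \<Sum>k\<in>UNIV. P t $ i $ k * mat_power (P t) n $ k $ j)"
    by (intro continuous_intros assms Suc)
  then show ?case by (simp add: mat_power_Suc matrix_matrix_mult_def)
qed simp

text \<open>The rate at which the powers of \<open>P t\<close> approach the invariant law depends
  only on \<kappa> and n0, so the convergence is uniform in t and continuity passes to the
  limit.\<close>

lemma continuous_on_invariant_pmf:
  fixes P :: "'a::topological_space \<Rightarrow> real ^ 'm::finite ^ 'm"
  assumes "continuous_on T P" and P: "\<And>t. t \<in> T \<Longrightarrow> stochastic_matrix (P t)"
    and minor: "\<And>t i j. t \<in> T \<Longrightarrow> \<kappa> * pmf \<nu>0 j \<le> mat_power (P t) n0 $ i $ j"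
    and "0 < \<kappa>" "1 \<le> n0"
  shows "continuous_on T (\<lambda>t. pmf (invariant_pmf (P t)) j)"
proof (cases "T = {}")
  case False
  then obtain t0 where "t0 \<in> T" by blast
  then have \<kappa>1: "\<kappa> \<le> 1" using minorization_le_1[OF stochastic_mat_power[OF P] minor] by blast
  fix i
  show ?thesis
  proof (rule uniform_limit_theorem)
    show "\<forall>\<^sub>F n in sequentially. continuous_on T (\<lambda>t. mat_power (P t) n $ i $ j)"
      by (intro always_eventually allI continuous_on_mat_power assms)
    show "uniform_limit T (\<lambda>n t. mat_power (P t) n $ i $ j) (\<lambda>t. pmf (invariant_pmf (P t)) j) sequentially"
    proof (rule uniform_limitI)
      fix e :: real assume "0 < e"
      have "\<forall>\<^sub>F n in sequentially. (1 - \<kappa>) ^ (n div n0) < e"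
        using doeblin_rate_tendsto_0[of \<kappa> n0] assms \<kappa>1 \<open>0 < e\<close> by (intro order_tendstoD) auto
      then show "\<forall>\<^sub>F n in sequentially. \<forall>t\<in>T. dist (mat_power (P t) n $ i $ j) (pmf (invariant_pmf (P t)) j) < e"
      proof eventually_elim
        case (elim n)
        show ?case
        proof
          fix t assume t: "t \<in> T"
          show "dist (mat_power (P t) n $ i $ j) (pmf (invariant_pmf (P t)) j) < e"
            using mat_power_entry_close_invariant[OF P[OF t] minor[OF t]
                invariant_pmf_invariant[OF P[OF t] minor[OF t] assms(4,5)], where i = i and j = j and n = n] elim
            by (simp add: dist_real_def abs_minus_commute)
        qed
      qed
    qed
  qed simp
qed simp

section \<open>Etemadi's strong law of large numbers\<close>

lemma cesaro_mean:
  fixes a :: "nat \<Rightarrow> real"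
  assumes "a \<longlonglongrightarrow> l"
  shows "(\<lambda>n. (\<Sum>k<n. a k) / real n) \<longlonglongrightarrow> l"
proof (rule LIMSEQ_I)
  fix e :: real assume e: "0 < e"
  obtain N where N: "\<And>n. N \<le> n \<Longrightarrow> \<bar>a n - l\<bar> < e / 2"
    using LIMSEQ_D[OF assms, of "e / 2"] e by auto
  define C where "C = (\<Sum>k<N. \<bar>a k - l\<bar>)"
  obtain N' :: nat where N': "2 * C / e < real N'" using reals_Archimedean2 by blast
  show "\<exists>no. \<forall>n\<ge>no. norm ((\<Sum>k<n. a k) / real n - l) < e"
  proof (intro exI allI impI)
    fix n assume n: "max (Suc N) N' \<le> n"
    have "\<bar>(\<Sum>k<n. a k) - real n * l\<bar> = \<bar>\<Sum>k<n. a k - l\<bar>"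
      by (simp add: sum_subtractf)
    also have "\<dots> \<le> (\<Sum>k<n. \<bar>a k - l\<bar>)" by (rule sum_abs)
    also have "\<dots> = C + (\<Sum>k\<in>{N..<n}. \<bar>a k - l\<bar>)"
      unfolding C_def using n by (subst sum.union_disjoint[symmetric]) (auto intro!: sum.cong)
    also have "(\<Sum>k\<in>{N..<n}. \<bar>a k - l\<bar>) \<le> (\<Sum>k\<in>{N..<n}. e / 2)"
      using N by (intro sum_mono less_imp_le) auto
    also have "\<dots> \<le> real n * (e / 2)" using n e by (simp add: mult_right_mono)
    finally have 1: "\<bar>(\<Sum>k<n. a k) - real n * l\<bar> \<le> C + real n * (e / 2)" by simp
    have "2 * C / e < real n" using n N' by linarith
    then have "C < real n * (e / 2)" using e by (simp add: field_simps)
    with 1 have 2: "\<bar>(\<Sum>k<n. a k) - real n * l\<bar> < real n * e" by (simp add: field_simps)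
    have "(\<Sum>k<n. a k) / real n - l = ((\<Sum>k<n. a k) - real n * l) / real n"
      using n by (simp add: field_simps)
    then have "norm ((\<Sum>k<n. a k) / real n - l) = \<bar>(\<Sum>k<n. a k) - real n * l\<bar> / real n"
      by simp
    also have "\<dots> < e" using 2 n by (simp add: field_simps)
    finally show "norm ((\<Sum>k<n. a k) / real n - l) < e" .
  qed
qed

text \<open>The series of the \<open>f r\<close> has a finite integral by monotone convergence,
  hence it converges at almost every point.\<close>

lemma AE_tendsto_0_of_summable_integrals:
  fixes f :: "nat \<Rightarrow> 'w \<Rightarrow> real"
  assumes int: "\<And>r. integrable M (f r)" and nonneg: "\<And>r x. 0 \<le> f r x"
    and sm: "summable (\<lambda>r. \<integral>x. f r x \<partial>M)"
  shows "AE x in M. (\<lambda>r. f r x) \<longlonglongrightarrow> 0"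
proof -
  have [measurable]: "\<And>r. f r \<in> borel_measurable M" using int by auto
  have "(\<integral>\<^sup>+x. (\<Sum>r. ennreal (f r x)) \<partial>M) = (\<Sum>r. \<integral>\<^sup>+x. ennreal (f r x) \<partial>M)"
    by (rule nn_integral_suminf) simp
  also have "\<dots> = (\<Sum>r. ennreal (\<integral>x. f r x \<partial>M))"
    using int nonneg by (simp add: nn_integral_eq_integral)
  also have "\<dots> \<noteq> \<infinity>"
    using sm nonneg by (simp add: suminf_ennreal2)
  finally have "AE x in M. (\<Sum>r. ennreal (f r x)) \<noteq> \<infinity>"
    by (intro nn_integral_PInf_AE) auto
  then show ?thesis
  proof eventually_elim
    case (elim x)
    then have "summable (\<lambda>r. f r x)" by (intro summable_suminf_not_top nonneg) auto
    then show ?case by (rule summable_LIMSEQ_zero)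
  qed
qed

text \<open>Later x is a value of the function to be averaged. The exponents that survive truncation
  start where \<alpha>^r reaches x, and the geometric tail from there on is at most
  \<open>\<alpha> / (\<alpha> - 1) / x\<close>.\<close>

lemma sum_truncated_geometric_le:
  fixes \<alpha> x :: real
  assumes "1 < \<alpha>" "0 < x"
  shows "(\<Sum>r<N. if x \<le> \<alpha> ^ r then 1 / \<alpha> ^ r else 0) \<le> \<alpha> / (\<alpha> - 1) / x"
proof -
  \<comment> \<open>Each term is dominated by a multiple of an increment of \<open>h\<close>, so the sum telescopes.\<close>
  define h where "h r = min (1 / x) (1 / \<alpha> ^ r)" for r
  have "(if x \<le> \<alpha> ^ r then 1 / \<alpha> ^ r else 0) \<le> \<alpha> / (\<alpha> - 1) * (h r - h (Suc r))" for r
  proof (cases "x \<le> \<alpha> ^ r")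
    case True
    also have "\<alpha> ^ r \<le> \<alpha> ^ Suc r" using assms by (intro power_increasing) auto
    finally have "x \<le> \<alpha> ^ Suc r" .
    with True assms have "1 / \<alpha> ^ r \<le> 1 / x" "1 / \<alpha> ^ Suc r \<le> 1 / x"
      by (intro divide_left_mono; simp)+
    then have "h r = 1 / \<alpha> ^ r" "h (Suc r) = 1 / \<alpha> ^ Suc r"
      by (simp_all add: h_def min_absorb2 del: power_Suc)
    then show ?thesis using True assms by (simp add: field_simps)
  next
    case False
    have "1 / \<alpha> ^ Suc r \<le> 1 / \<alpha> ^ r"
      using assms by (intro divide_left_mono power_increasing) auto
    then have "h (Suc r) \<le> h r" by (auto simp: h_def)
    then show ?thesis using False assms by simp
  qed
  then have "(\<Sum>r<N. if x \<le> \<alpha> ^ r then 1 / \<alpha> ^ r else 0) \<le> (\<Sum>r<N. \<alpha> / (\<alpha> - 1) * (h r - h (Suc r)))"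
    by (intro sum_mono)
  also have "\<dots> = \<alpha> / (\<alpha> - 1) * (h 0 - h N)"
    by (simp only: sum_distrib_left[symmetric] sum_lessThan_telescope')
  also have "\<dots> \<le> \<alpha> / (\<alpha> - 1) * (1 / x)"
  proof (intro mult_left_mono)
    have "h 0 \<le> 1 / x" "0 \<le> h N" using assms by (simp_all add: h_def)
    then show "h 0 - h N \<le> 1 / x" by linarith
  qed (use assms in auto)
  finally show ?thesis by simp
qed

section \<open>Averages along geometric sequences and the passage back to all n\<close>

definition geom_floor :: "real \<Rightarrow> nat \<Rightarrow> nat" where
  "geom_floor \<alpha> r = nat \<lfloor>\<alpha> ^ r\<rfloor>"

lemma geom_floor_bounds:
  assumes "1 < \<alpha>"
  shows "1 \<le> geom_floor \<alpha> r" "real (geom_floor \<alpha> r) \<le> \<alpha> ^ r" "\<alpha> ^ r < real (geom_floor \<alpha> r) + 1"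
    "\<alpha> ^ r / 2 \<le> real (geom_floor \<alpha> r)"
proof -
  have 1: "1 \<le> \<alpha> ^ r" using assms by (intro one_le_power) auto
  then show g1: "1 \<le> geom_floor \<alpha> r" by (simp add: geom_floor_def le_nat_iff)
  show "real (geom_floor \<alpha> r) \<le> \<alpha> ^ r" using 1 by (simp add: geom_floor_def)
  show l: "\<alpha> ^ r < real (geom_floor \<alpha> r) + 1" using 1 unfolding geom_floor_def by linarith
  show "\<alpha> ^ r / 2 \<le> real (geom_floor \<alpha> r)" using l g1 by linarith
qed

lemma geom_floor_ratio:
  assumes \<alpha>: "1 < \<alpha>"
  shows "(\<lambda>r. real (geom_floor \<alpha> (Suc r)) / real (geom_floor \<alpha> r)) \<longlonglongrightarrow> \<alpha>"
proof -
  have 0: "(\<lambda>r. (1 / \<alpha>) ^ r) \<longlonglongrightarrow> 0"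
    using \<alpha> by (intro LIMSEQ_power_zero) auto
  have l: "(\<lambda>r. \<alpha> - (1 / \<alpha>) ^ r) \<longlonglongrightarrow> \<alpha>"
    using tendsto_diff[OF tendsto_const 0, of \<alpha>] by simp
  have u: "(\<lambda>r. \<alpha> / (1 - (1 / \<alpha>) ^ r)) \<longlonglongrightarrow> \<alpha>"
    using tendsto_divide[OF tendsto_const tendsto_diff[OF tendsto_const 0], of 1 \<alpha>] by simp
  show ?thesis
  proof (rule tendsto_sandwich[OF _ _ l u])
    show "\<forall>\<^sub>F r in sequentially. \<alpha> - (1 / \<alpha>) ^ r
            \<le> real (geom_floor \<alpha> (Suc r)) / real (geom_floor \<alpha> r)"
    proof (intro always_eventually allI)
      fix r
      have "\<alpha> - (1 / \<alpha>) ^ r = (\<alpha> ^ Suc r - 1) / \<alpha> ^ r"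
        using \<alpha> by (simp add: power_one_over field_simps)
      also have "\<dots> \<le> (\<alpha> ^ Suc r - 1) / real (geom_floor \<alpha> r)"
        using geom_floor_bounds[OF \<alpha>, of r] \<alpha> one_le_power[of \<alpha> "Suc r"]
        by (intro divide_left_mono) auto
      also have "\<dots> \<le> real (geom_floor \<alpha> (Suc r)) / real (geom_floor \<alpha> r)"
        using geom_floor_bounds(3)[OF \<alpha>, of "Suc r"] by (intro divide_right_mono) auto
      finally show "\<alpha> - (1 / \<alpha>) ^ r \<le> real (geom_floor \<alpha> (Suc r)) / real (geom_floor \<alpha> r)" .
    qed
    show "\<forall>\<^sub>F r in sequentially. real (geom_floor \<alpha> (Suc r)) / real (geom_floor \<alpha> r)
            \<le> \<alpha> / (1 - (1 / \<alpha>) ^ r)"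
      unfolding eventually_sequentially
    proof (intro exI[of _ 1] allI impI)
      fix r :: nat assume "1 \<le> r"
      then have g1: "1 < \<alpha> ^ r" using \<alpha> by (intro one_less_power) auto
      have "real (geom_floor \<alpha> (Suc r)) / real (geom_floor \<alpha> r) \<le> \<alpha> ^ Suc r / real (geom_floor \<alpha> r)"
        using geom_floor_bounds(2)[OF \<alpha>, of "Suc r"] by (intro divide_right_mono) auto
      also have "\<dots> \<le> \<alpha> ^ Suc r / (\<alpha> ^ r - 1)"
        using geom_floor_bounds(1,3)[OF \<alpha>, of r] g1 \<alpha> by (intro divide_left_mono) auto
      also have "\<dots> = \<alpha> / (1 - (1 / \<alpha>) ^ r)"
        using \<alpha> g1 by (simp add: power_one_over divide_simps)
      finally show "real (geom_floor \<alpha> (Suc r)) / real (geom_floor \<alpha> r) \<le> \<alpha> / (1 - (1 / \<alpha>) ^ r)" .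
    qed
  qed
qed

text \<open>Any n lies between consecutive terms g r and g (r + 1), so monotonicity squeezes s n / n
  between s (g r) / g (r + 1) and s (g (r + 1)) / g r, whose limits are m / \<alpha> and m *
  \<alpha>. Only the countably many ratios 1 + 1 / (j + 1) are used, so that almost sure statements
  about them can be combined.\<close>

lemma LIMSEQ_of_geom_floor:
  fixes s :: "nat \<Rightarrow> real"
  assumes mono: "\<And>i k. i \<le> k \<Longrightarrow> s i \<le> s k" and s0: "0 \<le> s 0"
    and lim: "\<And>j. (\<lambda>r. s (geom_floor (1 + 1 / real (Suc j)) r) /
                     real (geom_floor (1 + 1 / real (Suc j)) r)) \<longlonglongrightarrow> m"
  shows "(\<lambda>n. s n / real n) \<longlonglongrightarrow> m"
proof -
  define \<alpha> where "\<alpha> j = 1 + 1 / real (Suc j)" for j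
  have \<alpha>1: "1 < \<alpha> j" for j by (simp add: \<alpha>_def)
  have \<alpha>_lim: "\<alpha> \<longlonglongrightarrow> 1"
    unfolding \<alpha>_def using tendsto_add[OF tendsto_const LIMSEQ_inverse_real_of_nat, of 1]
    by (simp add: inverse_eq_divide)
  have s_nonneg: "0 \<le> s n" for n using mono[of 0 n] s0 by simp
  \<comment> \<open>The disjunctions are implications: a number strictly beyond m * \<alpha> or m /
    \<alpha> is eventually respected by s n / n.\<close>
  have bounds: "(\<forall>\<^sub>F n in sequentially. s n / real n < a) \<or> \<not> m * \<alpha> j < a"
    "(\<forall>\<^sub>F n in sequentially. a < s n / real n) \<or> \<not> a < m / \<alpha> j" for a j
  proof -
    let ?g = "geom_floor (\<alpha> j)"
    have g_pos: "?g r \<noteq> 0" for r using geom_floor_bounds(1)[OF \<alpha>1[of j], of r] by simp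
    \<comment> \<open>\<open>R n\<close> is the exponent with
      \<open>\<alpha> j ^ R n \<le> n < \<alpha> j ^ Suc (R n)\<close>.\<close>
    define R where "R n = nat \<lfloor>log (\<alpha> j) (real n)\<rfloor>" for n
    have R: "?g (R n) \<le> n" "n \<le> ?g (Suc (R n))" if "1 \<le> n" for n
    proof -
      have "0 \<le> log (\<alpha> j) (real n)" using that \<alpha>1 by simp
      then have "real (R n) \<le> log (\<alpha> j) (real n)" "log (\<alpha> j) (real n) < real (Suc (R n))"
        unfolding R_def by linarith+
      then have "\<alpha> j powr real (R n) \<le> real n" "real n < \<alpha> j powr real (Suc (R n))"
        using that \<alpha>1[of j] by (simp_all add: le_log_iff log_less_iff)
      then have *: "\<alpha> j ^ R n \<le> real n" "real n < \<alpha> j ^ Suc (R n)"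
        using \<alpha>1[of j] by (simp_all add: powr_realpow del: of_nat_Suc power_Suc)
      show "?g (R n) \<le> n" using *(1) geom_floor_bounds(2)[OF \<alpha>1[of j], of "R n"] by linarith
      show "n \<le> ?g (Suc (R n))" using *(2) unfolding geom_floor_def by linarith
    qed
    have R_lim: "filterlim R at_top sequentially"
      unfolding filterlim_at_top eventually_sequentially
    proof (intro allI exI impI)
      fix Z n assume n: "Suc (?g (Suc Z)) \<le> n"
      show "Z \<le> R n"
      proof (rule ccontr)
        assume "\<not> Z \<le> R n"
        then have "\<alpha> j ^ Suc (R n) \<le> \<alpha> j ^ Suc Z"
          using \<alpha>1[of j] by (intro power_increasing) auto
        then have "?g (Suc (R n)) \<le> ?g (Suc Z)" unfolding geom_floor_def by (intro nat_mono floor_mono)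
        with n R(2)[of n] show False by linarith
      qed
    qed
    have ratio: "(\<lambda>r. real (?g (Suc r)) / real (?g r)) \<longlonglongrightarrow> \<alpha> j"
      by (rule geom_floor_ratio[OF \<alpha>1])
    have lim': "(\<lambda>r. s (?g r) / real (?g r)) \<longlonglongrightarrow> m" using lim unfolding \<alpha>_def .
    have "(\<lambda>r. s (?g (Suc r)) / real (?g (Suc r)) * (real (?g (Suc r)) / real (?g r))) \<longlonglongrightarrow> m * \<alpha> j"
      by (intro tendsto_mult ratio LIMSEQ_Suc[OF lim'])
    then have "(\<lambda>r. s (?g (Suc r)) / real (?g r)) \<longlonglongrightarrow> m * \<alpha> j"
      by (simp add: g_pos)
    from filterlim_compose[OF this R_lim]
    have u: "(\<lambda>n. s (?g (Suc (R n))) / real (?g (R n))) \<longlonglongrightarrow> m * \<alpha> j" .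
    have "(\<lambda>r. s (?g r) / real (?g r) / (real (?g (Suc r)) / real (?g r))) \<longlonglongrightarrow> m / \<alpha> j"
      using \<alpha>1[of j] by (intro tendsto_divide ratio lim') auto
    then have "(\<lambda>r. s (?g r) / real (?g (Suc r))) \<longlonglongrightarrow> m / \<alpha> j"
      by (simp add: g_pos)
    from filterlim_compose[OF this R_lim]
    have l: "(\<lambda>n. s (?g (R n)) / real (?g (Suc (R n)))) \<longlonglongrightarrow> m / \<alpha> j" .
    have le: "s n / real n \<le> s (?g (Suc (R n))) / real (?g (R n))" if "1 \<le> n" for n
      using that R[OF that] geom_floor_bounds(1)[OF \<alpha>1[of j], of "R n"]
      by (intro frac_le mono s_nonneg) auto
    have ge: "s (?g (R n)) / real (?g (Suc (R n))) \<le> s n / real n" if "1 \<le> n" for n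
      using that R[OF that] by (intro frac_le mono s_nonneg) auto
    show "(\<forall>\<^sub>F n in sequentially. s n / real n < a) \<or> \<not> m * \<alpha> j < a"
    proof (cases "m * \<alpha> j < a")
      case True
      have "\<forall>\<^sub>F n in sequentially. s n / real n < a"
        using order_tendstoD(2)[OF u True] eventually_ge_at_top[of 1]
        by eventually_elim (rule le_less_trans[OF le])
      then show ?thesis ..
    qed simp
    show "(\<forall>\<^sub>F n in sequentially. a < s n / real n) \<or> \<not> a < m / \<alpha> j"
    proof (cases "a < m / \<alpha> j")
      case True
      have "\<forall>\<^sub>F n in sequentially. a < s n / real n"
        using order_tendstoD(1)[OF l True] eventually_ge_at_top[of 1]
        by eventually_elim (erule less_le_trans[OF _ ge])
      then show ?thesis ..
    qed simp
  qed
  show ?thesis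
  proof (rule order_tendstoI)
    fix a assume "a < m"
    have "(\<lambda>j. m / \<alpha> j) \<longlonglongrightarrow> m" using tendsto_divide[OF tendsto_const \<alpha>_lim, of m] by simp
    from eventually_happens[OF order_tendstoD(1)[OF this \<open>a < m\<close>]]
    show "\<forall>\<^sub>F n in sequentially. a < s n / real n" using bounds(2) by auto
  next
    fix a assume "m < a"
    have "(\<lambda>j. m * \<alpha> j) \<longlonglongrightarrow> m" using tendsto_mult[OF tendsto_const \<alpha>_lim, of m] by simp
    from eventually_happens[OF order_tendstoD(2)[OF this \<open>m < a\<close>]]
    show "\<forall>\<^sub>F n in sequentially. s n / real n < a" using bounds(1) by auto
  qed
qed

text \<open>At each point the number of k with k < F x is at most the ceiling of F x, so the partial
  sums stay below the integral of F + 1.\<close>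

lemma (in finite_measure) summable_tail_measure:
  fixes F :: "'a \<Rightarrow> real"
  assumes F: "integrable M F" and nonneg: "\<And>x. 0 \<le> F x"
  shows "summable (\<lambda>k. measure M {x \<in> space M. real k < F x})"
proof (rule summableI_nonneg_bounded)
  have [measurable]: "F \<in> borel_measurable M" using F by auto
  fix n
  have "(\<Sum>k<n. measure M {x \<in> space M. real k < F x})
      = (\<Sum>k<n. \<integral>x. indicator {x \<in> space M. real k < F x} x \<partial>M)"
    by simp
  also have "\<dots> = (\<integral>x. (\<Sum>k<n. indicator {x \<in> space M. real k < F x} x) \<partial>M)"
    by (intro Bochner_Integration.integral_sum[symmetric]) (auto simp: less_top[symmetric])
  also have "\<dots> \<le> (\<integral>x. F x + 1 \<partial>M)"
  proof (intro integral_mono)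
    fix x assume x: "x \<in> space M"
    have "(\<Sum>k<n. indicator {x \<in> space M. real k < F x} x :: real)
        \<le> (\<Sum>k\<in>{..<nat \<lceil>F x\<rceil>}. 1)"
    proof -
      have "(\<Sum>k<n. indicator {x \<in> space M. real k < F x} x :: real)
         = (\<Sum>k\<in>{k. k < n \<and> real k < F x}. 1)"
        using x by (auto simp: indicator_def sum.If_cases Int_def)
      also have "\<dots> \<le> (\<Sum>k\<in>{..<nat \<lceil>F x\<rceil>}. 1)"
        by (intro sum_mono2) (auto, linarith)
      finally show ?thesis .
    qed
    also have "\<dots> \<le> F x + 1" using nonneg[of x] by simp
    finally show "(\<Sum>k<n. indicator {x \<in> space M. real k < F x} x) \<le> F x + 1" .
  qed (use F in \<open>auto simp: less_top[symmetric]\<close>)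
  finally show "(\<Sum>k<n. measure M {x \<in> space M. real k < F x}) \<le> (\<integral>x. F x + 1 \<partial>M)" .
qed simp

text \<open>Values above n become 0, not n. The square of the truncation then vanishes at every
  level below x, and only a geometric tail remains in a sum over levels.\<close>

definition trunc :: "nat \<Rightarrow> real \<Rightarrow> real" where
  "trunc n x = (if x \<le> real n then x else 0)"

lemma trunc_measurable [measurable]: "trunc n \<in> borel_measurable borel"
  unfolding trunc_def by measurable

lemma trunc_bounds: "0 \<le> x \<Longrightarrow> 0 \<le> trunc n x" "0 \<le> x \<Longrightarrow> trunc n x \<le> x" "trunc n x \<le> real n"
  by (auto simp: trunc_def)

lemma (in finite_measure) integrable_trunc_power:
  fixes F :: "'a \<Rightarrow> real"
  assumes [measurable]: "F \<in> borel_measurable M" and nonneg: "\<And>x. 0 \<le> F x"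
  shows "integrable M (\<lambda>x. (trunc n (F x)) ^ p)"
  using nonneg
  by (intro integrable_const_bound[of _ "real n ^ p"] AE_I2)
    (auto simp: trunc_bounds power_abs intro!: power_mono)

text \<open>Sum and integral are exchanged. At a point with value x only the levels
  \<open>geom_floor \<alpha> r \<ge> x\<close> count; replacing them by \<alpha>^r costs the factor
  2. What remains is x^2 times a geometric tail of order 1 / x, hence linear in x, so that the first
  moment suffices.\<close>

lemma (in finite_measure) summable_geom_floor_trunc:
  fixes F :: "'a \<Rightarrow> real"
  assumes F: "integrable M F" and nonneg: "\<And>x. 0 \<le> F x" and \<alpha>: "1 < \<alpha>"
  shows "summable (\<lambda>r. (\<integral>x. (trunc (geom_floor \<alpha> r) (F x))\<^sup>2 \<partial>M) / real (geom_floor \<alpha> r))"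
proof (rule summableI_nonneg_bounded)
  have [measurable]: "F \<in> borel_measurable M" using F by auto
  let ?g = "geom_floor \<alpha>"
  fix n
  have "(\<Sum>r<n. (\<integral>x. (trunc (?g r) (F x))\<^sup>2 \<partial>M) / real (?g r))
      = (\<integral>x. (\<Sum>r<n. (trunc (?g r) (F x))\<^sup>2 / real (?g r)) \<partial>M)"
    by (subst Bochner_Integration.integral_sum) (auto intro!: integrable_trunc_power nonneg)
  also have "\<dots> \<le> (\<integral>x. 2 * (\<alpha> / (\<alpha> - 1)) * F x \<partial>M)"
  proof (intro integral_mono Bochner_Integration.integrable_sum)
    fix x
    show "(\<Sum>r<n. (trunc (?g r) (F x))\<^sup>2 / real (?g r)) \<le> 2 * (\<alpha> / (\<alpha> - 1)) * F x"
    proof (cases "F x = 0")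
      case False
      with nonneg[of x] have pos: "0 < F x" by linarith
      have "(trunc (?g r) (F x))\<^sup>2 / real (?g r)
          \<le> 2 * (F x)\<^sup>2 * (if F x \<le> \<alpha> ^ r then 1 / \<alpha> ^ r else 0)" for r
      proof (cases "F x \<le> real (?g r)")
        case True
        then have "F x \<le> \<alpha> ^ r" using geom_floor_bounds(2)[OF \<alpha>, of r] by linarith
        moreover have "(F x)\<^sup>2 / real (?g r) \<le> (F x)\<^sup>2 / (\<alpha> ^ r / 2)"
          using geom_floor_bounds[OF \<alpha>, of r] \<alpha> by (intro divide_left_mono) auto
        ultimately show ?thesis using True by (simp add: trunc_def mult.commute)
      qed (use \<alpha> in \<open>simp add: trunc_def\<close>)
      then have "(\<Sum>r<n. (trunc (?g r) (F x))\<^sup>2 / real (?g r))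
          \<le> 2 * (F x)\<^sup>2 * (\<Sum>r<n. if F x \<le> \<alpha> ^ r then 1 / \<alpha> ^ r else 0)"
        unfolding sum_distrib_left by (intro sum_mono)
      also have "\<dots> \<le> 2 * (F x)\<^sup>2 * (\<alpha> / (\<alpha> - 1) / F x)"
        by (intro mult_left_mono sum_truncated_geometric_le \<alpha> pos) auto
      also have "\<dots> = 2 * (\<alpha> / (\<alpha> - 1)) * F x"
        using pos by (simp add: power2_eq_square)
      finally show ?thesis .
    qed (simp add: trunc_def)
  qed (use F in \<open>auto intro!: integrable_trunc_power nonneg\<close>)
  finally show "(\<Sum>r<n. (\<integral>x. (trunc (?g r) (F x))\<^sup>2 \<partial>M) / real (?g r)) \<le> (\<integral>x. 2 * (\<alpha> / (\<alpha> - 1)) * F x \<partial>M)" .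
qed simp

text \<open>Etemadi's argument. Independence of the summands is replaced by the variance bound; the truncated
  sums are controlled along the integer parts of the powers of any number above 1, and nonnegativity
  makes the sums monotone, which fills the gaps.\<close>

lemma etemadi_slln:
  fixes Z :: "nat \<Rightarrow> 'w \<Rightarrow> real" and F :: "'x \<Rightarrow> real" and D :: "'i::finite \<Rightarrow> 'x measure"
  assumes M: "prob_space M" and [measurable]: "\<And>k. Z k \<in> borel_measurable M"
    and Z_nonneg: "\<And>k \<omega>. 0 \<le> Z k \<omega>"
    and D: "\<And>i. finite_measure (D i)" and F: "\<And>i. integrable (D i) F" and F_nonneg: "\<And>x. 0 \<le> F x"
    and dom: "\<And>k. measure M {\<omega> \<in> space M. real k < Z k \<omega>}
                 \<le> (\<Sum>i\<in>UNIV. measure (D i) {x \<in> space (D i). real k < F x})"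
    and mean: "(\<lambda>k. \<integral>\<omega>. trunc k (Z k \<omega>) \<partial>M) \<longlonglongrightarrow> m"
    and var: "\<And>n. (\<integral>\<omega>. ((\<Sum>k<n. trunc k (Z k \<omega>)) - (\<Sum>k<n. \<integral>\<omega>. trunc k (Z k \<omega>) \<partial>M))\<^sup>2 \<partial>M)
                 \<le> real n * (a * (\<Sum>i\<in>UNIV. \<integral>x. (trunc n (F x))\<^sup>2 \<partial>D i) + b)"
  shows "AE \<omega> in M. (\<lambda>n. (\<Sum>k<n. Z k \<omega>) / real n) \<longlonglongrightarrow> m"
proof -
  interpret prob_space M by fact
  define dev where "dev n \<omega> = (\<Sum>k<n. trunc k (Z k \<omega>)) - (\<Sum>k<n. \<integral>\<omega>. trunc k (Z k \<omega>) \<partial>M)" for n \<omega>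
  have [measurable]: "dev n \<in> borel_measurable M" for n unfolding dev_def by measurable
  have dev_bound: "\<bar>dev n \<omega>\<bar> \<le> (\<Sum>k<n. real k) + \<bar>\<Sum>k<n. \<integral>\<omega>. trunc k (Z k \<omega>) \<partial>M\<bar>" for n \<omega>
  proof -
    have "\<bar>\<Sum>k<n. trunc k (Z k \<omega>)\<bar> \<le> (\<Sum>k<n. real k)"
      using Z_nonneg by (intro order_trans[OF sum_abs] sum_mono) (simp add: trunc_bounds)
    then show ?thesis unfolding dev_def by linarith
  qed
  have dev_int: "integrable M (\<lambda>\<omega>. (dev n \<omega> / real n)\<^sup>2)" for n
  proof (rule integrable_const_bound)
    show "AE \<omega> in M. norm ((dev n \<omega> / real n)\<^sup>2)
       \<le> (((\<Sum>k<n. real k) + \<bar>\<Sum>k<n. \<integral>\<omega>. trunc k (Z k \<omega>) \<partial>M\<bar>) / real n)\<^sup>2"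
      by (intro AE_I2) (auto simp: power_divide intro!: divide_right_mono power2_le_iff_abs_le[THEN iffD2] dev_bound add_nonneg_nonneg sum_nonneg)
  qed simp
  \<comment> \<open>The squares of the normalized deviations have summable integrals along the
    geometric sequence, so almost surely they form a convergent series.\<close>
  have dev_lim: "AE \<omega> in M. (\<lambda>r. dev (geom_floor \<alpha> r) \<omega> / real (geom_floor \<alpha> r)) \<longlonglongrightarrow> 0"
    if \<alpha>: "1 < \<alpha>" for \<alpha>
  proof -
    let ?g = "geom_floor \<alpha>"
    have g1: "1 \<le> ?g r" for r by (rule geom_floor_bounds[OF \<alpha>])
    \<comment> \<open>Dividing the variance bound by the square of g r leaves the truncated second
      moments over g r, and b / g r, which is at most
      \<open>2 * \<bar>b\<bar> * (1 / \<alpha>) ^ r\<close> because g r is at least half of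
      \<alpha>^r.\<close>
    have "summable (\<lambda>r. \<integral>\<omega>. (dev (?g r) \<omega> / real (?g r))\<^sup>2 \<partial>M)"
    proof (rule summable_comparison_test'[of "\<lambda>r. a * (\<Sum>i\<in>UNIV. (\<integral>x. (trunc (?g r) (F x))\<^sup>2 \<partial>D i) / real (?g r))
          + 2 * \<bar>b\<bar> * (1 / \<alpha>) ^ r" 0])
      show "summable (\<lambda>r. a * (\<Sum>i\<in>UNIV. (\<integral>x. (trunc (?g r) (F x))\<^sup>2 \<partial>D i) / real (?g r)) + 2 * \<bar>b\<bar> * (1 / \<alpha>) ^ r)"
        using \<alpha> by (intro summable_add summable_mult summable_sum D[THEN finite_measure.summable_geom_floor_trunc] F F_nonneg summable_geometric) auto
      fix r
      have "(\<integral>\<omega>. (dev (?g r) \<omega> / real (?g r))\<^sup>2 \<partial>M) = (\<integral>\<omega>. (dev (?g r) \<omega>)\<^sup>2 \<partial>M) / (real (?g r))\<^sup>2"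
        by (simp add: power_divide)
      also have "\<dots> \<le> real (?g r) * (a * (\<Sum>i\<in>UNIV. \<integral>x. (trunc (?g r) (F x))\<^sup>2 \<partial>D i) + b) / (real (?g r))\<^sup>2"
        using var[of "?g r"] unfolding dev_def by (intro divide_right_mono) auto
      also have "\<dots> = a * (\<Sum>i\<in>UNIV. (\<integral>x. (trunc (?g r) (F x))\<^sup>2 \<partial>D i) / real (?g r)) + b / real (?g r)"
        using g1[of r] by (simp add: power2_eq_square field_simps flip: sum_divide_distrib)
      also have "b / real (?g r) \<le> \<bar>b\<bar> / (\<alpha> ^ r / 2)"
        using geom_floor_bounds[OF \<alpha>, of r] \<alpha> by (intro frac_le) auto
      also have "\<dots> = 2 * \<bar>b\<bar> * (1 / \<alpha>) ^ r" by (simp add: power_one_over)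
      finally show "norm (\<integral>\<omega>. (dev (?g r) \<omega> / real (?g r))\<^sup>2 \<partial>M)
        \<le> a * (\<Sum>i\<in>UNIV. (\<integral>x. (trunc (?g r) (F x))\<^sup>2 \<partial>D i) / real (?g r)) + 2 * \<bar>b\<bar> * (1 / \<alpha>) ^ r"
        by simp
    qed
    from AE_tendsto_0_of_summable_integrals[OF dev_int _ this]
    have "AE \<omega> in M. (\<lambda>r. (dev (?g r) \<omega> / real (?g r))\<^sup>2) \<longlonglongrightarrow> 0" by simp
    then show ?thesis
    proof eventually_elim
      case (elim \<omega>)
      from tendsto_real_sqrt[OF this]
      have "(\<lambda>r. \<bar>dev (?g r) \<omega> / real (?g r)\<bar>) \<longlonglongrightarrow> 0" by simp
      then show ?case by (rule tendsto_rabs_zero_cancel)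
    qed
  qed
  \<comment> \<open>The dominated tails are summable: almost surely only finitely many
    \<open>Z k\<close> exceed k, so truncation does not affect the limit of the averages.\<close>
  have "AE \<omega> in M. \<forall>\<^sub>F k in sequentially. \<omega> \<in> space M - {\<omega> \<in> space M. real k < Z k \<omega>}"
  proof (rule borel_cantelli_AE1)
    show "summable (\<lambda>k. measure M {\<omega> \<in> space M. real k < Z k \<omega>})"
      using dom by (intro summable_comparison_test'[OF summable_sum[OF D[THEN finite_measure.summable_tail_measure, OF F F_nonneg]], of 0]) auto
  qed (auto simp: less_top[symmetric])
  moreover have "AE \<omega> in M. \<forall>j. (\<lambda>r. dev (geom_floor (1 + 1 / real (Suc j)) r) \<omega> /
      real (geom_floor (1 + 1 / real (Suc j)) r)) \<longlonglongrightarrow> 0"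
    by (subst AE_all_countable) (auto intro!: dev_lim)
  ultimately show ?thesis
  proof eventually_elim
    case (elim \<omega>)
    obtain N where N: "\<And>k. N \<le> k \<Longrightarrow> Z k \<omega> \<le> real k"
      using elim(1) unfolding eventually_sequentially by (auto simp: not_less)
    have "(\<lambda>k. Z k \<omega> - trunc k (Z k \<omega>)) \<longlonglongrightarrow> 0"
      using N by (intro tendsto_eventually) (auto simp: eventually_sequentially trunc_def intro!: exI[of _ N])
    then have "(\<lambda>n. (\<Sum>k<n. Z k \<omega> - trunc k (Z k \<omega>)) / real n) \<longlonglongrightarrow> 0" by (rule cesaro_mean)
    from tendsto_add[OF this cesaro_mean[OF mean]]
    have rest: "(\<lambda>n. (\<Sum>k<n. Z k \<omega> - trunc k (Z k \<omega>)) / real n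
        + (\<Sum>k<n. \<integral>\<omega>. trunc k (Z k \<omega>) \<partial>M) / real n) \<longlonglongrightarrow> m" by simp
    show ?case
    proof (rule LIMSEQ_of_geom_floor)
      fix j
      let ?g = "geom_floor (1 + 1 / real (Suc j))"
      have "filterlim ?g at_top sequentially"
        unfolding filterlim_at_top eventually_sequentially
      proof
        fix Z
        obtain N where "real Z < (1 + 1 / real (Suc j)) ^ N"
          using real_arch_pow[of "1 + 1 / real (Suc j)" "real Z"] by auto
        have "real Z \<le> (1 + 1 / real (Suc j)) ^ r" if "N \<le> r" for r
          by (rule less_imp_le[OF less_le_trans[OF \<open>real Z < _\<close> power_increasing[OF that]]]) simp
        then show "\<exists>N. \<forall>r\<ge>N. Z \<le> ?g r"
          by (intro exI[of _ N]) (auto simp: geom_floor_def le_nat_iff le_floor_iff)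
      qed
      from filterlim_compose[OF rest this] elim(2)[rule_format, of j]
      have "(\<lambda>r. ((\<Sum>k<?g r. Z k \<omega> - trunc k (Z k \<omega>)) / real (?g r)
        + (\<Sum>k<?g r. \<integral>\<omega>. trunc k (Z k \<omega>) \<partial>M) / real (?g r)) + dev (?g r) \<omega> / real (?g r)) \<longlonglongrightarrow> m + 0"
        by (rule tendsto_add)
      then show "(\<lambda>r. (\<Sum>k<?g r. Z k \<omega>) / real (?g r)) \<longlonglongrightarrow> m"
        unfolding dev_def by (simp add: sum_subtractf flip: add_divide_distrib)
    qed (auto intro!: sum_mono2 Z_nonneg)
  qed
qed

section \<open>Strong law for pairs of consecutive signals\<close>

lemma integral_uniform_measure:
  fixes f :: "'a \<Rightarrow> real"
  assumes [measurable]: "A \<in> sets M" "f \<in> borel_measurable M" and A: "emeasure M A \<noteq> 0" "emeasure M A \<noteq> \<infinity>"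
  shows "(\<integral>x. f x * indicator A x \<partial>M) = measure M A * (\<integral>x. f x \<partial>uniform_measure M A)"
proof -
  have pos: "0 < measure M A" using A by (simp add: measure_def zero_less_iff_neq_zero enn2real_positive_iff less_top)
  have "uniform_measure M A = density M (\<lambda>x. ennreal (indicator A x / measure M A))"
    unfolding uniform_measure_def
    using A pos by (intro density_cong) (auto simp: emeasure_eq_ennreal_measure divide_ennreal simp flip: ennreal_1 split: split_indicator)
  then have "(\<integral>x. f x \<partial>uniform_measure M A) = (\<integral>x. indicator A x / measure M A * f x \<partial>M)"
    using pos by (simp add: integral_density)
  also have "\<dots> = (\<integral>x. f x * indicator A x / measure M A \<partial>M)"
    by (simp add: mult.commute)
  finally show ?thesis using pos by simp
qed

locale hmm = prob_space M
  for M :: "'w measure" +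
  fixes P :: "real ^ 'm ^ 'm" and \<nu> :: "'m::finite pmf" and L :: "'m \<Rightarrow> 's::topological_space measure"
    and X :: "nat \<Rightarrow> 'w \<Rightarrow> 'm" and Y :: "nat \<Rightarrow> 'w \<Rightarrow> 's"
  assumes hmm: "hidden_markov_model M P \<nu> L X Y"
    and stochastic_P: "stochastic_matrix P"
    and sets_L [measurable_cong]: "\<And>i. sets (L i) = sets borel"
    and prob_L: "\<And>i. prob_space (L i)"
begin

section \<open>Hidden paths and the Markov property\<close>

lemma X_meas [measurable]: "X n \<in> measurable M (count_space UNIV)"
  using hmm by (simp add: hidden_markov_model_def)

lemma Y_meas [measurable]: "Y n \<in> measurable M borel"
  using hmm by (simp add: hidden_markov_model_def)

abbreviation pair_law :: "'m \<Rightarrow> 'm \<Rightarrow> ('s \<times> 's) measure" where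
  "pair_law i j \<equiv> L i \<Otimes>\<^sub>M L j"

definition signal_pair :: "nat \<Rightarrow> 'w \<Rightarrow> 's \<times> 's" where
  "signal_pair k \<omega> = (Y k \<omega>, Y (Suc k) \<omega>)"

lemma signal_pair_meas [measurable]: "signal_pair k \<in> measurable M (borel \<Otimes>\<^sub>M borel)"
  unfolding signal_pair_def by measurable

definition cylinder :: "nat \<Rightarrow> (nat \<Rightarrow> 'm) \<Rightarrow> 'w set" where
  "cylinder n x = {\<omega> \<in> space M. \<forall>k\<le>n. X k \<omega> = x k}"

lemma cylinder_sets [measurable]: "cylinder n x \<in> sets M"
proof -
  have "cylinder n x = {\<omega> \<in> space M. \<forall>k\<in>{..n}. X k \<omega> = x k}" by (auto simp: cylinder_def)
  also have "\<dots> \<in> sets M" by measurable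
  finally show ?thesis .
qed

text \<open>Paths are extensional, that is, \<open>undefined\<close> after time n. Distinct elements
  of \<open>paths n\<close> therefore have disjoint cylinders, and these partition the
  space.\<close>

definition paths :: "nat \<Rightarrow> (nat \<Rightarrow> 'm) set" where
  "paths n = {..n} \<rightarrow>\<^sub>E UNIV"

lemma finite_paths [simp]: "finite (paths n)"
  unfolding paths_def by (intro finite_PiE) auto

text \<open>The hidden path up to n as a random element of the finite set \<open>paths n\<close>:
  real functions of it are bounded and their expectations are finite sums.\<close>

definition hist :: "nat \<Rightarrow> 'w \<Rightarrow> nat \<Rightarrow> 'm" where
  "hist n \<omega> = restrict (\<lambda>k. X k \<omega>) {..n}"

lemma hist_paths: "hist n \<omega> \<in> paths n"
  by (auto simp: hist_def paths_def)

lemma mem_cylinder_iff: "\<omega> \<in> space M \<Longrightarrow> x \<in> paths n \<Longrightarrow> \<omega> \<in> cylinder n x \<longleftrightarrow> x = hist n \<omega>"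
  by (auto simp: cylinder_def hist_def paths_def fun_eq_iff PiE_def extensional_def)

lemma sum_indicator_cylinder:
  assumes "\<omega> \<in> space M"
  shows "(\<Sum>x\<in>paths n. indicator (cylinder n x) \<omega> :: real) = 1"
proof -
  have "(\<Sum>x\<in>paths n. indicator (cylinder n x) \<omega> :: real) = (\<Sum>x\<in>paths n. if x = hist n \<omega> then 1 else 0)"
    using assms by (intro sum.cong) (auto simp: mem_cylinder_iff indicator_def)
  then show ?thesis by (simp add: hist_paths)
qed

lemma integral_cylinder_decomp:
  fixes Z :: "'w \<Rightarrow> real"
  assumes Z: "integrable M Z"
  shows "(\<integral>\<omega>. Z \<omega> \<partial>M) = (\<Sum>x\<in>paths n. \<integral>\<omega>. Z \<omega> * indicator (cylinder n x) \<omega> \<partial>M)"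
proof -
  have "(\<integral>\<omega>. Z \<omega> \<partial>M) = (\<integral>\<omega>. (\<Sum>x\<in>paths n. Z \<omega> * indicator (cylinder n x) \<omega>) \<partial>M)"
    by (intro Bochner_Integration.integral_cong) (auto simp: sum_indicator_cylinder simp flip: sum_distrib_left)
  also have "\<dots> = (\<Sum>x\<in>paths n. \<integral>\<omega>. Z \<omega> * indicator (cylinder n x) \<omega> \<partial>M)"
    using Z by (intro Bochner_Integration.integral_sum integrable_mult_indicator[unfolded mult.commute] 
        integrable_real_mult_indicator) auto
  finally show ?thesis .
qed

lemma hist_meas: "(\<lambda>\<omega>. F (hist n \<omega>)) \<in> measurable M (count_space UNIV)"
proof -
  have "hist n \<in> measurable M (count_space (paths n))"
  proof (rule measurable_count_space_eq2[THEN iffD2], simp, intro conjI ballI)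
    show "hist n \<in> space M \<rightarrow> paths n" using hist_paths by auto
    fix x assume "x \<in> paths n"
    then have "hist n -` {x} \<inter> space M = {\<omega> \<in> space M. \<omega> \<in> cylinder n x}" by (auto simp: mem_cylinder_iff)
    also have "\<dots> = cylinder n x" by (auto simp: cylinder_def)
    finally have "hist n -` {x} \<inter> space M = cylinder n x" .
    then show "hist n -` {x} \<inter> space M \<in> sets M" by simp
  qed
  then show ?thesis by (rule measurable_compose) simp
qed

lemma hist_meas_real [measurable]: "(\<lambda>\<omega>. F (hist n \<omega>) :: real) \<in> borel_measurable M"
  using hist_meas[of F n] by (rule measurable_compose) simp

lemma integrable_hist: "integrable M (\<lambda>\<omega>. F (hist n \<omega>) :: real)"
proof (rule integrable_const_bound[of _ "\<Sum>x\<in>paths n. \<bar>F x\<bar>"])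
  show "AE \<omega> in M. norm (F (hist n \<omega>)) \<le> (\<Sum>x\<in>paths n. \<bar>F x\<bar>)"
    using hist_paths by (intro AE_I2) (auto intro!: member_le_sum[of _ _ "\<lambda>x. \<bar>F x\<bar>"])
qed simp

lemma integral_hist: "(\<integral>\<omega>. F (hist n \<omega>) \<partial>M) = (\<Sum>x\<in>paths n. prob (cylinder n x) * F x)" for F :: "_ \<Rightarrow> real"
proof -
  have "(\<integral>\<omega>. F (hist n \<omega>) * indicator (cylinder n x) \<omega> \<partial>M) = prob (cylinder n x) * F x" if "x \<in> paths n" for x
  proof -
    have "(\<integral>\<omega>. F (hist n \<omega>) * indicator (cylinder n x) \<omega> \<partial>M) = (\<integral>\<omega>. F x * indicator (cylinder n x) \<omega> \<partial>M)"
      using that by (intro Bochner_Integration.integral_cong) (auto simp: mem_cylinder_iff indicator_def)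
    then show ?thesis by simp
  qed
  then show ?thesis by (subst integral_cylinder_decomp[OF integrable_hist[of F n], of n]) simp
qed

text \<open>The model prescribes transition probabilities only given paths of positive probability.
  In product form the equation also covers null paths, where both sides vanish.\<close>

lemma prob_cylinder_Suc: "prob {\<omega> \<in> cylinder n x. X (Suc n) \<omega> = j} = prob (cylinder n x) * P $ x n $ j"
proof (cases "prob (cylinder n x) = 0")
  case True
  have "prob {\<omega> \<in> cylinder n x. X (Suc n) \<omega> = j} \<le> prob (cylinder n x)"
    by (intro finite_measure_mono) auto
  with True show ?thesis by (simp add: measure_le_0_iff)
next
  case False
  then have pos: "0 < prob {\<omega> \<in> space M. \<forall>k\<le>n. X k \<omega> = x k}" by (simp add: cylinder_def zero_less_measure_iff)
  then have "\<P>(\<omega> in M. X (Suc n) \<omega> = j \<bar> \<forall>k\<le>n. X k \<omega> = x k) = P $ x n $ j"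
    using hmm unfolding hidden_markov_model_def by blast
  moreover have "{\<omega> \<in> cylinder n x. X (Suc n) \<omega> = j} = {\<omega> \<in> space M. X (Suc n) \<omega> = j \<and> (\<forall>k\<le>n. X k \<omega> = x k)}"
    by (auto simp: cylinder_def)
  ultimately show ?thesis
    using pos unfolding cond_prob_def cylinder_def[symmetric] by (simp add: field_simps)
qed

text \<open>The Markov property integrated against an arbitrary function \<open>F\<close> of the
  past, which takes the place of conditional expectations.\<close>

lemma markov_step:
  fixes F :: "(nat \<Rightarrow> 'm) \<Rightarrow> real" and w :: "'m \<Rightarrow> 'm \<Rightarrow> real"
  shows "(\<integral>\<omega>. F (hist n \<omega>) * w (X n \<omega>) (X (Suc n) \<omega>) \<partial>M)
       = (\<integral>\<omega>. F (hist n \<omega>) * (\<Sum>j\<in>UNIV. P $ X n \<omega> $ j * w (X n \<omega>) j) \<partial>M)" (is "?l = ?r")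
proof -
  have eq: "F (hist n \<omega>) * w (X n \<omega>) (X (Suc n) \<omega>)
      = (\<lambda>x. F (restrict x {..n}) * w (x n) (x (Suc n))) (hist (Suc n) \<omega>)" for \<omega>
  proof -
    have "restrict (hist (Suc n) \<omega>) {..n} = hist n \<omega>"
      by (auto simp: hist_def restrict_def fun_eq_iff)
    then show ?thesis by (simp only:) (simp add: hist_def)
  qed
  have "?l = (\<Sum>x\<in>paths n. \<integral>\<omega>. F (hist n \<omega>) * w (X n \<omega>) (X (Suc n) \<omega>) * indicator (cylinder n x) \<omega> \<partial>M)"
    unfolding eq by (rule integral_cylinder_decomp[OF integrable_hist])
  also have "\<dots> = (\<Sum>x\<in>paths n. prob (cylinder n x) * (F x * (\<Sum>j\<in>UNIV. P $ x n $ j * w (x n) j)))"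
  proof (rule sum.cong[OF refl])
    fix x assume x: "x \<in> paths n"
    have "(\<integral>\<omega>. F (hist n \<omega>) * w (X n \<omega>) (X (Suc n) \<omega>) * indicator (cylinder n x) \<omega> \<partial>M)
       = (\<integral>\<omega>. (\<Sum>j\<in>UNIV. F x * w (x n) j * indicator {\<omega> \<in> cylinder n x. X (Suc n) \<omega> = j} \<omega>) \<partial>M)"
    proof (intro Bochner_Integration.integral_cong refl)
      fix \<omega> assume \<omega>: "\<omega> \<in> space M"
      have "(\<Sum>j\<in>UNIV. F x * w (x n) j * indicator {\<omega> \<in> cylinder n x. X (Suc n) \<omega> = j} \<omega>)
        = (\<Sum>j\<in>UNIV. if j = X (Suc n) \<omega> then F x * w (x n) j * indicator (cylinder n x) \<omega> else 0)"
        by (intro sum.cong) (auto simp: indicator_def)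
      then show "F (hist n \<omega>) * w (X n \<omega>) (X (Suc n) \<omega>) * indicator (cylinder n x) \<omega>
        = (\<Sum>j\<in>UNIV. F x * w (x n) j * indicator {\<omega> \<in> cylinder n x. X (Suc n) \<omega> = j} \<omega>)"
        using \<omega> x by (auto simp: indicator_def mem_cylinder_iff hist_def)
    qed
    also have "\<dots> = (\<Sum>j\<in>UNIV. F x * w (x n) j * prob {\<omega> \<in> cylinder n x. X (Suc n) \<omega> = j})"
    proof -
      have [measurable]: "{\<omega> \<in> cylinder n x. X (Suc n) \<omega> = j} \<in> sets M" for j by measurable
      show ?thesis
        by (subst Bochner_Integration.integral_sum)
          (auto intro!: integrable_mult_right simp: less_top[symmetric] Int_absorb2 sets.sets_into_space)
    qed
    also have "\<dots> = prob (cylinder n x) * (F x * (\<Sum>j\<in>UNIV. P $ x n $ j * w (x n) j))"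
      by (simp only: prob_cylinder_Suc sum_distrib_left) (simp add: ac_simps)
    finally show "(\<integral>\<omega>. F (hist n \<omega>) * w (X n \<omega>) (X (Suc n) \<omega>) * indicator (cylinder n x) \<omega> \<partial>M)
      = prob (cylinder n x) * (F x * (\<Sum>j\<in>UNIV. P $ x n $ j * w (x n) j))" .
  qed
  also have "\<dots> = (\<integral>\<omega>. (\<lambda>x. F x * (\<Sum>j\<in>UNIV. P $ x n $ j * w (x n) j)) (hist n \<omega>) \<partial>M)"
    by (rule integral_hist[symmetric])
  also have "\<dots> = ?r" by (simp add: hist_def)
  finally show ?thesis .
qed

lemma markov_steps:
  fixes F :: "(nat \<Rightarrow> 'm) \<Rightarrow> real" and v :: "real ^ 'm"
  shows "(\<integral>\<omega>. F (hist n \<omega>) * v $ X (n + r) \<omega> \<partial>M)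
       = (\<integral>\<omega>. F (hist n \<omega>) * (mat_power P r *v v) $ X n \<omega> \<partial>M)"
proof (induction r arbitrary: v)
  case (Suc r)
  \<comment> \<open>By restriction a function of the path up to n becomes one of the longer path up
    to n + r, so the one-step property applies at time n + r.\<close>
  have hist: "restrict (hist (n + r) \<omega>) {..n} = hist n \<omega>" for \<omega>
    by (auto simp: hist_def restrict_def fun_eq_iff)
  have "(\<integral>\<omega>. F (hist n \<omega>) * v $ X (n + Suc r) \<omega> \<partial>M)
      = (\<integral>\<omega>. F (hist n \<omega>) * (P *v v) $ X (n + r) \<omega> \<partial>M)"
    using markov_step[of "\<lambda>x. F (restrict x {..n})" "n + r" "\<lambda>_ j. v $ j"]
    by (simp add: hist matrix_vector_mult_def)
  also have "\<dots> = (\<integral>\<omega>. F (hist n \<omega>) * (mat_power P (r + 1) *v v) $ X n \<omega> \<partial>M)"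
    unfolding mat_power_add Suc.IH by (simp add: mat_power_Suc matrix_vector_mul_assoc)
  finally show ?case by simp
qed simp

end

lemma (in finite_measure) integrable_bounded:
  fixes f :: "'a \<Rightarrow> real"
  assumes "f \<in> borel_measurable M" "\<And>x. \<bar>f x\<bar> \<le> B"
  shows "integrable M f"
  using assms by (intro integrable_const_bound[of _ B]) auto

text \<open>Each distance to j occurs at most twice, once on either side. It is written by cases
  because subtraction on \<open>nat\<close> is truncated.\<close>

lemma sum_dist_le:
  fixes a :: "nat \<Rightarrow> real"
  assumes "\<And>d. 0 \<le> a d" "j < n"
  shows "(\<Sum>k<n. a (if j \<le> k then k - j else j - k)) \<le> 2 * (\<Sum>d<n. a d)"
proof -
  have "(\<Sum>k<n. a (if j \<le> k then k - j else j - k))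
      = (\<Sum>k<j. a (if j \<le> k then k - j else j - k)) + (\<Sum>k\<in>{j..<n}. a (if j \<le> k then k - j else j - k))"
    using assms(2) by (subst sum.union_disjoint[symmetric]) (auto intro!: sum.cong)
  also have "(\<Sum>k<j. a (if j \<le> k then k - j else j - k)) = (\<Sum>d\<in>{1..j}. a d)"
    by (rule sum.reindex_bij_witness[of _ "\<lambda>d. j - d" "\<lambda>k. j - k"]) auto
  also have "\<dots> \<le> (\<Sum>d<n. a d)"
    using assms by (intro sum_mono2) auto
  also have "(\<Sum>k\<in>{j..<n}. a (if j \<le> k then k - j else j - k)) = (\<Sum>d<n - j. a d)"
    by (rule sum.reindex_bij_witness[of _ "\<lambda>d. j + d" "\<lambda>k. k - j"]) auto
  also have "\<dots> \<le> (\<Sum>d<n. a d)"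
    using assms by (intro sum_mono2) auto
  finally show ?thesis by simp
qed

text \<open>Every exponent q is taken n0 times, and the geometric series of 1 - \<kappa> is at most
  1 / \<kappa>.\<close>

lemma sum_doeblin_rate_le:
  fixes \<kappa> :: real
  assumes "0 < \<kappa>" "\<kappa> \<le> 1" "1 \<le> n0"
  shows "(\<Sum>r<N. (1 - \<kappa>) ^ (r div n0)) \<le> real n0 / \<kappa>"
proof -
  have "(\<Sum>r<N. (1 - \<kappa>) ^ (r div n0)) \<le> (\<Sum>r<N * n0. (1 - \<kappa>) ^ (r div n0))"
    using assms by (intro sum_mono2) (auto intro: less_le_trans)
  also have "\<dots> = (\<Sum>q<N. \<Sum>r\<in>{q * n0..<q * n0 + n0}. (1 - \<kappa>) ^ (r div n0))"
    by (rule sum.nat_group[symmetric])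
  also have "\<dots> = (\<Sum>q<N. \<Sum>r\<in>{q * n0..<q * n0 + n0}. (1 - \<kappa>) ^ q)"
  proof (intro sum.cong refl)
    fix q r assume "r \<in> {q * n0..<q * n0 + n0}"
    then have "r div n0 = q" by (intro div_nat_eqI) (auto simp: mult.commute)
    then show "(1 - \<kappa>) ^ (r div n0) = (1 - \<kappa>) ^ q" by simp
  qed
  also have "\<dots> = real n0 * (\<Sum>q<N. (1 - \<kappa>) ^ q)" by (simp add: sum_distrib_left)
  also have "(\<Sum>q<N. (1 - \<kappa>) ^ q) \<le> 1 / \<kappa>"
    using assms by (simp add: sum_gp_strict divide_right_mono)
  finally show ?thesis using assms by (simp add: mult_left_mono)
qed

section \<open>Pairs of signals given the hidden chain\<close>

context hmm
begin

definition emission_mean :: "('s \<times> 's \<Rightarrow> real) \<Rightarrow> 'm \<Rightarrow> 'm \<Rightarrow> real" where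
  "emission_mean f i j = (\<integral>z. f z \<partial>pair_law i j)"

lemma prob_space_pair_law: "prob_space (pair_law i j)"
proof -
  interpret i: prob_space "L i" by (rule prob_L)
  interpret j: prob_space "L j" by (rule prob_L)
  interpret pair_prob_space "L i" "L j" ..
  show ?thesis by unfold_locales
qed

lemma sets_pair_law [measurable_cong]: "sets (pair_law i j) = sets (borel \<Otimes>\<^sub>M borel)"
  by (intro sets_pair_measure_cong sets_L)

text \<open>Given the hidden path the signals are independent. As j + 1 < k, the index sets {j, j +
  1} and {k, k + 1} are disjoint, so the two pairs are independent as well, each with a product
  law.\<close>

lemma emission_pair:
  fixes f h :: "'s \<times> 's \<Rightarrow> real"
  assumes [measurable]: "f \<in> borel_measurable (borel \<Otimes>\<^sub>M borel)" "h \<in> borel_measurable (borel \<Otimes>\<^sub>M borel)"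
    and bd: "\<And>z. \<bar>f z\<bar> \<le> B" "\<And>z. \<bar>h z\<bar> \<le> B"
    and j: "Suc j < k" and n: "Suc k \<le> n" and pos: "prob (cylinder n x) \<noteq> 0"
  shows "(\<integral>\<omega>. f (signal_pair j \<omega>) * h (signal_pair k \<omega>) \<partial>uniform_measure M (cylinder n x))
       = emission_mean f (x j) (x (Suc j)) * emission_mean h (x k) (x (Suc k))"
proof -
  define N where "N = uniform_measure M (cylinder n x)"
  have em: "emeasure M (cylinder n x) \<noteq> 0" "emeasure M (cylinder n x) \<noteq> \<infinity>"
    using pos by (auto simp: emeasure_eq_measure)
  interpret N: prob_space N unfolding N_def by (rule prob_space_uniform_measure[OF em])
  have "0 < prob {\<omega> \<in> space M. \<forall>k\<le>n. X k \<omega> = x k}"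
    using pos by (simp add: cylinder_def zero_less_measure_iff)
  then have ind: "N.indep_vars (\<lambda>_. borel) Y {..n}" and law: "\<And>k. k \<le> n \<Longrightarrow> distr N borel (Y k) = L (x k)"
    using hmm unfolding hidden_markov_model_def N_def cylinder_def Let_def by blast+
  have [measurable_cong]: "sets N = sets M" by (simp add: N_def)
  have pair_law: "distr N (borel \<Otimes>\<^sub>M borel) (signal_pair i) = pair_law (x i) (x (Suc i))" if "Suc i \<le> n" for i
  proof -
    have "N.indep_var (PiM {i} (\<lambda>_. borel)) (\<lambda>\<omega>. restrict (\<lambda>i. Y i \<omega>) {i})
            (PiM {Suc i} (\<lambda>_. borel)) (\<lambda>\<omega>. restrict (\<lambda>i. Y i \<omega>) {Suc i})"
      using that by (intro N.indep_var_restrict[OF ind]) auto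
    from N.indep_var_compose[OF this, of "\<lambda>g. g i" borel "\<lambda>g. g (Suc i)" borel]
    have "N.indep_var borel (Y i) borel (Y (Suc i))" by (simp add: comp_def)
    then have "distr N borel (Y i) \<Otimes>\<^sub>M distr N borel (Y (Suc i)) = distr N (borel \<Otimes>\<^sub>M borel) (signal_pair i)"
      unfolding N.indep_var_distribution_eq signal_pair_def by simp
    then show ?thesis using that by (simp add: law)
  qed
  have "N.indep_var (PiM {j, Suc j} (\<lambda>_. borel)) (\<lambda>\<omega>. restrict (\<lambda>i. Y i \<omega>) {j, Suc j})
          (PiM {k, Suc k} (\<lambda>_. borel)) (\<lambda>\<omega>. restrict (\<lambda>i. Y i \<omega>) {k, Suc k})"
    using j n by (intro N.indep_var_restrict[OF ind]) auto
  from N.indep_var_compose[OF this, of "\<lambda>g. f (g j, g (Suc j))" borel "\<lambda>g. h (g k, g (Suc k))" borel]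
  have "N.indep_var borel (\<lambda>\<omega>. f (signal_pair j \<omega>)) borel (\<lambda>\<omega>. h (signal_pair k \<omega>))"
    by (simp add: comp_def signal_pair_def)
  then have "(\<integral>\<omega>. f (signal_pair j \<omega>) * h (signal_pair k \<omega>) \<partial>N) = (\<integral>\<omega>. f (signal_pair j \<omega>) \<partial>N) * (\<integral>\<omega>. h (signal_pair k \<omega>) \<partial>N)"
    by (intro N.indep_var_lebesgue_integral N.integrable_bounded[where B = B] bd) measurable
  also have "(\<integral>\<omega>. f (signal_pair j \<omega>) \<partial>N) = emission_mean f (x j) (x (Suc j))"
    using j n by (simp add: emission_mean_def integral_distr flip: pair_law)
  also have "(\<integral>\<omega>. h (signal_pair k \<omega>) \<partial>N) = emission_mean h (x k) (x (Suc k))"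
    using j n by (simp add: emission_mean_def integral_distr flip: pair_law)
  finally show ?thesis unfolding N_def .
qed

text \<open>The formula given a hidden path is summed over all paths up to k + 1; null paths
  contribute nothing. All dependence between the two pairs of signals is thereby moved to the hidden
  chain.\<close>

lemma expectation_pair:
  fixes f h :: "'s \<times> 's \<Rightarrow> real"
  assumes [measurable]: "f \<in> borel_measurable (borel \<Otimes>\<^sub>M borel)" "h \<in> borel_measurable (borel \<Otimes>\<^sub>M borel)"
    and bd: "\<And>z. \<bar>f z\<bar> \<le> B" "\<And>z. \<bar>h z\<bar> \<le> B"
    and j: "Suc j < k"
  shows "(\<integral>\<omega>. f (signal_pair j \<omega>) * h (signal_pair k \<omega>) \<partial>M)
       = (\<integral>\<omega>. emission_mean f (X j \<omega>) (X (Suc j) \<omega>) * emission_mean h (X k \<omega>) (X (Suc k) \<omega>) \<partial>M)"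
proof -
  define F where "F x = emission_mean f (x j) (x (Suc j)) * emission_mean h (x k) (x (Suc k))" for x
  have "integrable M (\<lambda>\<omega>. f (signal_pair j \<omega>) * h (signal_pair k \<omega>))"
  proof (rule integrable_bounded[of _ "B * B"])
    show "\<bar>f (signal_pair j \<omega>) * h (signal_pair k \<omega>)\<bar> \<le> B * B" for \<omega>
      unfolding abs_mult using bd by (intro mult_mono) (auto intro: order_trans[OF abs_ge_zero])
  qed measurable
  then have "(\<integral>\<omega>. f (signal_pair j \<omega>) * h (signal_pair k \<omega>) \<partial>M)
      = (\<Sum>x\<in>paths (Suc k). \<integral>\<omega>. f (signal_pair j \<omega>) * h (signal_pair k \<omega>) * indicator (cylinder (Suc k) x) \<omega> \<partial>M)"
    by (rule integral_cylinder_decomp)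
  also have "\<dots> = (\<Sum>x\<in>paths (Suc k). prob (cylinder (Suc k) x) * F x)"
  proof (rule sum.cong[OF refl])
    fix x
    show "(\<integral>\<omega>. f (signal_pair j \<omega>) * h (signal_pair k \<omega>) * indicator (cylinder (Suc k) x) \<omega> \<partial>M) = prob (cylinder (Suc k) x) * F x"
    proof (cases "prob (cylinder (Suc k) x) = 0")
      case True
      then have "AE \<omega> in M. \<omega> \<notin> cylinder (Suc k) x"
        by (intro AE_not_in) (simp add: null_sets_def emeasure_eq_measure)
      then have "(\<integral>\<omega>. f (signal_pair j \<omega>) * h (signal_pair k \<omega>) * indicator (cylinder (Suc k) x) \<omega> \<partial>M) = (\<integral>\<omega>. 0 \<partial>M)"
        by (intro integral_cong_AE) auto
      then show ?thesis using True by simp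
    next
      case False
      then show ?thesis
        using emission_pair[OF assms(1,2) bd j order_refl False]
        by (subst integral_uniform_measure) (auto simp: F_def emeasure_eq_measure)
    qed
  qed
  also have "\<dots> = (\<integral>\<omega>. F (hist (Suc k) \<omega>) \<partial>M)" by (rule integral_hist[symmetric])
  also have "\<dots> = (\<integral>\<omega>. emission_mean f (X j \<omega>) (X (Suc j) \<omega>) * emission_mean h (X k \<omega>) (X (Suc k) \<omega>) \<partial>M)"
    using j by (simp add: F_def hist_def)
  finally show ?thesis .
qed

lemma expectation_single:
  fixes f :: "'s \<times> 's \<Rightarrow> real"
  assumes "f \<in> borel_measurable (borel \<Otimes>\<^sub>M borel)" "\<And>z. \<bar>f z\<bar> \<le> B"
  shows "(\<integral>\<omega>. f (signal_pair j \<omega>) \<partial>M) = (\<integral>\<omega>. emission_mean f (X j \<omega>) (X (Suc j) \<omega>) \<partial>M)"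
proof -
  have "emission_mean (\<lambda>_. 1) a b = 1" for a b
    using prob_space.prob_space[OF prob_space_pair_law] by (simp add: emission_mean_def)
  \<comment> \<open>The second function is the constant 1 at time j + 2, the first time whose pair
    is disjoint from the pair at j; \<open>max B 1\<close> bounds both functions.\<close>
  then show ?thesis
    using expectation_pair[of f "\<lambda>_. 1" "max B 1" j "j + 2"] assms by (simp add: le_max_iff_disj)
qed

lemma expectation_single_step:
  fixes f :: "'s \<times> 's \<Rightarrow> real"
  assumes "f \<in> borel_measurable (borel \<Otimes>\<^sub>M borel)" "\<And>z. \<bar>f z\<bar> \<le> B"
  shows "(\<integral>\<omega>. f (signal_pair k \<omega>) \<partial>M) = (\<integral>\<omega>. (\<Sum>j\<in>UNIV. P $ X k \<omega> $ j * emission_mean f (X k \<omega>) j) \<partial>M)"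
  using markov_step[of "\<lambda>_. 1" k "emission_mean f"] by (simp add: expectation_single[OF assms])

lemma integrable_X: "integrable M (\<lambda>\<omega>. g (X k \<omega>) :: real)"
  using integrable_hist[of "\<lambda>x. g (x k)" k] by (simp add: hist_def)

lemma integrable_X2: "integrable M (\<lambda>\<omega>. g (X k \<omega>) (X (Suc k) \<omega>) :: real)"
  using integrable_hist[of "\<lambda>x. g (x k) (x (Suc k))" "Suc k"] by (simp add: hist_def)

text \<open>The law of a signal pair is a mixture of finitely many pair laws with weights at most 1,
  so their sum dominates it uniformly in k. These are the dominating measures of the strong
  law.\<close>

lemma expectation_le_sum_emission_mean:
  fixes f :: "'s \<times> 's \<Rightarrow> real"
  assumes "f \<in> borel_measurable (borel \<Otimes>\<^sub>M borel)" "\<And>z. f z \<le> B" and nonneg: "\<And>z. 0 \<le> f z"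
  shows "(\<integral>\<omega>. f (signal_pair k \<omega>) \<partial>M) \<le> (\<Sum>p\<in>UNIV. emission_mean f (fst p) (snd p))"
proof -
  have "0 \<le> emission_mean f i j" for i j unfolding emission_mean_def using nonneg by simp
  then have "emission_mean f i j \<le> (\<Sum>p\<in>UNIV. emission_mean f (fst p) (snd p))" for i j
    using member_le_sum[of "(i, j)" UNIV "\<lambda>p. emission_mean f (fst p) (snd p)"] by simp
  then have "(\<integral>\<omega>. emission_mean f (X k \<omega>) (X (Suc k) \<omega>) \<partial>M) \<le> (\<integral>\<omega>. (\<Sum>p\<in>UNIV. emission_mean f (fst p) (snd p)) \<partial>M)"
    by (intro integral_mono integrable_X2) auto
  then show ?thesis
    using expectation_single[of f B k] assms by (simp add: prob_space abs_le_iff order_trans[OF _ nonneg])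
qed

text \<open>Given the hidden chain, the pairs of signals at times \<open>j\<close> and \<open>k\<close> are independent as soon as
  \<open>j + 1 < k\<close>, so only the forgetting of the chain between \<open>j + 1\<close> and \<open>k\<close> enters. The bound
  involves first moments only, hence it is uniform over truncations.\<close>

lemma covariance_bound:
  fixes f h :: "'s \<times> 's \<Rightarrow> real"
  assumes meas: "f \<in> borel_measurable (borel \<Otimes>\<^sub>M borel)" "h \<in> borel_measurable (borel \<Otimes>\<^sub>M borel)"
    and nonneg: "\<And>z. 0 \<le> f z" "\<And>z. 0 \<le> h z" and bd: "\<And>z. f z \<le> B" "\<And>z. h z \<le> B"
    and K: "\<And>i j. emission_mean f i j \<le> K" "\<And>i j. emission_mean h i j \<le> K"
    and minor: "\<And>i j. \<kappa> * pmf \<nu>0 j \<le> mat_power P n0 $ i $ j"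
    and j: "Suc j < k"
  shows "(\<integral>\<omega>. f (signal_pair j \<omega>) * h (signal_pair k \<omega>) \<partial>M) - (\<integral>\<omega>. f (signal_pair j \<omega>) \<partial>M) * (\<integral>\<omega>. h (signal_pair k \<omega>) \<partial>M)
       \<le> K\<^sup>2 * (1 - \<kappa>) ^ ((k - Suc j) div n0)"
proof -
  have abs: "\<And>z. \<bar>f z\<bar> \<le> B" "\<And>z. \<bar>h z\<bar> \<le> B" using nonneg bd by (simp_all add: abs_le_iff order_trans[OF _ nonneg(1)] order_trans[OF _ nonneg(2)])
  define r where "r = k - Suc j"
  have k: "k = Suc j + r" using j by (simp add: r_def)
  \<comment> \<open>\<open>v\<close> is the mean of h at the pair of time k given the hidden state
    at k; \<open>u\<close> is the same mean given the hidden state at j + 1.\<close>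
  define v where "v = (\<chi> c. \<Sum>d\<in>UNIV. P $ c $ d * emission_mean h c d)"
  define u where "u = mat_power P r *v v"
  define \<delta> where "\<delta> = (1 - \<kappa>) ^ (r div n0) * K"
  define G where "G \<omega> = emission_mean f (X j \<omega>) (X (Suc j) \<omega>)" for \<omega>
  have f0: "0 \<le> emission_mean f a b" "0 \<le> emission_mean h a b" for a b unfolding emission_mean_def using nonneg by simp_all
  then have K0: "0 \<le> K" using K(1)[of undefined undefined] order_trans by blast
  have "0 \<le> v $ c \<and> v $ c \<le> K" for c
  proof -
    have "v $ c \<le> (\<Sum>d\<in>UNIV. P $ c $ d * K)"
      using stochastic_P K by (auto simp: v_def stochastic_matrix_def intro!: sum_mono mult_left_mono)
    also have "\<dots> = K" using stochastic_P by (simp add: stochastic_matrix_def flip: sum_distrib_right)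
    finally show ?thesis
      using stochastic_P f0 by (auto simp: v_def stochastic_matrix_def intro!: sum_nonneg)
  qed
  then have "v $ a - v $ b \<le> K" for a b by (smt (verit))
  from mat_power_contraction[OF stochastic_P minor this]
  have u: "u $ a - u $ b \<le> \<delta>" for a b unfolding u_def \<delta>_def .
  have Eh: "(\<integral>\<omega>. h (signal_pair k \<omega>) \<partial>M) = (\<integral>\<omega>. u $ X (Suc j) \<omega> \<partial>M)"
    using expectation_single_step[OF meas(2) abs(2), of k] markov_steps[of "\<lambda>_. 1" "Suc j" v r]
    by (simp add: v_def u_def k)
  have "(\<integral>\<omega>. f (signal_pair j \<omega>) * h (signal_pair k \<omega>) \<partial>M) = (\<integral>\<omega>. G \<omega> * emission_mean h (X k \<omega>) (X (Suc k) \<omega>) \<partial>M)"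
    unfolding G_def by (rule expectation_pair[OF meas abs j])
  also have "\<dots> = (\<integral>\<omega>. G \<omega> * v $ X k \<omega> \<partial>M)"
    using markov_step[of "\<lambda>x. emission_mean f (x j) (x (Suc j))" k "emission_mean h"] j
    by (simp add: G_def v_def hist_def)
  also have "\<dots> = (\<integral>\<omega>. G \<omega> * u $ X (Suc j) \<omega> \<partial>M)"
    using markov_steps[of "\<lambda>x. emission_mean f (x j) (x (Suc j))" "Suc j" v r]
    by (simp add: G_def u_def hist_def k)
  finally have Efh: "(\<integral>\<omega>. f (signal_pair j \<omega>) * h (signal_pair k \<omega>) \<partial>M) = (\<integral>\<omega>. G \<omega> * u $ X (Suc j) \<omega> \<partial>M)" .
  have Ef: "(\<integral>\<omega>. f (signal_pair j \<omega>) \<partial>M) = (\<integral>\<omega>. G \<omega> \<partial>M)"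
    unfolding G_def by (rule expectation_single[OF meas(1) abs(1)])
  have intG: "integrable M G" unfolding G_def by (rule integrable_X2)
  have intGu: "integrable M (\<lambda>\<omega>. G \<omega> * u $ X (Suc j) \<omega>)"
    unfolding G_def using integrable_X2[of "\<lambda>a b. emission_mean f a b * u $ b"] by simp
  \<comment> \<open>\<open>c\<close> is an average of the entries of \<open>u\<close>, so each entry
    exceeds it by at most their oscillation. The covariance is the mean of \<open>G\<close> times
    \<open>u - c\<close>.\<close>
  define c where "c = (\<integral>\<omega>. h (signal_pair k \<omega>) \<partial>M)"
  have uc: "u $ a - c \<le> \<delta>" for a
  proof -
    have "u $ a - \<delta> = (\<integral>\<omega>. u $ a - \<delta> \<partial>M)" by (simp add: prob_space)
    also have "\<dots> \<le> (\<integral>\<omega>. u $ X (Suc j) \<omega> \<partial>M)"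
      using u[of a] by (intro integral_mono integrable_X) (auto simp: algebra_simps)
    finally show ?thesis by (simp add: c_def Eh)
  qed
  have \<delta>0: "0 \<le> \<delta>" using u[of undefined undefined] by simp
  have "(\<integral>\<omega>. f (signal_pair j \<omega>) * h (signal_pair k \<omega>) \<partial>M) - (\<integral>\<omega>. f (signal_pair j \<omega>) \<partial>M) * c = (\<integral>\<omega>. G \<omega> * (u $ X (Suc j) \<omega> - c) \<partial>M)"
    unfolding Efh Ef using intG intGu by (simp add: right_diff_distrib)
  also have "\<dots> \<le> (\<integral>\<omega>. K * \<delta> \<partial>M)"
  proof (rule integral_mono)
    show "integrable M (\<lambda>\<omega>. G \<omega> * (u $ X (Suc j) \<omega> - c))" using intG intGu by (simp add: right_diff_distrib)
    fix \<omega>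
    have "G \<omega> * (u $ X (Suc j) \<omega> - c) \<le> G \<omega> * \<delta>"
      by (intro mult_left_mono uc) (simp add: G_def f0)
    also have "\<dots> \<le> K * \<delta>" by (intro mult_right_mono \<delta>0) (simp add: G_def K)
    finally show "G \<omega> * (u $ X (Suc j) \<omega> - c) \<le> K * \<delta>" .
  qed simp
  also have "\<dots> = K\<^sup>2 * (1 - \<kappa>) ^ ((k - Suc j) div n0)"
    by (simp add: prob_space \<delta>_def power2_eq_square r_def)
  finally show ?thesis unfolding c_def .
qed

end

text \<open>The square expands into the double sum of all covariances. By symmetry each is bounded
  by \<open>a\<close> at the distance of its indices, and each row then sums to at most twice the
  sum of \<open>a\<close>.\<close>

lemma (in prob_space) variance_sum_le:
  fixes T :: "nat \<Rightarrow> 'a \<Rightarrow> real"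
  assumes meas: "\<And>k. T k \<in> borel_measurable M" and bd: "\<And>k \<omega>. k < n \<Longrightarrow> \<bar>T k \<omega>\<bar> \<le> B"
    and a: "\<And>d. 0 \<le> a d"
    and cov: "\<And>j k. j \<le> k \<Longrightarrow> k < n \<Longrightarrow>
       expectation (\<lambda>\<omega>. T j \<omega> * T k \<omega>) - expectation (T j) * expectation (T k) \<le> a (k - j)"
  shows "expectation (\<lambda>\<omega>. ((\<Sum>k<n. T k \<omega>) - (\<Sum>k<n. expectation (T k)))\<^sup>2) \<le> real n * (2 * (\<Sum>d<n. a d))"
proof -
  define e where "e k = expectation (T k)" for k
  have int: "integrable M (T k)" if "k < n" for k
    using meas bd[OF that] by (rule integrable_bounded)
  have int2: "integrable M (\<lambda>\<omega>. T j \<omega> * T k \<omega>)" if "j < n" "k < n" for j k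
  proof (rule integrable_bounded[where B = "B * B"])
    show "\<bar>T j \<omega> * T k \<omega>\<bar> \<le> B * B" for \<omega>
      unfolding abs_mult using bd that by (intro mult_mono) (auto intro: order_trans[OF abs_ge_zero])
  qed (use meas in measurable)
  have prod: "(T j \<omega> - e j) * (T k \<omega> - e k) = T j \<omega> * T k \<omega> - e k * T j \<omega> - e j * T k \<omega> + e j * e k" for j k \<omega>
    by (simp add: algebra_simps)
  have int3: "integrable M (\<lambda>\<omega>. (T j \<omega> - e j) * (T k \<omega> - e k))" if "j < n" "k < n" for j k
    unfolding prod using int int2 that by auto
  have covE: "expectation (\<lambda>\<omega>. (T j \<omega> - e j) * (T k \<omega> - e k)) = expectation (\<lambda>\<omega>. T j \<omega> * T k \<omega>) - e j * e k"
    if "j < n" "k < n" for j k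
    unfolding prod using int int2 that by (simp add: prob_space e_def[symmetric])
  have sq: "((\<Sum>k<n. T k \<omega>) - (\<Sum>k<n. e k))\<^sup>2 = (\<Sum>j<n. \<Sum>k<n. (T j \<omega> - e j) * (T k \<omega> - e k))" for \<omega>
    by (simp add: power2_eq_square sum_product flip: sum_subtractf)
  have "expectation (\<lambda>\<omega>. ((\<Sum>k<n. T k \<omega>) - (\<Sum>k<n. e k))\<^sup>2)
      = (\<Sum>j<n. \<Sum>k<n. expectation (\<lambda>\<omega>. T j \<omega> * T k \<omega>) - e j * e k)"
    unfolding sq using int3
    by (subst Bochner_Integration.integral_sum;
        (intro Bochner_Integration.integrable_sum sum.cong refl)?;
        (subst Bochner_Integration.integral_sum)?; (auto simp: covE)?)
  also have "\<dots> \<le> (\<Sum>j<n. \<Sum>k<n. a (if j \<le> k then k - j else j - k))"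
  proof (intro sum_mono)
    fix j k assume jk: "j \<in> {..<n}" "k \<in> {..<n}"
    show "expectation (\<lambda>\<omega>. T j \<omega> * T k \<omega>) - e j * e k \<le> a (if j \<le> k then k - j else j - k)"
    proof (cases "j \<le> k")
      case True
      with jk show ?thesis using cov[of j k] by (simp add: e_def)
    next
      case False
      with jk show ?thesis using cov[of k j] by (simp add: e_def mult.commute)
    qed
  qed
  also have "\<dots> \<le> (\<Sum>j<n. 2 * (\<Sum>d<n. a d))"
    using a by (intro sum_mono sum_dist_le) auto
  also have "\<dots> = real n * (2 * (\<Sum>d<n. a d))" by simp
  finally show ?thesis unfolding e_def .
qed

section \<open>Convergence of the state probabilities and the strong law\<close>

context hmm
begin

lemma prob_X_tendsto:
  assumes minor: "\<And>i j. \<kappa> * pmf \<nu>0 j \<le> mat_power P n0 $ i $ j" and \<kappa>: "0 < \<kappa>" "1 \<le> n0"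
  shows "(\<lambda>k. prob {\<omega> \<in> space M. X k \<omega> = c}) \<longlonglongrightarrow> pmf (invariant_pmf P) c"
proof (rule LIM_zero_cancel, rule Lim_null_comparison)
  have \<kappa>1: "\<kappa> \<le> 1" using minorization_le_1[OF stochastic_mat_power[OF stochastic_P] minor] .
  show "(\<lambda>k. (1 - \<kappa>) ^ (k div n0)) \<longlonglongrightarrow> 0" by (rule doeblin_rate_tendsto_0[OF \<kappa>(1) \<kappa>1 \<kappa>(2)])
  show "\<forall>\<^sub>F k in sequentially. norm (prob {\<omega> \<in> space M. X k \<omega> = c} - pmf (invariant_pmf P) c)
      \<le> (1 - \<kappa>) ^ (k div n0)"
  proof (intro always_eventually allI)
    fix k
    have "prob {\<omega> \<in> space M. X k \<omega> = c} = (\<integral>\<omega>. indicator {\<omega> \<in> space M. X k \<omega> = c} \<omega> \<partial>M)"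
      by simp
    also have "\<dots> = (\<integral>\<omega>. axis c 1 $ X (0 + k) \<omega> \<partial>M)"
      by (intro Bochner_Integration.integral_cong) (auto simp: axis_def)
    also have "\<dots> = (\<integral>\<omega>. mat_power P k $ X 0 \<omega> $ c \<partial>M)"
      using markov_steps[of "\<lambda>_. 1" 0 "axis c 1" k] by (simp add: matrix_vector_mult_basis column_def)
    finally have "prob {\<omega> \<in> space M. X k \<omega> = c} - pmf (invariant_pmf P) c
       = (\<integral>\<omega>. mat_power P k $ X 0 \<omega> $ c - pmf (invariant_pmf P) c \<partial>M)"
      using integrable_X[of "\<lambda>i. mat_power P k $ i $ c" 0] by (simp add: prob_space)
    also have "\<bar>\<dots>\<bar> \<le> (\<integral>\<omega>. \<bar>mat_power P k $ X 0 \<omega> $ c - pmf (invariant_pmf P) c\<bar> \<partial>M)"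
      by (rule integral_abs_bound)
    also have "\<dots> \<le> (\<integral>\<omega>. (1 - \<kappa>) ^ (k div n0) \<partial>M)"
    proof (intro integral_mono)
      show "integrable M (\<lambda>\<omega>. \<bar>mat_power P k $ X 0 \<omega> $ c - pmf (invariant_pmf P) c\<bar>)"
        by (rule integrable_X[of "\<lambda>i. \<bar>mat_power P k $ i $ c - pmf (invariant_pmf P) c\<bar>"])
      show "\<bar>mat_power P k $ X 0 \<omega> $ c - pmf (invariant_pmf P) c\<bar> \<le> (1 - \<kappa>) ^ (k div n0)" for \<omega>
        using mat_power_entry_close_invariant[OF stochastic_P minor invariant_pmf_invariant[OF stochastic_P minor \<kappa>],
            where n = k and j = c and i = "X 0 \<omega>"]
        by (simp add: abs_minus_commute)
    qed auto
    finally show "norm (prob {\<omega> \<in> space M. X k \<omega> = c} - pmf (invariant_pmf P) c) \<le> (1 - \<kappa>) ^ (k div n0)"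
      by (simp add: prob_space)
  qed
qed

lemma expectation_X: "(\<integral>\<omega>. g (X k \<omega>) \<partial>M) = (\<Sum>c\<in>UNIV. prob {\<omega> \<in> space M. X k \<omega> = c} * g c)"
  for g :: "'m \<Rightarrow> real"
proof -
  have "g (X k \<omega>) = (\<Sum>c\<in>UNIV. g c * indicator {\<omega> \<in> space M. X k \<omega> = c} \<omega>)" if "\<omega> \<in> space M" for \<omega>
  proof -
    have "(\<Sum>c\<in>UNIV. g c * indicator {\<omega> \<in> space M. X k \<omega> = c} \<omega>) = (\<Sum>c\<in>UNIV. if c = X k \<omega> then g c else 0)"
      using that by (intro sum.cong) auto
    then show ?thesis by simp
  qed
  then have "(\<integral>\<omega>. g (X k \<omega>) \<partial>M) = (\<integral>\<omega>. (\<Sum>c\<in>UNIV. g c * indicator {\<omega> \<in> space M. X k \<omega> = c} \<omega>) \<partial>M)"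
    by (intro Bochner_Integration.integral_cong) auto
  also have "\<dots> = (\<Sum>c\<in>UNIV. prob {\<omega> \<in> space M. X k \<omega> = c} * g c)"
    by (subst Bochner_Integration.integral_sum)
      (auto intro!: integrable_mult_right simp: less_top[symmetric] mult.commute)
  finally show ?thesis .
qed

text \<open>The limit of the truncated means required by Etemadi's argument comes from two sources:
  the law of the hidden state tends to the invariant one, and the means given the states tend to the
  untruncated ones by dominated convergence.\<close>

lemma strong_law_nonneg:
  fixes F :: "'s \<times> 's \<Rightarrow> real"
  assumes [measurable]: "F \<in> borel_measurable (borel \<Otimes>\<^sub>M borel)" and F0: "\<And>z. 0 \<le> F z"
    and F_int: "\<And>i j. integrable (pair_law i j) F"
    and minor: "\<And>i j. \<kappa> * pmf \<nu>0 j \<le> mat_power P n0 $ i $ j" and \<kappa>: "0 < \<kappa>" "1 \<le> n0"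
  shows "AE \<omega> in M. (\<lambda>n. (\<Sum>k<n. F (signal_pair k \<omega>)) / real n) \<longlonglongrightarrow>
           (\<Sum>i\<in>UNIV. \<Sum>j\<in>UNIV. pmf (invariant_pmf P) i * P $ i $ j * emission_mean F i j)"
proof -
  have \<kappa>1: "\<kappa> \<le> 1" using minorization_le_1[OF stochastic_mat_power[OF stochastic_P] minor] .
  define f where "f k z = trunc k (F z)" for k z
  have f_meas [measurable]: "f k \<in> borel_measurable (borel \<Otimes>\<^sub>M borel)" for k unfolding f_def by measurable
  have f0: "0 \<le> f k z" and fF: "f k z \<le> F z" and fk: "f k z \<le> real k" for k z
    by (simp_all add: f_def trunc_bounds F0)
  have f_abs: "\<bar>f k z\<bar> \<le> real k" for k z using f0 fk by simp
  \<comment> \<open>A bound, common to all truncations, for the means given two hidden states; this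
    is what the covariance bound takes as input.\<close>
  define K where "K = (\<Sum>p\<in>UNIV. emission_mean F (fst p) (snd p))"
  have fhatF0: "0 \<le> emission_mean F i j" for i j unfolding emission_mean_def by (simp add: F0)
  have fhatK: "emission_mean (f k) i j \<le> K" for k i j
  proof -
    interpret pair_law: prob_space "pair_law i j" by (rule prob_space_pair_law)
    have "emission_mean (f k) i j \<le> emission_mean F i j"
      unfolding emission_mean_def by (intro integral_mono fF F_int pair_law.integrable_bounded[OF _ f_abs]) measurable
    also have "\<dots> \<le> K"
      unfolding K_def using member_le_sum[of "(i, j)" UNIV "\<lambda>p. emission_mean F (fst p) (snd p)"] fhatF0 by simp
    finally show ?thesis .
  qed
  \<comment> \<open>The constants come from twice the sum of the covariance bounds: distances 0 and
    1 contribute 4 times the truncated second moments, the others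
    \<open>2 * K\<^sup>2 * (n0 / \<kappa>)\<close>; the remaining summand of \<open>b\<close> is
    slack.\<close>
  show ?thesis
  proof (rule etemadi_slln[where D = "\<lambda>p. pair_law (fst p) (snd p)" and F = F and M = M
        and a = 4 and b = "2 * K\<^sup>2 * (2 + real n0 / \<kappa>)"])
    show "prob_space M" by unfold_locales
    show "finite_measure (pair_law (fst p) (snd p))" for p
      using prob_space_pair_law by (rule prob_space.finite_measure)
    show "prob {\<omega> \<in> space M. real k < F (signal_pair k \<omega>)}
       \<le> (\<Sum>p\<in>UNIV. measure (pair_law (fst p) (snd p)) {x \<in> space (pair_law (fst p) (snd p)). real k < F x})" for k
    proof -
      define A where "A = {z \<in> space (borel \<Otimes>\<^sub>M borel). real k < F z}"
      have A[measurable]: "A \<in> sets (borel \<Otimes>\<^sub>M borel)" unfolding A_def by measurable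
      have "{\<omega> \<in> space M. real k < F (signal_pair k \<omega>)} \<in> sets M" by measurable
      then have "prob {\<omega> \<in> space M. real k < F (signal_pair k \<omega>)} = (\<integral>\<omega>. indicator {\<omega> \<in> space M. real k < F (signal_pair k \<omega>)} \<omega> \<partial>M)"
        by simp
      also have "\<dots> = (\<integral>\<omega>. indicator A (signal_pair k \<omega>) \<partial>M)"
        by (intro Bochner_Integration.integral_cong) (auto simp: A_def space_pair_measure indicator_def)
      also have "\<dots> \<le> (\<Sum>p\<in>UNIV. emission_mean (indicator A) (fst p) (snd p))"
        by (rule expectation_le_sum_emission_mean[where B = 1]) (auto simp: indicator_def A_def)
      also have "\<dots> = (\<Sum>p\<in>UNIV. measure (pair_law (fst p) (snd p)) {x \<in> space (pair_law (fst p) (snd p)). real k < F x})"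
      proof (intro sum.cong refl)
        fix p
        have "A = {x \<in> space (pair_law (fst p) (snd p)). real k < F x}"
          using sets_eq_imp_space_eq[OF sets_pair_law] by (auto simp: A_def)
        moreover have "A \<in> sets (pair_law (fst p) (snd p))" by measurable
        ultimately show "emission_mean (indicator A) (fst p) (snd p)
           = measure (pair_law (fst p) (snd p)) {x \<in> space (pair_law (fst p) (snd p)). real k < F x}"
          by (simp add: emission_mean_def)
      qed
      finally show ?thesis .
    qed
    show "(\<lambda>k. \<integral>\<omega>. trunc k (F (signal_pair k \<omega>)) \<partial>M) \<longlonglongrightarrow>
        (\<Sum>i\<in>UNIV. \<Sum>j\<in>UNIV. pmf (invariant_pmf P) i * P $ i $ j * emission_mean F i j)"
    proof -
      have "(\<lambda>k. emission_mean (f k) i j) \<longlonglongrightarrow> emission_mean F i j" for i j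
        unfolding emission_mean_def
      proof (rule integral_dominated_convergence[where w = F])
        have "(\<lambda>k. f k z) \<longlonglongrightarrow> F z" for z
        proof (rule tendsto_eventually)
          show "\<forall>\<^sub>F k in sequentially. f k z = F z"
            using eventually_ge_at_top[of "nat \<lceil>F z\<rceil>"]
            by eventually_elim (simp add: f_def trunc_def nat_le_iff ceiling_le_iff)
        qed
        then show "AE z in pair_law i j. (\<lambda>k. f k z) \<longlonglongrightarrow> F z" by simp
      qed (use f0 fF F_int in auto)
      then have "(\<lambda>k. \<Sum>i\<in>UNIV. prob {\<omega> \<in> space M. X k \<omega> = i} * (\<Sum>j\<in>UNIV. P $ i $ j * emission_mean (f k) i j))
          \<longlonglongrightarrow> (\<Sum>i\<in>UNIV. pmf (invariant_pmf P) i * (\<Sum>j\<in>UNIV. P $ i $ j * emission_mean F i j))"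
        by (intro tendsto_sum tendsto_mult prob_X_tendsto[OF minor \<kappa>] tendsto_const)
      moreover have "(\<integral>\<omega>. trunc k (F (signal_pair k \<omega>)) \<partial>M)
          = (\<Sum>i\<in>UNIV. prob {\<omega> \<in> space M. X k \<omega> = i} * (\<Sum>j\<in>UNIV. P $ i $ j * emission_mean (f k) i j))" for k
        using expectation_single_step[OF f_meas f_abs, of k k]
          expectation_X[of "\<lambda>i. \<Sum>j\<in>UNIV. P $ i $ j * emission_mean (f k) i j" k]
        by (simp add: f_def[symmetric])
      ultimately show ?thesis by (simp add: sum_distrib_left mult.assoc)
    qed
    fix n
    define B where "B = (\<Sum>p\<in>UNIV. \<integral>x. (trunc n (F x))\<^sup>2 \<partial>pair_law (fst p) (snd p))"
    \<comment> \<open>At distance 0 or 1 the two pairs share a signal and only second moments help.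
      At distance d \<ge> 2 the chain has d - 1 steps between the pairs to forget its state.\<close>
    define a where "a d = (if d \<le> 1 then B else K\<^sup>2 * (1 - \<kappa>) ^ ((d - 1) div n0))" for d
    have B0: "0 \<le> B" unfolding B_def by (intro sum_nonneg) simp
    have sq: "(\<integral>\<omega>. (f k (signal_pair k \<omega>))\<^sup>2 \<partial>M) \<le> B" if "k < n" for k
    proof -
      have "(f k z)\<^sup>2 \<le> (f n z)\<^sup>2" for z
        using that F0[of z] by (auto simp: f_def trunc_def intro!: power_mono)
      moreover have "integrable M (\<lambda>\<omega>. (f m (signal_pair k \<omega>))\<^sup>2)" for m
        by (intro integrable_bounded[where B = "(real m)\<^sup>2"]) (auto intro!: power_mono f0 fk)
      ultimately have "(\<integral>\<omega>. (f k (signal_pair k \<omega>))\<^sup>2 \<partial>M) \<le> (\<integral>\<omega>. (f n (signal_pair k \<omega>))\<^sup>2 \<partial>M)"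
        by (intro integral_mono) auto
      also have "\<dots> \<le> (\<Sum>p\<in>UNIV. emission_mean (\<lambda>z. (f n z)\<^sup>2) (fst p) (snd p))"
        by (intro expectation_le_sum_emission_mean[where B = "(real n)\<^sup>2"]) (auto intro!: power_mono f0 fk)
      finally show ?thesis by (simp add: B_def emission_mean_def f_def)
    qed
    have "(\<integral>\<omega>. ((\<Sum>k<n. f k (signal_pair k \<omega>)) - (\<Sum>k<n. \<integral>\<omega>. f k (signal_pair k \<omega>) \<partial>M))\<^sup>2 \<partial>M)
        \<le> real n * (2 * (\<Sum>d<n. a d))"
    proof (rule variance_sum_le[where B = "real n"])
      show "0 \<le> a d" for d using B0 \<kappa>1 by (simp add: a_def)
      show "\<bar>f k (signal_pair k \<omega>)\<bar> \<le> real n" if "k < n" for k \<omega> using f_abs[of k "signal_pair k \<omega>"] that by linarith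
      fix j k assume jk: "j \<le> k" "k < n"
      show "(\<integral>\<omega>. f j (signal_pair j \<omega>) * f k (signal_pair k \<omega>) \<partial>M) - (\<integral>\<omega>. f j (signal_pair j \<omega>) \<partial>M) * (\<integral>\<omega>. f k (signal_pair k \<omega>) \<partial>M) \<le> a (k - j)"
      proof (cases "Suc j < k")
        case True
        have "f j z \<le> real n" "f k z \<le> real n" for z using fk[of j z] fk[of k z] jk by linarith+
        moreover have "\<not> k - j \<le> 1" using True by simp
        ultimately show ?thesis
          using covariance_bound[OF f_meas[of j] f_meas[of k] f0 f0 _ _ fhatK fhatK minor True, where B = "real n"]
          by (simp add: a_def)
      next
        case False
        have int: "integrable M (\<lambda>\<omega>. (f m (signal_pair m \<omega>))\<^sup>2)" for m
          by (intro integrable_bounded[where B = "(real m)\<^sup>2"]) (auto intro!: power_mono f0 fk)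
        have "(\<integral>\<omega>. f j (signal_pair j \<omega>) * f k (signal_pair k \<omega>) \<partial>M) \<le> (\<integral>\<omega>. ((f j (signal_pair j \<omega>))\<^sup>2 + (f k (signal_pair k \<omega>))\<^sup>2) / 2 \<partial>M)"
        proof (rule integral_mono)
          show "integrable M (\<lambda>\<omega>. f j (signal_pair j \<omega>) * f k (signal_pair k \<omega>))"
          proof (rule integrable_bounded[where B = "real n * real n"])
            show "\<bar>f j (signal_pair j \<omega>) * f k (signal_pair k \<omega>)\<bar> \<le> real n * real n" for \<omega>
              unfolding abs_mult using f_abs[of j "signal_pair j \<omega>"] f_abs[of k "signal_pair k \<omega>"] jk by (intro mult_mono) linarith+
          qed measurable
          show "f j (signal_pair j \<omega>) * f k (signal_pair k \<omega>) \<le> ((f j (signal_pair j \<omega>))\<^sup>2 + (f k (signal_pair k \<omega>))\<^sup>2) / 2" for \<omega>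
            using sum_squares_bound[of "f j (signal_pair j \<omega>)" "f k (signal_pair k \<omega>)"] by simp
        qed (use int in auto)
        also have "\<dots> = ((\<integral>\<omega>. (f j (signal_pair j \<omega>))\<^sup>2 \<partial>M) + (\<integral>\<omega>. (f k (signal_pair k \<omega>))\<^sup>2 \<partial>M)) / 2"
          using int by simp
        also have "\<dots> \<le> B" using sq[of j] sq[of k] jk by simp
        also have "B = a (k - j)" using False jk unfolding a_def by (intro if_P[symmetric]) arith
        moreover have "0 \<le> (\<integral>\<omega>. f j (signal_pair j \<omega>) \<partial>M) * (\<integral>\<omega>. f k (signal_pair k \<omega>) \<partial>M)"
          by (intro mult_nonneg_nonneg Bochner_Integration.integral_nonneg f0)
        ultimately show ?thesis by linarith
      qed
    qed measurable
    also have "2 * (\<Sum>d<n. a d) \<le> 4 * B + 2 * K\<^sup>2 * (2 + real n0 / \<kappa>)"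
    proof -
      \<comment> \<open>The extra term allows splitting off distance 0 by a shift; after it the
        index 0 stands for distance 1, the other place where \<open>B\<close> occurs.\<close>
      have "(\<Sum>d<n. a d) \<le> (\<Sum>d<Suc n. a d)"
        using B0 \<kappa>1 by (simp add: a_def)
      also have "\<dots> = B + (\<Sum>d<n. a (Suc d))"
        by (subst sum.lessThan_Suc_shift) (simp add: a_def)
      also have "(\<Sum>d<n. a (Suc d)) \<le> (\<Sum>d<n. (if d = 0 then B else 0) + K\<^sup>2 * (1 - \<kappa>) ^ (d div n0))"
        using \<kappa>1 by (intro sum_mono) (auto simp: a_def)
      also have "\<dots> = (\<Sum>d<n. if d = 0 then B else 0) + K\<^sup>2 * (\<Sum>d<n. (1 - \<kappa>) ^ (d div n0))"
        by (simp add: sum.distrib sum_distrib_left)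
      also have "(\<Sum>d<n. if d = 0 then B else 0) \<le> B" using B0 by simp
      also have "K\<^sup>2 * (\<Sum>d<n. (1 - \<kappa>) ^ (d div n0)) \<le> K\<^sup>2 * (real n0 / \<kappa>)"
        by (intro mult_left_mono sum_doeblin_rate_le \<kappa> \<kappa>1) simp
      finally have "(\<Sum>d<n. a d) \<le> 2 * B + K\<^sup>2 * (real n0 / \<kappa>)" by simp
      moreover have "K\<^sup>2 * (2 + real n0 / \<kappa>) = 2 * K\<^sup>2 + K\<^sup>2 * (real n0 / \<kappa>)" by (simp add: algebra_simps)
      moreover have "0 \<le> K\<^sup>2" by simp
      ultimately show ?thesis by linarith
    qed
    finally show "(\<integral>\<omega>. ((\<Sum>k<n. trunc k (F (signal_pair k \<omega>))) - (\<Sum>k<n. \<integral>\<omega>. trunc k (F (signal_pair k \<omega>)) \<partial>M))\<^sup>2 \<partial>M)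
       \<le> real n * (4 * (\<Sum>p\<in>UNIV. \<integral>x. (trunc n (F x))\<^sup>2 \<partial>pair_law (fst p) (snd p)) + 2 * K\<^sup>2 * (2 + real n0 / \<kappa>))"
      by (simp add: f_def B_def mult_left_mono)
  qed (use F0 F_int in auto)
qed

lemma strong_law:
  fixes F :: "'s \<times> 's \<Rightarrow> real"
  assumes [measurable]: "F \<in> borel_measurable (borel \<Otimes>\<^sub>M borel)"
    and F_int: "\<And>i j. integrable (pair_law i j) F"
    and minor: "\<And>i j. \<kappa> * pmf \<nu>0 j \<le> mat_power P n0 $ i $ j" and \<kappa>: "0 < \<kappa>" "1 \<le> n0"
  shows "AE \<omega> in M. (\<lambda>n. (\<Sum>k<n. F (signal_pair k \<omega>)) / real n) \<longlonglongrightarrow>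
           (\<Sum>i\<in>UNIV. \<Sum>j\<in>UNIV. pmf (invariant_pmf P) i * P $ i $ j * emission_mean F i j)"
proof -
  define F1 where "F1 z = max 0 (F z)" for z
  define F2 where "F2 z = max 0 (- F z)" for z
  have meas: "F1 \<in> borel_measurable (borel \<Otimes>\<^sub>M borel)" "F2 \<in> borel_measurable (borel \<Otimes>\<^sub>M borel)"
    unfolding F1_def F2_def by measurable
  have int: "integrable (pair_law i j) F1" "integrable (pair_law i j) F2" for i j
    unfolding F1_def F2_def using F_int[of i j] by auto
  have F: "F z = F1 z - F2 z" for z by (simp add: F1_def F2_def)
  have emission_mean: "emission_mean F i j = emission_mean F1 i j - emission_mean F2 i j" for i j
    unfolding emission_mean_def F using int by simp
  have "AE \<omega> in M. (\<lambda>n. (\<Sum>k<n. F1 (signal_pair k \<omega>)) / real n) \<longlonglongrightarrow>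
           (\<Sum>i\<in>UNIV. \<Sum>j\<in>UNIV. pmf (invariant_pmf P) i * P $ i $ j * emission_mean F1 i j)"
    by (rule strong_law_nonneg[OF meas(1) _ int(1) minor \<kappa>]) (simp add: F1_def)
  moreover have "AE \<omega> in M. (\<lambda>n. (\<Sum>k<n. F2 (signal_pair k \<omega>)) / real n) \<longlonglongrightarrow>
           (\<Sum>i\<in>UNIV. \<Sum>j\<in>UNIV. pmf (invariant_pmf P) i * P $ i $ j * emission_mean F2 i j)"
    by (rule strong_law_nonneg[OF meas(2) _ int(2) minor \<kappa>]) (simp add: F2_def)
  ultimately show ?thesis
  proof eventually_elim
    case (elim \<omega>)
    from tendsto_diff[OF this] show ?case
      by (simp add: F emission_mean sum_subtractf right_diff_distrib diff_divide_distrib)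
  qed
qed

end

section \<open>Wald's consistency argument\<close>

text \<open>As the ball shrinks to t, the supremum of \<phi> over it tends to \<phi> t by
  continuity, dominated by \<open>G\<close>, and the integrals follow. A strict bound at t therefore
  extends to the supremum over some ball.\<close>

lemma ex_small_ball_sup_integral:
  fixes T :: "'a::{metric_space,second_countable_topology} set" and \<phi> :: "'a \<Rightarrow> 'x \<Rightarrow> real"
  assumes T: "closed T" "t \<in> T"
    and meas: "\<And>s. s \<in> T \<Longrightarrow> \<phi> s \<in> borel_measurable \<pi>"
    and cont: "\<And>x. continuous_on T (\<lambda>s. \<phi> s x)"
    and dom: "\<And>s x. s \<in> T \<Longrightarrow> \<bar>\<phi> s x\<bar> \<le> G x" and G: "integrable \<pi> G"
    and less: "(\<integral>x. \<phi> t x \<partial>\<pi>) < c"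
  shows "\<exists>r>0. \<exists>\<psi>. \<psi> \<in> borel_measurable \<pi> \<and> (\<forall>x. \<bar>\<psi> x\<bar> \<le> G x) \<and> (\<integral>x. \<psi> x \<partial>\<pi>) < c \<and>
           (\<forall>s\<in>T \<inter> ball t r. \<forall>x. \<phi> s x \<le> \<psi> x)"
proof -
  define U where "U j = T \<inter> ball t (1 / real (Suc j))" for j
  have "\<forall>j. \<exists>D. countable D \<and> D \<subseteq> U j \<and> U j \<subseteq> closure D" by (meson separable)
  then obtain D where D: "\<And>j. countable (D j)" "\<And>j. D j \<subseteq> U j" "\<And>j. U j \<subseteq> closure (D j)" by metis
  have tU: "t \<in> U j" for j using T by (simp add: U_def)
  have D_ne: "D j \<noteq> {}" for j using D(3)[of j] tU[of j] by auto
  have DT: "D j \<subseteq> T" for j using D(2)[of j] by (auto simp: U_def)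
  \<comment> \<open>The supremum runs over a countable dense subset of the ball, so that it is measurable.\<close>
  define \<psi> where "\<psi> j x = (SUP s\<in>D j. \<phi> s x)" for j x
  have bdd: "bdd_above ((\<lambda>s. \<phi> s x) ` D j)" for j x
    using dom DT[of j] by (intro bdd_aboveI2[of _ _ "G x"]) (auto simp: abs_le_iff)
  have \<psi>_meas: "\<psi> j \<in> borel_measurable \<pi>" for j
    unfolding \<psi>_def using D(1) DT meas bdd by (intro borel_measurable_cSUP) auto
  have \<phi>_le: "\<phi> s x \<le> \<psi> j x" if "s \<in> U j" for s j x
  proof (rule continuous_le_on_closure[of "D j" "\<lambda>s. \<phi> s x"])
    show "continuous_on (closure (D j)) (\<lambda>s. \<phi> s x)"
      using closure_minimal[OF DT T(1)] cont by (rule continuous_on_subset[rotated])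
    show "s \<in> closure (D j)" using that D(3) by blast
    show "\<phi> s x \<le> \<psi> j x" if "s \<in> D j" for s
      unfolding \<psi>_def by (rule cSUP_upper[OF that bdd])
  qed
  have \<psi>_le: "\<psi> j x \<le> a" if "\<And>s. s \<in> U j \<Longrightarrow> \<phi> s x \<le> a" for j x a
    unfolding \<psi>_def using that D(2) by (intro cSUP_least D_ne) blast
  have \<psi>_abs: "\<bar>\<psi> j x\<bar> \<le> G x" for j x
  proof -
    have "\<psi> j x \<le> G x" using dom by (intro \<psi>_le) (auto simp: U_def abs_le_iff)
    moreover have "- G x \<le> \<psi> j x" using \<phi>_le[OF tU, of x j] dom[OF T(2), of x] by simp
    ultimately show ?thesis by simp
  qed
  have "(\<lambda>j. \<integral>x. \<psi> j x \<partial>\<pi>) \<longlonglongrightarrow> (\<integral>x. \<phi> t x \<partial>\<pi>)"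
  proof (rule integral_dominated_convergence[where w = G])
    have "(\<lambda>j. \<psi> j x) \<longlonglongrightarrow> \<phi> t x" for x
    proof (rule LIMSEQ_I)
      fix e :: real assume e: "0 < e"
      obtain \<delta> where \<delta>: "0 < \<delta>" "\<And>s. s \<in> T \<Longrightarrow> dist s t < \<delta> \<Longrightarrow> dist (\<phi> s x) (\<phi> t x) < e / 2"
        using cont[of x] T(2) half_gt_zero[OF e] unfolding continuous_on_iff by meson
      obtain N where N: "1 / real (Suc N) < \<delta>" using \<delta>(1) nat_approx_posE by blast
      show "\<exists>N. \<forall>j\<ge>N. norm (\<psi> j x - \<phi> t x) < e"
      proof (intro exI allI impI)
        fix j assume "N \<le> j"
        then have "1 / real (Suc j) \<le> 1 / real (Suc N)" by (simp add: frac_le)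
        with N have "1 / real (Suc j) < \<delta>" by linarith
        have "\<psi> j x \<le> \<phi> t x + e / 2"
        proof (rule \<psi>_le)
          fix s assume "s \<in> U j"
          then have "dist (\<phi> s x) (\<phi> t x) < e / 2"
            using \<open>1 / real (Suc j) < \<delta>\<close> by (intro \<delta>(2)) (auto simp: U_def dist_commute)
          then show "\<phi> s x \<le> \<phi> t x + e / 2" unfolding dist_real_def by linarith
        qed
        with \<phi>_le[OF tU, of x j] e show "norm (\<psi> j x - \<phi> t x) < e" by simp
      qed
    qed
    then show "AE x in \<pi>. (\<lambda>j. \<psi> j x) \<longlonglongrightarrow> \<phi> t x" by simp
  qed (use meas T \<psi>_meas G \<psi>_abs in auto)
  from eventually_happens[OF order_tendstoD(2)[OF this less]]
  obtain j where "(\<integral>x. \<psi> j x \<partial>\<pi>) < c" by auto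
  with \<psi>_meas \<psi>_abs \<phi>_le show ?thesis
    by (intro exI[of _ "1 / real (Suc j)"] conjI exI[of _ "\<psi> j"]) (auto simp: U_def)
qed

text \<open>Finitely many balls cover the parameters at distance at least e from \<theta>. On each
  of them the sums of \<phi> lie below those of one function with a smaller mean than \<phi>
  \<theta>, so an estimate there eventually contradicts \<open>est\<close>. The law of large numbers
  is assumed for all functions dominated by \<open>G\<close> because it is applied to these
  suprema.\<close>

lemma wald_consistency:
  fixes T :: "'a::{metric_space,second_countable_topology} set" and \<phi> :: "'a \<Rightarrow> 'x \<Rightarrow> real"
    and W :: "nat \<Rightarrow> 'w \<Rightarrow> 'x"
  assumes T: "compact T" "\<theta> \<in> T"
    and meas: "\<And>s. s \<in> T \<Longrightarrow> \<phi> s \<in> borel_measurable \<pi>"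
    and cont: "\<And>x. continuous_on T (\<lambda>s. \<phi> s x)"
    and dom: "\<And>s x. s \<in> T \<Longrightarrow> \<bar>\<phi> s x\<bar> \<le> G x" and G: "integrable \<pi> G"
    and max: "\<And>t. t \<in> T \<Longrightarrow> t \<noteq> \<theta> \<Longrightarrow> (\<integral>x. \<phi> t x \<partial>\<pi>) < (\<integral>x. \<phi> \<theta> x \<partial>\<pi>)"
    and lln: "\<And>F. F \<in> borel_measurable \<pi> \<Longrightarrow> (\<And>x. \<bar>F x\<bar> \<le> G x) \<Longrightarrow>
                AE \<omega> in M. (\<lambda>n. (\<Sum>k<n. F (W k \<omega>)) / real n) \<longlonglongrightarrow> (\<integral>x. F x \<partial>\<pi>)"
    and est: "AE \<omega> in M. \<forall>n\<ge>1. est n \<omega> \<in> T \<and>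
                (\<Sum>k<n. \<phi> \<theta> (W k \<omega>)) \<le> (\<Sum>k<n. \<phi> (est n \<omega>) (W k \<omega>))"
  shows "AE \<omega> in M. (\<lambda>n. est n \<omega>) \<longlonglongrightarrow> \<theta>"
proof -
  have near: "AE \<omega> in M. \<forall>\<^sub>F n in sequentially. dist (est n \<omega>) \<theta> < e" if e: "0 < e" for e
  proof -
    define K where "K = T - ball \<theta> e"
    have "compact K" unfolding K_def by (intro compact_diff T) simp
    define Q where "Q t r \<psi> \<longleftrightarrow> \<psi> \<in> borel_measurable \<pi> \<and> (\<forall>x. \<bar>\<psi> x\<bar> \<le> G x) \<and>
      (\<integral>x. \<psi> x \<partial>\<pi>) < (\<integral>x. \<phi> \<theta> x \<partial>\<pi>) \<and> (\<forall>s\<in>T \<inter> ball t r. \<forall>x. \<phi> s x \<le> \<psi> x)" for t r \<psi>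
    have "\<exists>r>0. \<exists>\<psi>. Q t r \<psi>" if "t \<in> K" for t
      unfolding Q_def
    proof (rule ex_small_ball_sup_integral[where G = G])
      show "(\<integral>x. \<phi> t x \<partial>\<pi>) < (\<integral>x. \<phi> \<theta> x \<partial>\<pi>)" using that e by (intro max) (auto simp: K_def)
    qed (use that compact_imp_closed[OF T(1)] meas cont dom G in \<open>auto simp: K_def\<close>)
    then obtain r \<psi> where r: "\<And>t. t \<in> K \<Longrightarrow> 0 < r t" and Q: "\<And>t. t \<in> K \<Longrightarrow> Q t (r t) (\<psi> t)"
      by metis
    then have \<psi>: "\<And>t. t \<in> K \<Longrightarrow> \<psi> t \<in> borel_measurable \<pi>" "\<And>t x. t \<in> K \<Longrightarrow> \<bar>\<psi> t x\<bar> \<le> G x"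
        "\<And>t. t \<in> K \<Longrightarrow> (\<integral>x. \<psi> t x \<partial>\<pi>) < (\<integral>x. \<phi> \<theta> x \<partial>\<pi>)"
        "\<And>t s x. t \<in> K \<Longrightarrow> s \<in> T \<Longrightarrow> s \<in> ball t (r t) \<Longrightarrow> \<phi> s x \<le> \<psi> t x"
      by (auto simp: Q_def)
    have "K \<subseteq> (\<Union>t\<in>K. ball t (r t))" using r by force
    then obtain C where C: "C \<subseteq> K" "finite C" "K \<subseteq> (\<Union>t\<in>C. ball t (r t))"
      using compactE_image[OF \<open>compact K\<close>, of K "\<lambda>t. ball t (r t)"] by auto
    have "AE \<omega> in M. \<forall>t\<in>C. (\<lambda>n. (\<Sum>k<n. \<psi> t (W k \<omega>)) / real n) \<longlonglongrightarrow> (\<integral>x. \<psi> t x \<partial>\<pi>)"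
      using C \<psi> by (intro AE_finite_allI lln) auto
    moreover have "AE \<omega> in M. (\<lambda>n. (\<Sum>k<n. \<phi> \<theta> (W k \<omega>)) / real n) \<longlonglongrightarrow> (\<integral>x. \<phi> \<theta> x \<partial>\<pi>)"
      by (intro lln meas dom T)
    ultimately show ?thesis using est
    proof eventually_elim
      case (elim \<omega>)
      have "\<forall>\<^sub>F n in sequentially. (\<Sum>k<n. \<psi> t (W k \<omega>)) / real n < (\<Sum>k<n. \<phi> \<theta> (W k \<omega>)) / real n"
        if "t \<in> C" for t
      proof -
        have "t \<in> K" using that C(1) by blast
        from dense[OF \<psi>(3)[OF this]]
        obtain c where c: "(\<integral>x. \<psi> t x \<partial>\<pi>) < c" "c < (\<integral>x. \<phi> \<theta> x \<partial>\<pi>)" by blast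
        from order_tendstoD(2)[OF elim(1)[rule_format, OF that] c(1)] order_tendstoD(1)[OF elim(2) c(2)]
        show ?thesis by eventually_elim (rule less_trans)
      qed
      then have "\<forall>\<^sub>F n in sequentially. \<forall>t\<in>C. (\<Sum>k<n. \<psi> t (W k \<omega>)) / real n < (\<Sum>k<n. \<phi> \<theta> (W k \<omega>)) / real n"
        using C(2) by (simp add: eventually_ball_finite)
      then show ?case using eventually_ge_at_top[of 1]
      proof eventually_elim
        case (elim n)
        note estn = \<open>\<forall>n\<ge>1. est n \<omega> \<in> T \<and> _\<close>[rule_format, OF elim(2)]
        show ?case
        proof (rule ccontr)
          assume "\<not> dist (est n \<omega>) \<theta> < e"
          with estn have "est n \<omega> \<in> K" by (simp add: K_def dist_commute)
          then obtain t where t: "t \<in> C" "est n \<omega> \<in> ball t (r t)" using C(3) by blast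
          then have "(\<Sum>k<n. \<phi> (est n \<omega>) (W k \<omega>)) \<le> (\<Sum>k<n. \<psi> t (W k \<omega>))"
            using C(1) t estn by (intro sum_mono \<psi>(4)) auto
          moreover have "(\<Sum>k<n. \<psi> t (W k \<omega>)) < (\<Sum>k<n. \<phi> \<theta> (W k \<omega>))"
            using elim(1)[rule_format, OF t(1)] by (simp add: divide_less_cancel)
          ultimately show False using estn by linarith
        qed
      qed
    qed
  qed
  \<comment> \<open>Countably many radii keep the union of the exceptional sets null.\<close>
  have "AE \<omega> in M. \<forall>i. \<forall>\<^sub>F n in sequentially. dist (est n \<omega>) \<theta> < 1 / real (Suc i)"
    by (subst AE_all_countable) (auto intro: near)
  then show ?thesis
  proof eventually_elim
    case (elim \<omega>)
    show ?case
    proof (rule tendstoI)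
      fix e :: real assume "0 < e"
      then obtain i where "1 / real (Suc i) < e" using nat_approx_posE by blast
      with elim[rule_format, of i] show "\<forall>\<^sub>F n in sequentially. dist (est n \<omega>) \<theta> < e"
        by (auto elim: eventually_mono)
    qed
  qed
qed

section \<open>Gibbs' inequality and identifiability\<close>

text \<open>\<open>D\<close> is u - 1 - ln u at u = q / p: nonnegative, and 0 only for u = 1. Both
  masses being 1, its mean under the density p is the difference of the two means of
  logarithms.\<close>

lemma gibbs_strict:
  fixes p q :: "'x \<Rightarrow> real"
  assumes p: "integrable \<mu> p" "\<And>x. 0 < p x" and q: "integrable \<mu> q" "\<And>x. 0 < q x"
    and mass: "(\<integral>x. p x \<partial>\<mu>) = 1" "(\<integral>x. q x \<partial>\<mu>) = 1"
    and lnp: "integrable (density \<mu> p) (\<lambda>x. ln (p x))" and lnq: "integrable (density \<mu> p) (\<lambda>x. ln (q x))"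
    and ne: "\<not> (AE x in \<mu>. p x = q x)"
  shows "(\<integral>x. ln (q x) \<partial>density \<mu> p) < (\<integral>x. ln (p x) \<partial>density \<mu> p)"
proof -
  have [measurable]: "p \<in> borel_measurable \<mu>" "q \<in> borel_measurable \<mu>" using p q by auto
  define \<pi> where "\<pi> = density \<mu> p"
  define D where "D x = q x / p x - 1 - (ln (q x) - ln (p x))" for x
  have p0: "p x \<noteq> 0" "0 \<le> p x" for x using p(2)[of x] by auto
  have ln_le: "ln (q x) - ln (p x) \<le> q x / p x - 1" for x
    using ln_le_minus_one[of "q x / p x"] p(2)[of x] q(2)[of x] by (simp add: ln_div)
  have int_one: "integrable \<pi> (\<lambda>x. 1 :: real)"
    unfolding \<pi>_def using p p0 by (subst integrable_density) auto
  have int_ratio: "integrable \<pi> (\<lambda>x. q x / p x)"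
    unfolding \<pi>_def using q p0 by (subst integrable_density) auto
  have int_D: "integrable \<pi> D"
    unfolding D_def using int_one int_ratio lnp lnq by (auto simp: \<pi>_def)
  have D0: "0 \<le> D x" for x using ln_le[of x] by (simp add: D_def)
  have "(\<integral>x. 1 \<partial>\<pi>) = (1 :: real)"
    unfolding \<pi>_def using p0 mass by (subst integral_density) auto
  moreover have "(\<integral>x. q x / p x \<partial>\<pi>) = 1"
    unfolding \<pi>_def using p0 mass by (subst integral_density) auto
  ultimately have D_eq: "(\<integral>x. D x \<partial>\<pi>) = (\<integral>x. ln (p x) \<partial>\<pi>) - (\<integral>x. ln (q x) \<partial>\<pi>)"
    unfolding D_def using int_one int_ratio lnp lnq by (simp add: \<pi>_def[symmetric])
  have "(\<integral>x. D x \<partial>\<pi>) \<noteq> 0"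
  proof
    assume "(\<integral>x. D x \<partial>\<pi>) = 0"
    then have "AE x in \<pi>. D x = 0"
      using integral_nonneg_eq_0_iff_AE[OF int_D] D0 by simp
    then have "AE x in \<mu>. D x = 0"
      unfolding \<pi>_def using p(2) by (subst (asm) AE_density) auto
    then have "AE x in \<mu>. p x = q x"
    proof eventually_elim
      case (elim x)
      then have "ln (q x / p x) = q x / p x - 1"
        using p(2)[of x] q(2)[of x] by (simp add: D_def ln_div)
      then have "q x / p x = 1" using p(2)[of x] q(2)[of x] by (intro ln_eq_minus_one) auto
      then show ?case using p0[of x] by simp
    qed
    with ne show False ..
  qed
  moreover have "0 \<le> (\<integral>x. D x \<partial>\<pi>)" using D0 by simp
  ultimately show ?thesis using D_eq by (simp add: \<pi>_def)
qed

text \<open>Equality of mixtures of point masses is expressed through the mass at each point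
  \<open>v\<close>, which involves no \<sigma>-field on the parameters.\<close>

definition mixture_identifiable ::
    "'m::finite itself \<Rightarrow> 'b set \<Rightarrow> ('b \<Rightarrow> 's::topological_space measure) \<Rightarrow> bool" where
  "mixture_identifiable _ B Q \<longleftrightarrow>
     (\<forall>(b :: 'm \<Rightarrow> 'b) (b' :: 'm \<Rightarrow> 'b) c c'. (\<forall>i. b i \<in> B \<and> b' i \<in> B \<and> 0 \<le> c i \<and> 0 \<le> c' i) \<longrightarrow>
        (\<Sum>i\<in>UNIV. c i) = 1 \<longrightarrow> (\<Sum>i\<in>UNIV. c' i) = 1 \<longrightarrow>
        (\<forall>A\<in>sets borel. (\<Sum>i\<in>UNIV. c i * measure (Q (b i)) A) = (\<Sum>i\<in>UNIV. c' i * measure (Q (b' i)) A)) \<longrightarrow>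
        (\<forall>v. (\<Sum>i\<in>UNIV. if b i = v then c i else 0) = (\<Sum>i\<in>UNIV. if b' i = v then c' i else 0)))"

lemma mixture_identifiableD:
  fixes b b' :: "'m::finite \<Rightarrow> 'b"
  assumes "mixture_identifiable TYPE('m) B Q" "\<And>i. b i \<in> B" "\<And>i. b' i \<in> B" "\<And>i. 0 \<le> c i" "\<And>i. 0 \<le> c' i"
    "(\<Sum>i\<in>UNIV. c i) = 1" "(\<Sum>i\<in>UNIV. c' i) = 1"
    "\<And>A. A \<in> sets borel \<Longrightarrow> (\<Sum>i\<in>UNIV. c i * measure (Q (b i)) A) = (\<Sum>i\<in>UNIV. c' i * measure (Q (b' i)) A)"
  shows "(\<Sum>i\<in>UNIV. if b i = v then c i else 0) = (\<Sum>i\<in>UNIV. if b' i = v then c' i else 0)"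
  using assms(2-) assms(1)[unfolded mixture_identifiable_def, rule_format, of b b' c c' v] by blast

text \<open>Identifiability speaks of probability mixtures. Fixing a set in one coordinate of a pair
  law leaves weights of smaller total mass, which are normalized by their sum; if it is 0, all
  weights vanish.\<close>

lemma mixture_weights_unique:
  fixes Q :: "'b \<Rightarrow> 's::topological_space measure" and b :: "'m::finite \<Rightarrow> 'b"
  assumes mix: "mixture_identifiable TYPE('m) B Q"
    and b: "\<And>i. b i \<in> B" "inj b"
    and c: "\<And>i. 0 \<le> c i" "\<And>i. 0 \<le> c' i" and mass: "(\<Sum>i\<in>UNIV. c i) = (\<Sum>i\<in>UNIV. c' i)"
    and eq: "\<And>A. A \<in> sets borel \<Longrightarrow> (\<Sum>i\<in>UNIV. c i * measure (Q (b i)) A) = (\<Sum>i\<in>UNIV. c' i * measure (Q (b i)) A)"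
  shows "c j = c' j"
proof (cases "(\<Sum>i\<in>UNIV. c i) = 0")
  case True
  then have "c j = 0" "c' j = 0"
    using mass c by (simp_all add: sum_nonneg_eq_0_iff)
  then show ?thesis by simp
next
  case False
  define s where "s = (\<Sum>i\<in>UNIV. c i)"
  have s: "0 < s" using False c by (simp add: s_def sum_nonneg order_less_le)
  have "(\<Sum>i\<in>UNIV. if b i = b j then c i / s else 0) = (\<Sum>i\<in>UNIV. if b i = b j then c' i / s else 0)"
  proof (rule mixture_identifiableD[OF mix])
    fix A :: "'s set" assume "A \<in> sets borel"
    from arg_cong[OF eq[OF this], of "\<lambda>x. x / s"]
    show "(\<Sum>i\<in>UNIV. c i / s * measure (Q (b i)) A) = (\<Sum>i\<in>UNIV. c' i / s * measure (Q (b i)) A)"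
      by (simp add: sum_divide_distrib)
  qed (use c s b mass in \<open>auto simp: s_def simp flip: sum_divide_distrib\<close>)
  moreover have "(b i = b j) = (i = j)" for i using b(2) by (auto dest: injD)
  ultimately show ?thesis using s by simp
qed

lemma pair_law_identifiable:
  fixes Q :: "'b \<Rightarrow> 's::topological_space measure" and b b' :: "'m::finite \<Rightarrow> 'b"
    and P P' :: "real ^ 'm ^ 'm" and \<mu> \<mu>' :: "'m \<Rightarrow> real"
  assumes mix: "mixture_identifiable TYPE('m) B Q"
    and b: "\<And>i. b i \<in> B" "inj b" and b': "\<And>i. b' i \<in> B" "inj b'"
    and order: "\<And>\<tau>. bij \<tau> \<Longrightarrow> (\<And>i. b (\<tau> i) = b' i) \<Longrightarrow> (\<forall>i. \<tau> i = i)"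
    and \<mu>: "\<And>i. 0 < \<mu> i" "(\<Sum>i\<in>UNIV. \<mu> i) = 1" and \<mu>': "\<And>i. 0 < \<mu>' i" "(\<Sum>i\<in>UNIV. \<mu>' i) = 1"
    and P: "stochastic_matrix P" and P': "stochastic_matrix P'"
    and inv: "\<And>j. (\<Sum>i\<in>UNIV. \<mu> i * P $ i $ j) = \<mu> j"
    and Q_mass: "\<And>\<beta>. \<beta> \<in> B \<Longrightarrow> measure (Q \<beta>) UNIV = 1"
    and eq: "\<And>A C. A \<in> sets borel \<Longrightarrow> C \<in> sets borel \<Longrightarrow>
      (\<Sum>i\<in>UNIV. \<Sum>j\<in>UNIV. \<mu> i * P $ i $ j * (measure (Q (b i)) A * measure (Q (b j)) C)) =
      (\<Sum>i\<in>UNIV. \<Sum>j\<in>UNIV. \<mu>' i * P' $ i $ j * (measure (Q (b' i)) A * measure (Q (b' j)) C))"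
  shows "b = b'" "P = P'"
proof -
  have UNIV: "(UNIV :: 's set) \<in> sets borel" by simp
  have row: "(\<Sum>j\<in>UNIV. P $ i $ j) = 1" "(\<Sum>j\<in>UNIV. P' $ i $ j) = 1" for i
    using P P' by (auto simp: stochastic_matrix_def)
  have P0: "0 \<le> P $ i $ j" "0 \<le> P' $ i $ j" for i j
    using P P' by (auto simp: stochastic_matrix_def)
  have marg: "(\<Sum>i\<in>UNIV. \<Sum>j\<in>UNIV. m i * R $ i $ j * (x i * measure (Q (d j)) UNIV)) = (\<Sum>i\<in>UNIV. m i * x i)"
    if "\<And>i. (\<Sum>j\<in>UNIV. R $ i $ j) = 1" "\<And>i. d i \<in> B" for m x :: "'m \<Rightarrow> real" and R :: "real ^ 'm ^ 'm" and d
  proof -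
    have "(\<Sum>j\<in>UNIV. m i * R $ i $ j * (x i * measure (Q (d j)) UNIV)) = m i * x i * (\<Sum>j\<in>UNIV. R $ i $ j)" for i
      unfolding sum_distrib_left using that Q_mass by (intro sum.cong) auto
    then show ?thesis using that by simp
  qed
  have first: "(\<Sum>i\<in>UNIV. \<mu> i * measure (Q (b i)) A) = (\<Sum>i\<in>UNIV. \<mu>' i * measure (Q (b' i)) A)" if "A \<in> sets borel" for A
    using eq[OF that UNIV] by (simp add: marg row b b')
  have atoms: "(\<Sum>i\<in>UNIV. if b i = v then \<mu> i else 0) = (\<Sum>i\<in>UNIV. if b' i = v then \<mu>' i else 0)" for v
    by (rule mixture_identifiableD[OF mix b(1) b'(1) less_imp_le[OF \<mu>(1)] less_imp_le[OF \<mu>'(1)] \<mu>(2) \<mu>'(2) first])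
  \<comment> \<open>As all weights are positive, each \<open>b i\<close> is an atom of the other
    mixture, so the families agree up to a permutation \<rho>. The ordering assumption permutes
    \<open>b\<close> and not \<open>b'\<close>, whence the inverse of \<rho>.\<close>
  have "\<exists>k. b' k = b i" for i
  proof (rule ccontr)
    assume "\<not> (\<exists>k. b' k = b i)"
    then have "(\<Sum>k\<in>UNIV. if b k = b i then \<mu> k else 0) = 0" by (simp add: atoms)
    moreover have "(\<Sum>k\<in>UNIV. if b k = b i then \<mu> k else 0) = \<mu> i" using b(2) by (simp add: inj_eq)
    ultimately show False using \<mu>(1)[of i] by simp
  qed
  then obtain \<rho> where \<rho>: "\<And>i. b' (\<rho> i) = b i" by metis
  have "inj \<rho>" using b(2) by (intro injI) (metis \<rho> injD)
  then have bij: "bij \<rho>" by (simp add: bij_def finite_UNIV_inj_surj)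
  have "\<forall>i. inv \<rho> i = i"
    using \<rho> bij by (intro order) (auto simp: bij_imp_bij_inv bij_is_surj surj_f_inv_f simp flip: \<rho>)
  then show bb: "b = b'"
    using \<rho> bij by (metis bij_inv_eq_iff ext)
  have \<mu>\<mu>: "\<mu> i = \<mu>' i" for i
    using atoms[of "b i"] b(2) by (simp add: bb[symmetric] inj_eq)
  note unique = mixture_weights_unique[OF mix b]
  \<comment> \<open>For a fixed set \<open>A\<close> in the first coordinate, both sides of the identity are mixtures in the second.\<close>
  have half: "(\<Sum>i\<in>UNIV. \<mu> i * P $ i $ j * measure (Q (b i)) A) = (\<Sum>i\<in>UNIV. \<mu> i * P' $ i $ j * measure (Q (b i)) A)"
    if A: "A \<in> sets borel" for A j
  proof (rule unique)
    let ?c = "\<lambda>j. \<Sum>i\<in>UNIV. \<mu> i * P $ i $ j * measure (Q (b i)) A"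
    let ?c' = "\<lambda>j. \<Sum>i\<in>UNIV. \<mu> i * P' $ i $ j * measure (Q (b i)) A"
    show "0 \<le> ?c j" "0 \<le> ?c' j" for j
      using \<mu> P0 by (auto intro!: sum_nonneg simp: less_imp_le)
    have "(\<Sum>j\<in>UNIV. \<Sum>i\<in>UNIV. \<mu> i * R $ i $ j * measure (Q (b i)) A) = (\<Sum>i\<in>UNIV. \<mu> i * measure (Q (b i)) A)"
      if "\<And>i. (\<Sum>j\<in>UNIV. R $ i $ j) = 1" for R :: "real ^ 'm ^ 'm"
      using marg[of R b \<mu> "\<lambda>i. measure (Q (b i)) A", OF that b(1)]
      by (subst sum.swap) (simp add: Q_mass b mult.assoc)
    from this[OF row(1)] this[OF row(2)] show "(\<Sum>j\<in>UNIV. ?c j) = (\<Sum>j\<in>UNIV. ?c' j)" by simp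
    fix C :: "'s set" assume C: "C \<in> sets borel"
    have swap: "(\<Sum>j\<in>UNIV. (\<Sum>i\<in>UNIV. \<mu> i * R $ i $ j * measure (Q (b i)) A) * measure (Q (b j)) C)
      = (\<Sum>i\<in>UNIV. \<Sum>j\<in>UNIV. \<mu> i * R $ i $ j * (measure (Q (b i)) A * measure (Q (b j)) C))" for R :: "real ^ 'm ^ 'm"
      unfolding sum_distrib_right by (subst sum.swap) (simp add: mult.assoc)
    show "(\<Sum>j\<in>UNIV. ?c j * measure (Q (b j)) C) = (\<Sum>j\<in>UNIV. ?c' j * measure (Q (b j)) C)"
      unfolding swap using eq[OF A C] by (simp add: bb[symmetric] \<mu>\<mu>)
  qed
  \<comment> \<open>For fixed j, \<open>half\<close> is an identity between mixtures in the first
    coordinate; taking the whole space for A shows that their total masses agree.\<close>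
  have "\<mu> i * P $ i $ j = \<mu> i * P' $ i $ j" for i j
  proof (rule unique[where c = "\<lambda>i. \<mu> i * P $ i $ j" and c' = "\<lambda>i. \<mu> i * P' $ i $ j" and j = i])
    show "(\<Sum>i\<in>UNIV. \<mu> i * P $ i $ j) = (\<Sum>i\<in>UNIV. \<mu> i * P' $ i $ j)"
      using half[OF UNIV, of j] by (simp add: Q_mass b)
  qed (use \<mu> P0 half in \<open>auto simp: less_imp_le\<close>)
  then show "P = P'" using \<mu>(1) by (simp add: vec_eq_iff less_le)
qed

section \<open>Signal densities and pair densities\<close>

text \<open>\<open>elog\<close> is -\<infinity> at nonpositive arguments, so a finite difference
  forces positivity. In this way a finite supremum of logarithmic ratios makes all densities
  positive at once.\<close>

lemma elog_diff_le_imp: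
  assumes "0 < x" "\<bar>elog x - elog y\<bar> \<le> ereal c"
  shows "0 < y" "\<bar>ln x - ln y\<bar> \<le> c"
proof -
  show y: "0 < y"
  proof (rule ccontr)
    assume "\<not> 0 < y"
    then have "\<bar>elog x - elog y\<bar> = \<infinity>" using assms(1) by (simp add: elog_def)
    with assms(2) show False by simp
  qed
  show "\<bar>ln x - ln y\<bar> \<le> c" using assms y by (simp add: elog_def)
qed

lemma elog_diff: "0 < x \<Longrightarrow> 0 < y \<Longrightarrow> \<bar>elog x - elog y\<bar> = ereal \<bar>ln x - ln y\<bar>"
  by (simp add: elog_def)

text \<open>The ratio \<open>q b / q b0\<close> is replaced by 1 outside a set \<open>E\<close> of full measure, so that its regularity
  holds at every point. As \<open>\<sigma>\<close> need not be \<open>\<sigma>\<close>-finite, the law of \<open>b0\<close> serves as reference measure.\<close>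

lemma signal_ratio:
  fixes \<sigma> :: "'s::topological_space measure" and q :: "'b::topological_space \<Rightarrow> 's \<Rightarrow> real"
  assumes sets_\<sigma>: "sets \<sigma> = sets borel"
    and q_meas: "\<And>b. b \<in> B \<Longrightarrow> q b \<in> borel_measurable \<sigma>"
    and q_nonneg: "\<And>b y. b \<in> B \<Longrightarrow> 0 \<le> q b y"
    and ac: "\<And>b b'. b \<in> B \<Longrightarrow> b' \<in> B \<Longrightarrow> absolutely_continuous (signal_law \<sigma> q b) (signal_law \<sigma> q b')"
    and q_cont: "AE y in \<sigma>. continuous_on B (\<lambda>b. q b y)"
    and L1: "\<And>b. b \<in> B \<Longrightarrow>
               in_L1 (signal_law \<sigma> q b) (\<lambda>y. SUP b'\<in>B. \<bar>elog (q b y) - elog (q b' y)\<bar>)"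
    and b0: "b0 \<in> B"
  obtains r :: "'b \<Rightarrow> 's \<Rightarrow> real" and g :: "'s \<Rightarrow> real" and E :: "'s set" where
    "\<And>b. b \<in> B \<Longrightarrow> r b \<in> borel_measurable borel"
    "\<And>b y. b \<in> B \<Longrightarrow> 0 < r b y"
    "\<And>y. continuous_on B (\<lambda>b. r b y)"
    "\<And>b y. b \<in> B \<Longrightarrow> \<bar>ln (r b y)\<bar> \<le> g y"
    "g \<in> borel_measurable borel"
    "\<And>b. b \<in> B \<Longrightarrow> integrable (signal_law \<sigma> q b) g"
    "\<And>b. b \<in> B \<Longrightarrow> signal_law \<sigma> q b = density (signal_law \<sigma> q b0) (\<lambda>y. ennreal (r b y))"
    "E \<in> sets borel" "\<And>b. b \<in> B \<Longrightarrow> AE y in signal_law \<sigma> q b. y \<in> E"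
    "\<And>y. y \<in> E \<Longrightarrow> 0 < q b0 y" "\<And>b y. b \<in> B \<Longrightarrow> y \<in> E \<Longrightarrow> q b y = q b0 y * r b y"
proof -
  note [measurable_cong] = sets_\<sigma>
  note q_meas[measurable]
  define \<rho> where "\<rho> = signal_law \<sigma> q b0"
  have space_\<sigma>: "space \<sigma> = UNIV" using sets_eq_imp_space_eq[OF sets_\<sigma>] by simp
  have sets_\<rho> [measurable_cong]: "sets \<rho> = sets borel" by (simp add: \<rho>_def signal_law_def sets_\<sigma>)
  have space_\<rho>: "space \<rho> = UNIV" using sets_eq_imp_space_eq[OF sets_\<rho>] by simp
  obtain g0 where g0: "integrable \<rho> g0"
    "AE y in \<rho>. (SUP b'\<in>B. \<bar>elog (q b0 y) - elog (q b' y)\<bar>) = ereal (g0 y)"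
    using L1[OF b0] unfolding in_L1_def \<rho>_def by blast
  have AE_\<rho>: "(AE y in \<rho>. R y) \<longleftrightarrow> (AE y in \<sigma>. 0 < q b0 y \<longrightarrow> R y)" for R
    unfolding \<rho>_def signal_law_def using q_meas[OF b0] by (subst AE_density) auto
  \<comment> \<open>One null set serves all parameters, because the supremum over \<open>B\<close>
    is formed before the exceptional set is chosen.\<close>
  have "AE y in \<rho>. 0 < q b0 y \<and> continuous_on B (\<lambda>b. q b y) \<and>
      (SUP b'\<in>B. \<bar>elog (q b0 y) - elog (q b' y)\<bar>) = ereal (g0 y)"
    using g0(2) q_cont by (auto simp: AE_\<rho>)
  then obtain N where N: "N \<in> null_sets \<rho>"
    "\<And>y. y \<notin> N \<Longrightarrow> 0 < q b0 y \<and> continuous_on B (\<lambda>b. q b y) \<and>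
      (SUP b'\<in>B. \<bar>elog (q b0 y) - elog (q b' y)\<bar>) = ereal (g0 y)"
    unfolding eventually_ae_filter by (auto simp: space_\<rho>)
  define E where "E = - N"
  have E [measurable]: "E \<in> sets borel" using N(1) by (auto simp: E_def null_sets_def sets_\<rho>)
  define r where "r b y = (if y \<in> E then q b y / q b0 y else 1)" for b y
  define g where "g y = (if y \<in> E then g0 y else 0)" for y
  have pos0: "0 < q b0 y" if "y \<in> E" for y using that N(2) by (auto simp: E_def)
  have bound: "0 < q b y" "\<bar>ln (q b0 y) - ln (q b y)\<bar> \<le> g0 y" if "y \<in> E" "b \<in> B" for y b
  proof -
    have "\<bar>elog (q b0 y) - elog (q b y)\<bar> \<le> (SUP b'\<in>B. \<bar>elog (q b0 y) - elog (q b' y)\<bar>)"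
      using that by (intro SUP_upper)
    then have *: "\<bar>elog (q b0 y) - elog (q b y)\<bar> \<le> ereal (g0 y)" using that N(2)[of y] by (simp add: E_def)
    show "0 < q b y" "\<bar>ln (q b0 y) - ln (q b y)\<bar> \<le> g0 y"
      using elog_diff_le_imp[OF pos0[OF that(1)] *] by auto
  qed
  have r_meas: "r b \<in> borel_measurable borel" if "b \<in> B" for b
    using q_meas[OF that] q_meas[OF b0] unfolding r_def by (simp cong: measurable_cong_sets[OF sets_\<sigma> refl])
  have r_pos: "0 < r b y" if "b \<in> B" for b y using that pos0 bound by (auto simp: r_def)
  have ln_r: "\<bar>ln (r b y)\<bar> \<le> g y" if "b \<in> B" for b y
    using that pos0[of y] bound[of y b] by (auto simp: r_def g_def ln_div abs_minus_commute)
  have g0_meas: "g0 \<in> borel_measurable borel"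
    using g0(1) by (simp cong: measurable_cong_sets[OF sets_\<rho> refl] add: borel_measurable_integrable)
  have g_meas: "g \<in> borel_measurable borel"
    unfolding g_def using g0_meas by measurable
  \<comment> \<open>Absolute continuity carries the null set of the law of \<open>b0\<close> over to
    every other law.\<close>
  have AE_E: "AE y in signal_law \<sigma> q b. y \<in> E" if "b \<in> B" for b
  proof -
    have "N \<in> null_sets (signal_law \<sigma> q b)"
      using ac[OF b0 that] N(1) by (auto simp: absolutely_continuous_def \<rho>_def)
    from AE_not_in[OF this] show ?thesis by (simp add: E_def)
  qed
  have density: "signal_law \<sigma> q b = density \<rho> (\<lambda>y. ennreal (r b y))" if b: "b \<in> B" for b
  proof -
    have [measurable]: "r b \<in> borel_measurable \<sigma>" using r_meas[OF b] by (simp cong: measurable_cong_sets[OF sets_\<sigma> refl])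
    have q0 [measurable]: "q b0 \<in> borel_measurable \<sigma>" "q b \<in> borel_measurable \<sigma>" using q_meas b b0 by auto
    have 1: "AE y in \<sigma>. 0 < q b y \<longrightarrow> y \<in> E"
      using AE_E[OF b] unfolding signal_law_def using q0 by (subst (asm) AE_density) auto
    have "density \<rho> (\<lambda>y. ennreal (r b y)) = density \<sigma> (\<lambda>y. ennreal (q b0 y) * ennreal (r b y))"
      unfolding \<rho>_def signal_law_def by (rule density_density_eq) auto
    also have "\<dots> = density \<sigma> (\<lambda>y. ennreal (q b y))"
    proof (rule density_cong)
      have "AE y in \<sigma>. 0 < q b0 y \<longrightarrow> y \<in> E" using AE_E[OF b0] unfolding \<rho>_def[symmetric] AE_\<rho> .
      with 1 show "AE y in \<sigma>. ennreal (q b0 y) * ennreal (r b y) = ennreal (q b y)"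
      proof eventually_elim
        case (elim y)
        show ?case
        proof (cases "y \<in> E")
          case True
          then show ?thesis using pos0[of y] q_nonneg[OF b, of y]
            by (simp add: r_def flip: ennreal_mult)
        next
          case False
          with elim q_nonneg[OF b, of y] q_nonneg[OF b0, of y] have "q b y = 0" "q b0 y = 0" by auto
          then show ?thesis by simp
        qed
      qed
    qed auto
    finally show ?thesis by (simp add: signal_law_def)
  qed
  \<comment> \<open>\<open>g\<close> comes from the ratios to \<open>q b0\<close>. Under the law of
    another b, the triangle inequality through \<open>q b\<close> bounds it by twice the integrable
    supremum belonging to b.\<close>
  have g_int: "integrable (signal_law \<sigma> q b) g" if b: "b \<in> B" for b
  proof -
    obtain h where h: "integrable (signal_law \<sigma> q b) h"
      "AE y in signal_law \<sigma> q b. (SUP b'\<in>B. \<bar>elog (q b y) - elog (q b' y)\<bar>) = ereal (h y)"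
      using L1[OF b] unfolding in_L1_def by blast
    show ?thesis
    proof (rule Bochner_Integration.integrable_bound)
      show "integrable (signal_law \<sigma> q b) (\<lambda>y. 2 * h y)" using h(1) by simp
      have "sets (signal_law \<sigma> q b) = sets borel" by (simp add: signal_law_def sets_\<sigma>)
      then show "g \<in> borel_measurable (signal_law \<sigma> q b)"
        using g_meas by (simp cong: measurable_cong_sets)
      show "AE y in signal_law \<sigma> q b. norm (g y) \<le> norm (2 * h y)"
        using h(2)
      proof eventually_elim
        case (elim y)
        show ?case
        proof (cases "y \<in> E")
          case True
          have le: "\<bar>ln (q b y) - ln (q b' y)\<bar> \<le> h y" if "b' \<in> B" for b'
          proof -
            have "\<bar>elog (q b y) - elog (q b' y)\<bar> \<le> (SUP b'\<in>B. \<bar>elog (q b y) - elog (q b' y)\<bar>)"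
              using that by (intro SUP_upper)
            then show ?thesis using elog_diff_le_imp(2)[OF bound(1)[OF True b]] elim by metis
          qed
          have "ereal (g0 y) = (SUP b'\<in>B. \<bar>elog (q b0 y) - elog (q b' y)\<bar>)"
            using True N(2)[of y] by (simp add: E_def)
          also have "\<dots> \<le> ereal (2 * h y)"
          proof (rule SUP_least)
            fix b' assume b': "b' \<in> B"
            show "\<bar>elog (q b0 y) - elog (q b' y)\<bar> \<le> ereal (2 * h y)"
              using le[OF b'] le[OF b0] by (simp add: elog_diff bound(1)[OF True] b' b0)
          qed
          finally have "g0 y \<le> 2 * h y" by simp
          moreover have "0 \<le> g0 y" using bound(2)[OF True b0] by simp
          ultimately show ?thesis using True by (simp add: g_def)
        qed (simp add: g_def)
      qed
    qed
  qed
  show ?thesis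
  proof (rule that[of r g E])
    show "continuous_on B (\<lambda>b. r b y)" for y
    proof (cases "y \<in> E")
      case True
      then have "continuous_on B (\<lambda>b. q b y)" using N(2)[of y] by (simp add: E_def)
      then show ?thesis using True pos0[of y] unfolding r_def by (simp add: continuous_on_divide)
    qed (simp add: r_def)
    show "q b y = q b0 y * r b y" if "y \<in> E" for b y
      using that pos0[of y] by (simp add: r_def)
  qed (use r_meas r_pos ln_r g_meas g_int density[unfolded \<rho>_def] E AE_E pos0 in auto)
qed

lemma measure_pair_Times:
  assumes "sigma_finite_measure N" "A \<in> sets M" "B \<in> sets N"
  shows "measure (M \<Otimes>\<^sub>M N) (A \<times> B) = measure M A * measure N B"
  using sigma_finite_measure.emeasure_pair_measure_Times[OF assms]
  by (simp add: measure_def enn2real_mult)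

lemma sum_transition_weights:
  fixes P :: "real ^ 'm::finite ^ 'm"
  assumes "stochastic_matrix P"
  shows "(\<Sum>i\<in>UNIV. \<Sum>j\<in>UNIV. pmf \<mu> i * P $ i $ j) = 1"
proof -
  have "(\<Sum>i\<in>UNIV. pmf \<mu> i) = 1" by (rule sum_pmf_eq_1) auto
  then show ?thesis using assms by (simp add: stochastic_matrix_def flip: sum_distrib_left)
qed

text \<open>The pair density is a convex combination of products, each lying between exp (- (g y + g
  y')) and exp (g y + g y').\<close>

lemma pair_density_bounds:
  fixes P :: "real ^ 'm::finite ^ 'm"
  assumes P: "stochastic_matrix P"
    and r: "\<And>i y. 0 < r (b $ i) y" "\<And>i y. \<bar>ln (r (b $ i) y)\<bar> \<le> g y"
  shows "0 < pair_density P b r y y'" "\<bar>ln (pair_density P b r y y')\<bar> \<le> g y + g y'"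
proof -
  let ?w = "\<lambda>i j. pmf (invariant_pmf P) i * P $ i $ j"
  have w0: "0 \<le> ?w i j" for i j using P by (simp add: stochastic_matrix_def)
  have one: "exp (- g y) \<le> r (b $ i) y \<and> r (b $ i) y \<le> exp (g y)" for i y
  proof -
    have "- g y \<le> ln (r (b $ i) y)" "ln (r (b $ i) y) \<le> g y" using r(2)[of i y] by linarith+
    then show ?thesis using r(1)[of i y] by (metis exp_le_cancel_iff exp_ln)
  qed
  have two: "exp (- (g y + g y')) \<le> r (b $ i) y * r (b $ j) y'" "r (b $ i) y * r (b $ j) y' \<le> exp (g y + g y')" for i j
  proof -
    have "exp (- g y) * exp (- g y') \<le> r (b $ i) y * r (b $ j) y'"
      using one by (intro mult_mono less_imp_le[OF r(1)]) auto
    then show "exp (- (g y + g y')) \<le> r (b $ i) y * r (b $ j) y'" by (simp flip: exp_add)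
    have "r (b $ i) y * r (b $ j) y' \<le> exp (g y) * exp (g y')"
      using one by (intro mult_mono less_imp_le[OF r(1)]) auto
    then show "r (b $ i) y * r (b $ j) y' \<le> exp (g y + g y')" by (simp flip: exp_add)
  qed
  have const: "(\<Sum>i\<in>UNIV. \<Sum>j\<in>UNIV. ?w i j * c) = c" for c
    using sum_transition_weights[OF P] by (simp flip: sum_distrib_right)
  have pd: "pair_density P b r y y' = (\<Sum>i\<in>UNIV. \<Sum>j\<in>UNIV. ?w i j * (r (b $ i) y * r (b $ j) y'))"
    by (simp add: pair_density_def mult.assoc)
  have lo: "exp (- (g y + g y')) \<le> pair_density P b r y y'"
    unfolding pd by (subst const[symmetric]) (intro sum_mono mult_left_mono two w0)
  have hi: "pair_density P b r y y' \<le> exp (g y + g y')"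
    unfolding pd by (subst const[of "exp (g y + g y')", symmetric]) (intro sum_mono mult_left_mono two w0)
  show pos: "0 < pair_density P b r y y'" using lo exp_gt_zero[of "- (g y + g y')"] by linarith
  have "- (g y + g y') \<le> ln (pair_density P b r y y')" using lo pos by (simp add: ln_ge_iff)
  moreover have "ln (pair_density P b r y y') \<le> g y + g y'" using hi pos by (metis exp_ln exp_le_cancel_iff)
  ultimately show "\<bar>ln (pair_density P b r y y')\<bar> \<le> g y + g y'" by linarith
qed

text \<open>Used with values of \<open>q b0\<close> as factors: these do not depend on the
  parameter, so the criterion changes by a constant only.\<close>

lemma pair_density_scale:
  assumes "\<And>i. q (b $ i) y = c * r (b $ i) y" "\<And>i. q (b $ i) y' = c' * r (b $ i) y'"
  shows "pair_density P b q y y' = c * c' * pair_density P b r y y'"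
  unfolding pair_density_def assms sum_distrib_left by (intro sum.cong refl) (simp add: ac_simps)

lemma continuous_on_pair_density:
  fixes P :: "'a::topological_space \<Rightarrow> real ^ 'm::finite ^ 'm" and b :: "'a \<Rightarrow> 'b::topological_space ^ 'm"
  assumes "continuous_on T P" "continuous_on T b"
    and "\<And>i. continuous_on T (\<lambda>t. pmf (invariant_pmf (P t)) i)"
    and b: "\<And>t i. t \<in> T \<Longrightarrow> b t $ i \<in> B" and r: "\<And>y. continuous_on B (\<lambda>\<beta>. r \<beta> y)"
  shows "continuous_on T (\<lambda>t. pair_density (P t) (b t) r y y')"
proof -
  have "continuous_on T (\<lambda>t. r (b t $ i) y)" for i y
    using b by (intro continuous_on_compose2[OF r] continuous_on_component assms) auto
  then show ?thesis
    unfolding pair_density_def by (intro continuous_intros assms)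
qed

lemma pair_density_measurable:
  assumes "\<And>i. r (b $ i) \<in> borel_measurable N"
  shows "(\<lambda>z. pair_density P b r (fst z) (snd z)) \<in> borel_measurable (N \<Otimes>\<^sub>M N)"
  unfolding pair_density_def using assms by measurable

text \<open>The density is a weighted sum of product densities, so \<pi> is the corresponding
  mixture of product laws. This identifies the limit in the strong law with an integral over
  \<pi>.\<close>

lemma integral_pair_density:
  fixes P :: "real ^ 'm::finite ^ 'm" and r :: "'b \<Rightarrow> 's \<Rightarrow> real" and F :: "'s \<times> 's \<Rightarrow> real"
  assumes \<rho>: "prob_space \<rho>" and P: "stochastic_matrix P"
    and r: "\<And>i. r (b $ i) \<in> borel_measurable \<rho>" "\<And>i y. 0 \<le> r (b $ i) y"
    and prob: "\<And>i. prob_space (density \<rho> (r (b $ i)))"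
    and F: "F \<in> borel_measurable (\<rho> \<Otimes>\<^sub>M \<rho>)"
      "\<And>i j. integrable (density \<rho> (r (b $ i)) \<Otimes>\<^sub>M density \<rho> (r (b $ j))) F"
  defines "\<pi> \<equiv> density (\<rho> \<Otimes>\<^sub>M \<rho>) (\<lambda>z. pair_density P b r (fst z) (snd z))"
  shows "integrable \<pi> F"
    and "(\<integral>z. F z \<partial>\<pi>) = (\<Sum>i\<in>UNIV. \<Sum>j\<in>UNIV. pmf (invariant_pmf P) i * P $ i $ j *
            (\<integral>z. F z \<partial>(density \<rho> (r (b $ i)) \<Otimes>\<^sub>M density \<rho> (r (b $ j)))))"
proof -
  interpret \<rho>: prob_space \<rho> by fact
  note r(1)[measurable] F(1)[measurable]
  let ?p = "\<lambda>z. pair_density P b r (fst z) (snd z)"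
  let ?Q = "\<lambda>i. density \<rho> (r (b $ i))"
  let ?w = "\<lambda>i j. pmf (invariant_pmf P) i * P $ i $ j"
  have pm: "?p \<in> borel_measurable (\<rho> \<Otimes>\<^sub>M \<rho>)" by (rule pair_density_measurable) (rule r)
  have p0: "0 \<le> ?p z" for z
    using P r(2) by (auto simp: pair_density_def stochastic_matrix_def intro!: sum_nonneg mult_nonneg_nonneg)
  have Q: "?Q i \<Otimes>\<^sub>M ?Q j = density (\<rho> \<Otimes>\<^sub>M \<rho>) (\<lambda>z. ennreal (r (b $ i) (fst z) * r (b $ j) (snd z)))" for i j
  proof -
    have sf: "sigma_finite_measure (?Q j)"
      using prob[of j] by (simp add: finite_measure.sigma_finite_measure prob_space.finite_measure)
    have "?Q i \<Otimes>\<^sub>M ?Q j = density (\<rho> \<Otimes>\<^sub>M \<rho>) (\<lambda>(x, y). ennreal (r (b $ i) x) * ennreal (r (b $ j) y))"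
      by (rule pair_measure_density[OF _ _ _ sf]) (auto intro: \<rho>.sigma_finite_measure_axioms)
    also have "(\<lambda>(x, y). ennreal (r (b $ i) x) * ennreal (r (b $ j) y))
        = (\<lambda>z. ennreal (r (b $ i) (fst z) * r (b $ j) (snd z)))"
      using r(2) by (auto simp: ennreal_mult)
    finally show ?thesis .
  qed
  have int: "integrable (\<rho> \<Otimes>\<^sub>M \<rho>) (\<lambda>z. r (b $ i) (fst z) * r (b $ j) (snd z) * F z)" for i j
    using F(2)[of i j] r(2) unfolding Q by (subst (asm) integrable_density) auto
  have eq: "(\<integral>z. F z \<partial>(?Q i \<Otimes>\<^sub>M ?Q j)) = (\<integral>z. r (b $ i) (fst z) * r (b $ j) (snd z) * F z \<partial>(\<rho> \<Otimes>\<^sub>M \<rho>))" for i j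
    unfolding Q using r(2) by (subst integral_density) auto
  have pF: "?p z * F z = (\<Sum>i\<in>UNIV. \<Sum>j\<in>UNIV. ?w i j * (r (b $ i) (fst z) * r (b $ j) (snd z) * F z))" for z
    unfolding pair_density_def sum_distrib_right by (intro sum.cong refl) (simp add: ac_simps)
  show "integrable \<pi> F"
    unfolding \<pi>_def using pm p0 int
    by (subst integrable_density) (auto simp: pF intro!: Bochner_Integration.integrable_sum)
  have "(\<integral>z. F z \<partial>\<pi>) = (\<integral>z. ?p z * F z \<partial>(\<rho> \<Otimes>\<^sub>M \<rho>))"
    unfolding \<pi>_def using pm p0 by (subst integral_density) auto
  also have "\<dots> = (\<Sum>i\<in>UNIV. \<Sum>j\<in>UNIV. ?w i j * (\<integral>z. r (b $ i) (fst z) * r (b $ j) (snd z) * F z \<partial>(\<rho> \<Otimes>\<^sub>M \<rho>)))"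
    unfolding pF using int
    by (simp add: Bochner_Integration.integral_sum Bochner_Integration.integrable_sum)
  finally show "(\<integral>z. F z \<partial>\<pi>) = (\<Sum>i\<in>UNIV. \<Sum>j\<in>UNIV. ?w i j * (\<integral>z. F z \<partial>(?Q i \<Otimes>\<^sub>M ?Q j)))"
    unfolding eq .
qed

lemma integrable_pair_add:
  fixes g :: "'s \<Rightarrow> real"
  assumes "prob_space M1" "prob_space M2" "integrable M1 g" "integrable M2 g"
  shows "integrable (M1 \<Otimes>\<^sub>M M2) (\<lambda>z. g (fst z) + g (snd z))"
proof -
  interpret M1: prob_space M1 by fact
  interpret M2: prob_space M2 by fact
  interpret pair_prob_space M1 M2 ..
  have [measurable]: "g \<in> borel_measurable M1" "g \<in> borel_measurable M2" using assms by auto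
  have "integrable (distr (M1 \<Otimes>\<^sub>M M2) M1 fst) g"
    using assms(3) by (simp add: M2.distr_pair_fst)
  then have "integrable (M1 \<Otimes>\<^sub>M M2) (\<lambda>z. g (fst z))"
    by (rule integrable_distr[rotated]) simp
  moreover have "integrable (M1 \<Otimes>\<^sub>M M2) (\<lambda>z. g (snd z))"
    using assms(4) by (intro Fubini_integrable) auto
  ultimately show ?thesis by simp
qed

section \<open>Consistency of the maximum entropy estimator\<close>

text \<open>The law of a signal pair is dominated by the sum of the pair laws, and each of these
  gives mass 0 to a first signal outside \<open>E\<close>.\<close>

lemma (in hmm) AE_signal_in:
  assumes [measurable]: "E \<in> sets borel" and E: "\<And>i. AE y in L i. y \<in> E"
  shows "AE \<omega> in M. Y k \<omega> \<in> E"
proof -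
  define f :: "'s \<times> 's \<Rightarrow> real" where "f z = indicator ((- E) \<times> UNIV) z" for z
  have Ec: "- E \<in> sets borel" using assms(1) by simp
  have [measurable]: "(- E) \<times> UNIV \<in> sets (borel \<Otimes>\<^sub>M borel)" using Ec by (intro pair_measureI) auto
  have f_meas: "f \<in> borel_measurable (borel \<Otimes>\<^sub>M borel)" unfolding f_def by measurable
  have "emission_mean f i j = 0" for i j
  proof -
    interpret j: prob_space "L j" by (rule prob_L)
    have "- E \<in> null_sets (L i)"
      using E[of i] Ec by (subst AE_iff_null_sets) (simp_all add: sets_L)
    then have 0: "measure (L i) (- E) = 0" by (simp add: null_sets_def measure_def)
    have "emission_mean f i j = measure (pair_law i j) ((- E) \<times> UNIV)"
      unfolding emission_mean_def f_def using sets_eq_imp_space_eq[OF sets_pair_law[of i j]]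
      by (simp add: space_pair_measure)
    also have "\<dots> = measure (L i) (- E) * measure (L j) UNIV"
      using Ec by (intro measure_pair_Times j.sigma_finite_measure_axioms) (auto simp: sets_L)
    finally show ?thesis using 0 by simp
  qed
  then have "(\<integral>\<omega>. f (signal_pair k \<omega>) \<partial>M) \<le> 0"
    using expectation_le_sum_emission_mean[OF f_meas, of 1 k] by (simp add: f_def)
  moreover have "(\<integral>\<omega>. f (signal_pair k \<omega>) \<partial>M) = prob {\<omega> \<in> space M. Y k \<omega> \<notin> E}"
  proof -
    have "{\<omega> \<in> space M. Y k \<omega> \<notin> E} \<in> sets M" by measurable
    moreover have "(\<integral>\<omega>. f (signal_pair k \<omega>) \<partial>M) = (\<integral>\<omega>. indicator {\<omega> \<in> space M. Y k \<omega> \<notin> E} \<omega> \<partial>M)"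
      by (intro Bochner_Integration.integral_cong) (auto simp: f_def signal_pair_def indicator_def)
    ultimately show ?thesis by simp
  qed
  ultimately have "prob {\<omega> \<in> space M. Y k \<omega> \<notin> E} = 0" by (simp add: measure_le_0_iff)
  then show ?thesis by (subst AE_iff_measurable[OF _ refl]) (auto simp: emeasure_eq_measure)
qed

lemma elog_mult: "0 < x \<Longrightarrow> 0 < y \<Longrightarrow> elog (x * y) = ereal (ln x + ln y)"
  by (simp add: elog_def ln_mult)

theorem theorem4p1:
  fixes \<Theta>0 \<Theta> :: "(real ^ 'p) set"
    and O0 Obar :: "(real ^ 'd) set"
    and \<sigma> :: "'s::topological_space measure"
    and q :: "real ^ 'd \<Rightarrow> 's \<Rightarrow> real"
    and P :: "real ^ 'p \<Rightarrow> real ^ 'm ^ 'm"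
    and \<beta> :: "real ^ 'p \<Rightarrow> (real ^ 'd) ^ 'm"
    and M :: "'w measure"
    and X :: "nat \<Rightarrow> 'w \<Rightarrow> 'm"
    and Y :: "nat \<Rightarrow> 'w \<Rightarrow> 's"
    and \<nu> :: "'m pmf"
    and \<theta> :: "real ^ 'p"
    and \<theta>_hat :: "nat \<Rightarrow> 'w \<Rightarrow> real ^ 'p"
  assumes m_ge_2: "2 \<le> CARD('m)"
    and S: "signal_space TYPE('s)"
    and sets_\<sigma>: "sets \<sigma> = sets borel"
    and q_meas: "\<And>b. b \<in> Obar \<Longrightarrow> q b \<in> borel_measurable \<sigma>"
    and q_nonneg: "\<And>b y. b \<in> Obar \<Longrightarrow> 0 \<le> q b y"
    and q_prob: "\<And>b. b \<in> Obar \<Longrightarrow> prob_space (signal_law \<sigma> q b)"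
    and P_stoch: "\<And>t. t \<in> \<Theta> \<Longrightarrow> stochastic_matrix (P t)"
    and H0_\<Theta>: "open \<Theta>0" "bounded \<Theta>0" "\<Theta> = closure \<Theta>0"
    and H0_O: "open O0" "bounded O0" "Obar = closure O0"
    and H0_\<beta>: "\<And>t i. t \<in> \<Theta> \<Longrightarrow> \<beta> t $ i \<in> Obar"
    and H0_cont: "continuous_on \<Theta> (\<lambda>t. (P t, \<beta> t))"
    and H0_inj: "inj_on (\<lambda>t. (P t, \<beta> t)) \<Theta>"
    and H0_weak: "weakly_continuous_on Obar (signal_law \<sigma> q)"
    and H1: "\<exists>n0\<ge>1. \<exists>\<kappa>>0. \<exists>\<nu>0 :: 'm pmf. (\<forall>j. 0 < pmf \<nu>0 j) \<and>
               (\<forall>t\<in>\<Theta>. \<forall>i j. \<kappa> * pmf \<nu>0 j \<le> mat_power (P t) n0 $ i $ j)"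
    and H2: "\<And>t t' (\<tau> :: 'm \<Rightarrow> 'm). t \<in> \<Theta> \<Longrightarrow> t' \<in> \<Theta> \<Longrightarrow> bij \<tau> \<Longrightarrow>
               (\<And>i. \<beta> t $ \<tau> i = \<beta> t' $ i) \<Longrightarrow> (\<forall>i. \<tau> i = i)"
    and H3: "\<And>(b :: 'm \<Rightarrow> real ^ 'd) (b' :: 'm \<Rightarrow> real ^ 'd) (c :: 'm \<Rightarrow> real) (c' :: 'm \<Rightarrow> real).
               (\<And>i. b i \<in> Obar) \<Longrightarrow> (\<And>i. b' i \<in> Obar) \<Longrightarrow>
               (\<And>i. 0 \<le> c i) \<Longrightarrow> (\<And>i. 0 \<le> c' i) \<Longrightarrow>
               (\<Sum>i\<in>UNIV. c i) = 1 \<Longrightarrow> (\<Sum>i\<in>UNIV. c' i) = 1 \<Longrightarrow>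
               (\<And>A. A \<in> sets borel \<Longrightarrow>
                  (\<Sum>i\<in>UNIV. c i * measure (signal_law \<sigma> q (b i)) A) =
                  (\<Sum>i\<in>UNIV. c' i * measure (signal_law \<sigma> q (b' i)) A)) \<Longrightarrow>
               (\<forall>B\<in>sets borel.
                  (\<Sum>i\<in>UNIV. c i * measure (return borel (b i)) B) =
                  (\<Sum>i\<in>UNIV. c' i * measure (return borel (b' i)) B))"
    and H4_i: "\<And>b b'. b \<in> Obar \<Longrightarrow> b' \<in> Obar \<Longrightarrow>
               absolutely_continuous (signal_law \<sigma> q b) (signal_law \<sigma> q b') \<and>
               absolutely_continuous (signal_law \<sigma> q b') (signal_law \<sigma> q b)"
    and H4_ii: "AE y in \<sigma>. continuous_on Obar (\<lambda>b. q b y)"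
    and H4_iii: "\<And>b. b \<in> Obar \<Longrightarrow>
               in_L1 (signal_law \<sigma> q b) (\<lambda>y. SUP b'\<in>Obar. \<bar>elog (q b y) - elog (q b' y)\<bar>)"
    and \<theta>: "\<theta> \<in> \<Theta>"
    and HMM: "hidden_markov_model M (P \<theta>) \<nu> (\<lambda>i. signal_law \<sigma> q (\<beta> \<theta> $ i)) X Y"
    and ME: "AE \<omega> in M. \<forall>n\<ge>1.
               is_arg_min (\<lambda>t. empirical_entropy (P t) (\<beta> t) q n (\<lambda>k. Y k \<omega>))
                 (\<lambda>t. t \<in> \<Theta>) (\<theta>_hat n \<omega>)"
  shows "AE \<omega> in M. (\<lambda>n. \<theta>_hat n \<omega>) \<longlonglongrightarrow> \<theta>"
proof -
  obtain n0 \<kappa> \<nu>0 where n0: "1 \<le> n0" and \<kappa>: "0 < \<kappa>" and \<nu>0: "\<And>j. 0 < pmf \<nu>0 j"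
    and minor: "\<And>t i j. t \<in> \<Theta> \<Longrightarrow> \<kappa> * pmf \<nu>0 j \<le> mat_power (P t) n0 $ i $ j"
    using H1 by blast
  define Q where "Q = signal_law \<sigma> q"
  \<comment> \<open>The reference parameter is that of an arbitrary hidden state under \<theta>; any
    element of \<open>Obar\<close> would serve.\<close>
  define b0 where "b0 = \<beta> \<theta> $ undefined"
  define \<rho> where "\<rho> = Q b0"
  have b0: "b0 \<in> Obar" unfolding b0_def by (rule H0_\<beta>[OF \<theta>])
  have sets_Q: "sets (Q b) = sets borel" for b by (simp add: Q_def signal_law_def sets_\<sigma>)
  have space_Q: "space (Q b) = UNIV" for b using sets_eq_imp_space_eq[OF sets_Q] by simp
  have prob_Q: "prob_space (Q b)" if "b \<in> Obar" for b using q_prob[OF that] by (simp add: Q_def)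
  have sets_\<rho> [measurable_cong]: "sets \<rho> = sets borel" by (simp add: \<rho>_def sets_Q)
  have prob_\<rho>: "prob_space \<rho>" unfolding \<rho>_def by (rule prob_Q[OF b0])
  obtain r g E where r_meas: "\<And>b. b \<in> Obar \<Longrightarrow> r b \<in> borel_measurable borel"
    and r_pos: "\<And>b y. b \<in> Obar \<Longrightarrow> 0 < r b y"
    and r_cont: "\<And>y. continuous_on Obar (\<lambda>b. r b y)"
    and ln_r: "\<And>b y. b \<in> Obar \<Longrightarrow> \<bar>ln (r b y)\<bar> \<le> g y"
    and g_meas: "g \<in> borel_measurable borel"
    and g_int: "\<And>b. b \<in> Obar \<Longrightarrow> integrable (Q b) g"
    and Q_density: "\<And>b. b \<in> Obar \<Longrightarrow> Q b = density \<rho> (\<lambda>y. ennreal (r b y))"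
    and E: "E \<in> sets borel" and AE_E: "\<And>b. b \<in> Obar \<Longrightarrow> AE y in Q b. y \<in> E"
    and q0_pos: "\<And>y. y \<in> E \<Longrightarrow> 0 < q b0 y"
    and q_eq: "\<And>b y. b \<in> Obar \<Longrightarrow> y \<in> E \<Longrightarrow> q b y = q b0 y * r b y"
    using signal_ratio[of \<sigma> Obar q b0, OF sets_\<sigma> q_meas q_nonneg conjunct1[OF H4_i] H4_ii H4_iii b0]
    unfolding Q_def \<rho>_def by blast

  \<comment> \<open>\<open>p t\<close> is the stationary density of two consecutive signals relative
    to \<rho> times \<rho>, and \<open>\<pi> t\<close> the stationary law itself.\<close>
  define p where "p t z = pair_density (P t) (\<beta> t) r (fst z) (snd z)" for t and z :: "'s \<times> 's"
  define G where "G z = g (fst z) + g (snd z)" for z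
  define \<pi> where "\<pi> t = density (\<rho> \<Otimes>\<^sub>M \<rho>) (p t)" for t
  have sets_\<rho>2 [measurable_cong]: "sets (\<rho> \<Otimes>\<^sub>M \<rho>) = sets (borel \<Otimes>\<^sub>M borel)"
    by (intro sets_pair_measure_cong sets_\<rho>)
  have p_pos: "0 < p t z" and ln_p: "\<bar>ln (p t z)\<bar> \<le> G z" if "t \<in> \<Theta>" for t z
    unfolding p_def G_def using that by (auto intro!: pair_density_bounds P_stoch r_pos ln_r H0_\<beta>)
  have p_meas: "p t \<in> borel_measurable (borel \<Otimes>\<^sub>M borel)" if "t \<in> \<Theta>" for t
    unfolding p_def using that by (intro pair_density_measurable r_meas H0_\<beta>)
  have law: "integrable (\<pi> t) F"
    "(\<integral>z. F z \<partial>\<pi> t) = (\<Sum>i\<in>UNIV. \<Sum>j\<in>UNIV. pmf (invariant_pmf (P t)) i * P t $ i $ j *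
        (\<integral>z. F z \<partial>(Q (\<beta> t $ i) \<Otimes>\<^sub>M Q (\<beta> t $ j))))"
    if t: "t \<in> \<Theta>" and F: "F \<in> borel_measurable (borel \<Otimes>\<^sub>M borel)"
      "\<And>i j. integrable (Q (\<beta> t $ i) \<Otimes>\<^sub>M Q (\<beta> t $ j)) F" for t and F :: "'s \<times> 's \<Rightarrow> real"
  proof -
    have Qi: "Q (\<beta> t $ i) = density \<rho> (r (\<beta> t $ i))" for i by (rule Q_density[OF H0_\<beta>[OF t]])
    have *: "F \<in> borel_measurable (\<rho> \<Otimes>\<^sub>M \<rho>)" using F(1) by (simp cong: measurable_cong_sets[OF sets_\<rho>2 refl])
    have **: "r (\<beta> t $ i) \<in> borel_measurable \<rho>" for i
      using r_meas[OF H0_\<beta>[OF t]] by (simp cong: measurable_cong_sets[OF sets_\<rho> refl])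
    note thms = integral_pair_density[where r = r and b = "\<beta> t" and F = F, OF prob_\<rho> P_stoch[OF t] ** less_imp_le[OF r_pos[OF H0_\<beta>[OF t]]]
        prob_Q[OF H0_\<beta>[OF t], unfolded Qi] * F(2)[unfolded Qi]]
    show "integrable (\<pi> t) F" unfolding \<pi>_def p_def by (rule thms)
    show "(\<integral>z. F z \<partial>\<pi> t) = (\<Sum>i\<in>UNIV. \<Sum>j\<in>UNIV. pmf (invariant_pmf (P t)) i * P t $ i $ j *
        (\<integral>z. F z \<partial>(Q (\<beta> t $ i) \<Otimes>\<^sub>M Q (\<beta> t $ j))))"
      unfolding \<pi>_def p_def Qi by (rule thms)
  qed
  have sets_QQ [measurable_cong]: "sets (Q b \<Otimes>\<^sub>M Q b') = sets (borel \<Otimes>\<^sub>M borel)" for b b'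
    by (intro sets_pair_measure_cong sets_Q)
  have prob_QQ: "prob_space (Q b \<Otimes>\<^sub>M Q b')" if "b \<in> Obar" "b' \<in> Obar" for b b'
  proof -
    interpret b: prob_space "Q b" by (rule prob_Q[OF that(1)])
    interpret b': prob_space "Q b'" by (rule prob_Q[OF that(2)])
    interpret pair_prob_space "Q b" "Q b'" ..
    show ?thesis by unfold_locales
  qed
  have G_meas: "G \<in> borel_measurable (borel \<Otimes>\<^sub>M borel)" unfolding G_def using g_meas by measurable
  have G_QQ: "integrable (Q b \<Otimes>\<^sub>M Q b') G" if "b \<in> Obar" "b' \<in> Obar" for b b'
    unfolding G_def using that by (intro integrable_pair_add prob_Q g_int)
  have G_\<pi>: "integrable (\<pi> t) G" if "t \<in> \<Theta>" for t
    by (intro law(1) that G_meas G_QQ H0_\<beta>)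
  have sets_\<pi> [measurable_cong]: "sets (\<pi> t) = sets (borel \<Otimes>\<^sub>M borel)" for t by (simp add: \<pi>_def sets_\<rho>2)
  have dominated: "integrable N F"
    if "integrable N G" "sets N = sets (borel \<Otimes>\<^sub>M borel)" "F \<in> borel_measurable (borel \<Otimes>\<^sub>M borel)" "\<And>z. \<bar>F z\<bar> \<le> G z"
    for N and F :: "'s \<times> 's \<Rightarrow> real"
  proof (rule Bochner_Integration.integrable_bound[OF that(1)])
    show "F \<in> borel_measurable N" using that(3) by (simp cong: measurable_cong_sets[OF that(2) refl])
    show "AE z in N. norm (F z) \<le> norm (G z)" by (intro AE_I2) (simp only: real_norm_def order_trans[OF that(4) abs_ge_self])
  qed
  have ln_p_meas: "(\<lambda>z. ln (p t z)) \<in> borel_measurable (borel \<Otimes>\<^sub>M borel)" if "t \<in> \<Theta>" for t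
    using p_meas[OF that] by measurable
  have p_mass: "integrable (\<rho> \<Otimes>\<^sub>M \<rho>) (p t)" "(\<integral>z. p t z \<partial>(\<rho> \<Otimes>\<^sub>M \<rho>)) = 1" if t: "t \<in> \<Theta>" for t
  proof -
    have one: "integrable (Q (\<beta> t $ i) \<Otimes>\<^sub>M Q (\<beta> t $ j)) (\<lambda>_. 1 :: real)" for i j
      using prob_space.finite_measure[OF prob_QQ[OF H0_\<beta>[OF t] H0_\<beta>[OF t]]]
      by (intro finite_measure.integrable_const)
    have *: "p t \<in> borel_measurable (\<rho> \<Otimes>\<^sub>M \<rho>)" "\<And>z. 0 \<le> p t z"
      using p_meas[OF t] p_pos[OF t] by (auto simp: less_imp_le cong: measurable_cong_sets[OF sets_\<rho>2 refl])
    have "integrable (\<pi> t) (\<lambda>_. 1 :: real)" by (intro law(1) t one) simp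
    then show "integrable (\<rho> \<Otimes>\<^sub>M \<rho>) (p t)"
      unfolding \<pi>_def using * by (subst (asm) integrable_density) auto
    have "(\<integral>z. 1 \<partial>\<pi> t) = (1 :: real)"
      using sum_transition_weights[OF P_stoch[OF t], of "invariant_pmf (P t)"]
        prob_space.prob_space[OF prob_QQ[OF H0_\<beta>[OF t] H0_\<beta>[OF t]]]
      by (subst law(2)[OF t _ one]) simp_all
    then show "(\<integral>z. p t z \<partial>(\<rho> \<Otimes>\<^sub>M \<rho>)) = 1"
      unfolding \<pi>_def using * by (subst (asm) integral_density) auto
  qed

  \<comment> \<open>Two states with equal parameters could be transposed, a nontrivial relabelling
    forbidden by \<open>H2\<close>.\<close>
  have inj_\<beta>: "inj (($) (\<beta> t))" if t: "t \<in> \<Theta>" for t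
  proof (rule injI)
    fix i k assume eq: "\<beta> t $ i = \<beta> t $ k"
    define \<tau> where "\<tau> x = (if x = i then k else if x = k then i else x)" for x
    have "\<tau> \<circ> \<tau> = id" by (auto simp: \<tau>_def)
    then have "bij \<tau>" using o_bij by blast
    moreover have "\<beta> t $ \<tau> x = \<beta> t $ x" for x using eq by (simp add: \<tau>_def)
    ultimately have "\<tau> i = i" using H2[OF t t] by blast
    then show "i = k" by (simp add: \<tau>_def)
  qed
  have mix: "mixture_identifiable TYPE('m) Obar Q"
    unfolding mixture_identifiable_def
  proof (intro allI impI)
    fix b b' :: "'m \<Rightarrow> real ^ 'd" and c c' :: "'m \<Rightarrow> real" and v
    assume "\<forall>i. b i \<in> Obar \<and> b' i \<in> Obar \<and> 0 \<le> c i \<and> 0 \<le> c' i"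
      "(\<Sum>i\<in>UNIV. c i) = 1" "(\<Sum>i\<in>UNIV. c' i) = 1"
      "\<forall>A\<in>sets borel. (\<Sum>i\<in>UNIV. c i * measure (Q (b i)) A) = (\<Sum>i\<in>UNIV. c' i * measure (Q (b' i)) A)"
    \<comment> \<open>Evaluating the mixtures of point masses on singletons reads off their
      atoms.\<close>
    then have "(\<Sum>i\<in>UNIV. c i * measure (return borel (b i)) {v}) = (\<Sum>i\<in>UNIV. c' i * measure (return borel (b' i)) {v})"
      using H3[of b b' c c'] by (simp add: Q_def)
    then show "(\<Sum>i\<in>UNIV. if b i = v then c i else 0) = (\<Sum>i\<in>UNIV. if b' i = v then c' i else 0)"
      by (simp add: measure_return indicator_def if_distrib sum.If_cases cong: if_cong)
  qed
  have identifiable: "t = \<theta>" if t: "t \<in> \<Theta>" and ae: "AE z in \<rho> \<Otimes>\<^sub>M \<rho>. p \<theta> z = p t z" for t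
  proof -
    have pm: "p s \<in> borel_measurable (\<rho> \<Otimes>\<^sub>M \<rho>)" if "s \<in> \<Theta>" for s
      using p_meas[OF that] by (simp cong: measurable_cong_sets[OF sets_\<rho>2 refl])
    \<comment> \<open>Almost everywhere equal densities give the same pair law; its values on
      rectangles are the bilinear sums to which identifiability applies.\<close>
    have \<pi>_eq: "\<pi> \<theta> = \<pi> t"
      unfolding \<pi>_def using ae pm[OF \<theta>] pm[OF t] by (intro density_cong) auto
    have rect: "(\<integral>z. indicator (A \<times> C) z \<partial>\<pi> s) = (\<Sum>i\<in>UNIV. \<Sum>j\<in>UNIV. pmf (invariant_pmf (P s)) i * P s $ i $ j *
        (measure (Q (\<beta> s $ i)) A * measure (Q (\<beta> s $ j)) C))"
      if s: "s \<in> \<Theta>" and AC: "A \<in> sets borel" "C \<in> sets borel" for s A C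
    proof -
      have AC': "A \<times> C \<in> sets (borel \<Otimes>\<^sub>M borel)" using AC by (rule pair_measureI)
      have "(\<integral>z. indicator (A \<times> C) z \<partial>(Q (\<beta> s $ i) \<Otimes>\<^sub>M Q (\<beta> s $ j)))
          = measure (Q (\<beta> s $ i)) A * measure (Q (\<beta> s $ j)) C" for i j
      proof -
        interpret j: prob_space "Q (\<beta> s $ j)" by (rule prob_Q[OF H0_\<beta>[OF s]])
        have "(\<integral>z. indicator (A \<times> C) z \<partial>(Q (\<beta> s $ i) \<Otimes>\<^sub>M Q (\<beta> s $ j)))
           = measure (Q (\<beta> s $ i) \<Otimes>\<^sub>M Q (\<beta> s $ j)) (A \<times> C)"
          by (simp add: space_pair_measure space_Q)
        also have "\<dots> = measure (Q (\<beta> s $ i)) A * measure (Q (\<beta> s $ j)) C"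
          by (intro measure_pair_Times j.sigma_finite_measure_axioms) (simp_all add: sets_Q AC)
        finally show ?thesis .
      qed
      moreover have "integrable (Q (\<beta> s $ i) \<Otimes>\<^sub>M Q (\<beta> s $ j)) (indicator (A \<times> C) :: _ \<Rightarrow> real)" for i j
        using prob_space.finite_measure[OF prob_QQ[OF H0_\<beta>[OF s] H0_\<beta>[OF s]]] AC'
        by (intro finite_measure.integrable_bounded[where B = 1])
          (auto simp: indicator_def cong: measurable_cong_sets[OF sets_QQ refl])
      ultimately show ?thesis using AC' by (subst law(2)[OF s]) auto
    qed
    note pair = pair_law_identifiable[of Obar Q "($) (\<beta> \<theta>)" "($) (\<beta> t)"
        "pmf (invariant_pmf (P \<theta>))" "pmf (invariant_pmf (P t))" "P \<theta>" "P t",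
        OF mix H0_\<beta>[OF \<theta>] inj_\<beta>[OF \<theta>] H0_\<beta>[OF t] inj_\<beta>[OF t] H2[OF \<theta> t]
          invariant_pmf_pos[OF P_stoch[OF \<theta>] minor[OF \<theta>] \<kappa> n0 \<nu>0] sum_pmf_eq_1
          invariant_pmf_pos[OF P_stoch[OF t] minor[OF t] \<kappa> n0 \<nu>0] sum_pmf_eq_1
          P_stoch[OF \<theta>] P_stoch[OF t] invariant_pmf_invariant[OF P_stoch[OF \<theta>] minor[OF \<theta>] \<kappa> n0]]
    have mass: "measure (Q b) UNIV = 1" if "b \<in> Obar" for b
      using prob_space.prob_space[OF prob_Q[OF that]] by (simp add: space_Q)
    have rect_eq: "(\<Sum>i\<in>UNIV. \<Sum>j\<in>UNIV. pmf (invariant_pmf (P \<theta>)) i * P \<theta> $ i $ j *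
        (measure (Q (\<beta> \<theta> $ i)) A * measure (Q (\<beta> \<theta> $ j)) C)) =
      (\<Sum>i\<in>UNIV. \<Sum>j\<in>UNIV. pmf (invariant_pmf (P t)) i * P t $ i $ j *
        (measure (Q (\<beta> t $ i)) A * measure (Q (\<beta> t $ j)) C))"
      if "A \<in> sets borel" "C \<in> sets borel" for A C
      unfolding rect[OF \<theta> that, symmetric] rect[OF t that, symmetric] \<pi>_eq ..
    have "($) (\<beta> \<theta>) = ($) (\<beta> t)" "P \<theta> = P t"
      by (rule pair; (rule mass rect_eq)?; simp)+
    then have "\<beta> \<theta> = \<beta> t" "P \<theta> = P t" by (simp_all add: vec_eq_iff fun_eq_iff)
    then show "t = \<theta>" using inj_onD[OF H0_inj _ t \<theta>] by simp
  qed

  have p_cont: "continuous_on \<Theta> (\<lambda>t. p t z)" for z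
  proof -
    have cont: "continuous_on \<Theta> P" "continuous_on \<Theta> \<beta>"
      using continuous_on_fst[OF H0_cont] continuous_on_snd[OF H0_cont] by simp_all
    show ?thesis
      unfolding p_def
      by (rule continuous_on_pair_density[OF cont
            continuous_on_invariant_pmf[OF cont(1) P_stoch minor \<kappa> n0] H0_\<beta> r_cont])
  qed
  interpret hmm M "P \<theta>" \<nu> "\<lambda>i. Q (\<beta> \<theta> $ i)" X Y
  proof (intro hmm.intro hmm_axioms.intro)
    show "prob_space M" using HMM by (simp add: hidden_markov_model_def)
  qed (use HMM P_stoch[OF \<theta>] sets_Q prob_Q[OF H0_\<beta>[OF \<theta>]] in \<open>simp_all add: Q_def\<close>)

  show ?thesis
  proof (rule wald_consistency[where T = \<Theta> and \<phi> = "\<lambda>t z. ln (p t z)" and \<pi> = "\<pi> \<theta>" and G = G and W = signal_pair])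
    show "compact \<Theta>" using H0_\<Theta> by (simp add: compact_closure)
    show "(\<lambda>z. ln (p t z)) \<in> borel_measurable (\<pi> \<theta>)" if "t \<in> \<Theta>" for t
      using ln_p_meas[OF that] by (simp cong: measurable_cong_sets[OF sets_\<pi> refl])
    show "continuous_on \<Theta> (\<lambda>t. ln (p t z))" for z
    proof (rule continuous_on_ln)
      show "continuous_on \<Theta> (\<lambda>t. p t z)" by (rule p_cont)
      show "\<forall>t\<in>\<Theta>. p t z \<noteq> 0" using p_pos by (simp add: less_imp_neq[THEN not_sym])
    qed
    show "(\<integral>z. ln (p t z) \<partial>\<pi> \<theta>) < (\<integral>z. ln (p \<theta> z) \<partial>\<pi> \<theta>)" if t: "t \<in> \<Theta>" "t \<noteq> \<theta>" for t
      unfolding \<pi>_def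
    proof (rule gibbs_strict)
      have "integrable (\<pi> \<theta>) (\<lambda>z. ln (p s z))" if "s \<in> \<Theta>" for s
        by (rule dominated[OF G_\<pi>[OF \<theta>] sets_\<pi> ln_p_meas[OF that] ln_p[OF that]])
      then show "integrable (density (\<rho> \<Otimes>\<^sub>M \<rho>) (p \<theta>)) (\<lambda>z. ln (p \<theta> z))"
        "integrable (density (\<rho> \<Otimes>\<^sub>M \<rho>) (p \<theta>)) (\<lambda>z. ln (p t z))"
        using t \<theta> unfolding \<pi>_def by auto
      show "\<not> (AE z in \<rho> \<Otimes>\<^sub>M \<rho>. p \<theta> z = p t z)" using identifiable t by blast
    qed (use p_mass p_pos t \<theta> in auto)
    show "AE \<omega> in M. (\<lambda>n. (\<Sum>k<n. F (signal_pair k \<omega>)) / real n) \<longlonglongrightarrow> (\<integral>z. F z \<partial>\<pi> \<theta>)"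
      if F: "F \<in> borel_measurable (\<pi> \<theta>)" "\<And>z. \<bar>F z\<bar> \<le> G z" for F
    proof -
      have F_meas: "F \<in> borel_measurable (borel \<Otimes>\<^sub>M borel)"
        using F(1) by (simp cong: measurable_cong_sets[OF sets_\<pi> refl])
      have F_int: "integrable (Q (\<beta> \<theta> $ i) \<Otimes>\<^sub>M Q (\<beta> \<theta> $ j)) F" for i j
        by (rule dominated[OF G_QQ[OF H0_\<beta>[OF \<theta>] H0_\<beta>[OF \<theta>]] sets_QQ F_meas F(2)])
      show ?thesis
        using strong_law[OF F_meas F_int minor[OF \<theta>] \<kappa> n0]
        unfolding law(2)[OF \<theta> F_meas F_int] emission_mean_def .
    qed
    \<comment> \<open>Almost surely all signals lie in \<open>E\<close> at once, where the original
      densities are positive and factor through \<open>q b0\<close>.\<close>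
    have "AE \<omega> in M. \<forall>k. Y k \<omega> \<in> E"
      by (subst AE_all_countable) (intro allI AE_signal_in E AE_E H0_\<beta>[OF \<theta>])
    then show "AE \<omega> in M. \<forall>n\<ge>1. \<theta>_hat n \<omega> \<in> \<Theta> \<and>
        (\<Sum>k<n. ln (p \<theta> (signal_pair k \<omega>))) \<le> (\<Sum>k<n. ln (p (\<theta>_hat n \<omega>) (signal_pair k \<omega>)))"
      using ME
    proof eventually_elim
      case (elim \<omega>)
      \<comment> \<open>The first sum does not involve t and cancels when two parameters are
        compared. The index is shifted from k = 1..n to k < n to match
        \<open>signal_pair\<close>.\<close>
      have entropy: "empirical_entropy (P t) (\<beta> t) q n (\<lambda>k. Y k \<omega>)
          = ereal (- (1 / real n * ((\<Sum>k<n. ln (q b0 (Y k \<omega>) * q b0 (Y (Suc k) \<omega>))) + (\<Sum>k<n. ln (p t (signal_pair k \<omega>))))))"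
        if t: "t \<in> \<Theta>" for t n
      proof -
        have "elog (pair_density (P t) (\<beta> t) q (Y k \<omega>) (Y (Suc k) \<omega>))
            = ereal (ln (q b0 (Y k \<omega>) * q b0 (Y (Suc k) \<omega>)) + ln (p t (signal_pair k \<omega>)))" for k
        proof -
          have pos: "0 < q b0 (Y k \<omega>) * q b0 (Y (Suc k) \<omega>)" using elim(1) q0_pos by simp
          have "pair_density (P t) (\<beta> t) q (Y k \<omega>) (Y (Suc k) \<omega>)
              = q b0 (Y k \<omega>) * q b0 (Y (Suc k) \<omega>) * p t (signal_pair k \<omega>)"
            unfolding p_def signal_pair_def fst_conv snd_conv using elim(1) H0_\<beta>[OF t]
            by (intro pair_density_scale q_eq) auto
          then show ?thesis by (simp only: elog_mult[OF pos p_pos[OF t]])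
        qed
        then show ?thesis
          unfolding empirical_entropy_def
          by (simp add: sum.atLeast1_atMost_eq sum.distrib sum_ereal)
      qed
      show ?case
      proof (intro allI impI)
        fix n :: nat assume n: "1 \<le> n"
        have est: "\<theta>_hat n \<omega> \<in> \<Theta>" "empirical_entropy (P (\<theta>_hat n \<omega>)) (\<beta> (\<theta>_hat n \<omega>)) q n (\<lambda>k. Y k \<omega>)
            \<le> empirical_entropy (P \<theta>) (\<beta> \<theta>) q n (\<lambda>k. Y k \<omega>)"
          using elim(2)[rule_format, OF n] \<theta> by (auto simp: is_arg_min_linorder)
        from est(2) show "\<theta>_hat n \<omega> \<in> \<Theta> \<and> (\<Sum>k<n. ln (p \<theta> (signal_pair k \<omega>))) \<le> (\<Sum>k<n. ln (p (\<theta>_hat n \<omega>) (signal_pair k \<omega>)))"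
          unfolding entropy[OF est(1)] entropy[OF \<theta>] using n est(1)
          by (simp add: divide_le_cancel)
      qed
    qed
  qed (use \<theta> ln_p G_\<pi> in auto)
qed

end
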